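(* Let $P$ and $Q$ be two latent variable models on $\mathcal{X}$ with conditional scores $\mathbf{s}_p(x|z)$ and $\mathbf{s}_q(x|w)$, let $R$ be a probability distribution on $\mathcal{X}$, and let $m\ge 1$. For each $t\ge1$ let $\mathbf{y}^{(t)}=(x,\mathbf{z}^{(t)},\mathbf{w}^{(t)})$ be a random variable in which $x\sim R$ and, conditionally on $x$, $\mathbf{z}^{(t)}\in\mathcal{Z}^m$ and $\mathbf{w}^{(t)}\in\mathcal{W}^m$ are draws of size $m$ from the Markov chains of $P$ and $Q$ respectively (targeting $P_Z(\cdot|x)$ and $Q_W(\cdot|x)$) after $t$ burn-in steps. Let $\mathbf{y}_1^{(t)},\dots,\mathbf{y}_n^{(t)}$ be i.i.d. copies of $\mathbf{y}^{(t)}$, let $\bar H_{p,q}$ be the difference kernel defined in the context, and put $$U_n^{(t)}(P,Q)=\frac{1}{n(n-1)}\sum_{i\ne j}\bar H_{p,q}[\mathbf{y}_i^{(t)},\mathbf{y}_j^{(t)}],\qquad v_{n,t}=(n-1)\sum_{i=1}^n\bigl(U_{n,-i}^{(t)}(P,Q)-U_n^{(t)}(P,Q)\bigr)^2,$$ where $U_{n,-i}^{(t)}(P,Q)$ is the same U-statistic computed on the sample with the $i$-th point $\mathbf{y}_i^{(t)}$ removed. Let $\mu_{P,Q}=\mathrm{KSD}^2(P\Vert R)-\mathrm{KSD}^2(Q\Vert R)$ and $\theta_t=\mathbb{E}\bigl[\bar H_{p,q}[\mathbf{y}_1^{(t)},\mathbf{y}_2^{(t)}]\bigr]$. Assume: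 (a) $\limsup_{t\to\infty}\mathbb{E}\bigl[\bar H_{p,q}[\mathbf{y}_1^{(t)},\mathbf{y}_2^{(t)}]^4\bigr]<\infty$; (b) $\limsup_{t\to\infty}\mathbb{E}\bigl[|\bar H_{p,q}[\mathbf{y}_1^{(t)},\mathbf{y}_2^{(t)}]-\theta_t|^3\bigr]^{1/3}<\infty$; (c) $\sigma_t^2=4\,\mathrm{Var}\bigl[\mathbb{E}\bigl[\bar H_{p,q}[\mathbf{y}_1^{(t)},\mathbf{y}_2^{(t)}]\,\big|\,\mathbf{y}_2^{(t)}\bigr]\bigr]$ converges as $t\to\infty$ to a constant $\sigma_{P,Q}^2>0$; (d) $\theta_t\to\mu_{P,Q}$ as $t\to\infty$. Then, as $n\to\infty$ with $t=t(n)\to\infty$ growing as a function of $n$ such that $\sqrt{n}\,(\theta_{t(n)}-\mu_{P,Q})\to0$, $$\frac{\sqrt{n}\,\bigl(U_n^{(t)}(P,Q)-\mu_{P,Q}\bigr)}{\sqrt{v_{n,t}}}\ \longrightarrow\ \mathcal{N}(0,1)\quad\text{in distribution}.$$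
   Context: **Observation space.** $\mathcal{X}$ is either $\mathbb{R}^D$ (densities with respect to Lebesgue measure, strictly positive and continuously differentiable) or $\{0,\dots,L-1\}^D$ with $L>1$ (densities are strictly positive probability mass functions). **Difference operators (discrete case).** $\Delta_d f(x)=f(x^1,\dots,x^d+1 \bmod L,\dots,x^D)-f(x)$, $\Delta_d^{-1}f(x)=f(x)-f(x^1,\dots,x^d-1\bmod L,\dots,x^D)$, $\Delta=(\Delta_1,\dots,\Delta_D)$, $\Delta^{-1}=(\Delta_1^{-1},\dots,\Delta_D^{-1})$. **Latent variable models.** $\mathcal{Z},\mathcal{W}$ are Polish spaces. $P$ is given by a family of densities $\{p(\cdot|z):z\in\mathcal{Z}\}$ on $\mathcal{X}$ and a prior probability measure $P_Z$ on $\mathcal{Z}$; its marginal density is $p(x)=\int p(x|z)\,dP_Z(z)$ and its posterior is $P_Z(dz|x)=\{p(x|z)/p(x)\}P_Z(dz)$. $Q$ is given in the same way by $\{q(\cdot|w):w\in\mathcal{W}\}$ and a prior $Q_W$. The conditional score is $\mathbf{s}_p(x|z)=p(x|z)^{-1}\nabla_x p(x|z)$ (continuous case) or $p(x|z)^{-1}\Delta_x p(x|z)$ (discrete case), and the marginal score is $\mathbf{s}_p(x)=p(x)^{-1}\nabla p(x)$ or $p(x)^{-1}\Delta p(x)$; similarly for $q$. **Kernel.** $k:\mathcal{X}\times\mathcal{X}\to\mathbb{R}$ is a positive definite kernel, continuously differentiable in each argument with continuous mixed derivatives in the continuous case. In the continuous case $k_1(a,b)=\nabla_x k(x,x')|_{x=a,x'=b}\in\mathbb{R}^D$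 and $k_{12}(a,b)=\nabla_x^\top\nabla_{x'}k(x,x')|_{x=a,x'=b}\in\mathbb{R}$; in the discrete case $\nabla$ is replaced by $\Delta^{-1}$ in these two definitions. **KSD.** $\mathcal{F}$ is the space of $f=(f_1,\dots,f_D)$ with each $f_d$ in the RKHS of $k$, with $\langle f,g\rangle_{\mathcal F}=\sum_d\langle f_d,g_d\rangle$. The Stein operator is $\mathcal{A}_Pf(x)=\langle\mathbf{s}_p(x),f(x)\rangle+\langle\nabla,f(x)\rangle$ (continuous) or $\mathcal{A}_Pf(x)=\mathrm{tr}[f(x)\mathbf{s}_p(x)^\top+\Delta^{-1}f(x)]$ (discrete), and $\mathrm{KSD}(P\Vert R)=\sup_{\|f\|_{\mathcal F}\le1}|\mathbb{E}_{x\sim R}\mathcal{A}_Pf(x)-\mathbb{E}_{y\sim P}\mathcal{A}_Pf(y)|$, where it is a standing assumption that $\mathbb{E}_{y\sim P}\mathcal{A}_Pf(y)=0$ for all $f\in\mathcal F$ (and likewise for $Q$), and that $\mathrm{KSD}(P\Vert R)$ and $\mathrm{KSD}(Q\Vert R)$ are finite. **Difference kernel.** For $\mathbf{z}=(z_1,\dots,z_m)$ let $\bar{\mathbf{s}}_p(x|\mathbf{z})=\frac1m\sum_{j=1}^m\mathbf{s}_p(x|z_j)$, and $$\bar H_p[(x,\mathbf{z}),(x',\mathbf{z}')]=\bar{\mathbf{s}}_p(x|\mathbf{z})^\top\bar{\mathbf{s}}_p(x'|\mathbf{z}')k(x,x')+\bar{\mathbf{s}}_p(x|\mathbf{z})^\top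 k_1(x',x)+k_1(x,x')^\top\bar{\mathbf{s}}_p(x'|\mathbf{z}')+k_{12}(x,x').$$ $\bar H_q$ is defined analogously from $\mathbf{s}_q(x|w)$, and $\bar H_{p,q}[(x,\mathbf{z},\mathbf{w}),(x',\mathbf{z}',\mathbf{w}')]=\bar H_p[(x,\mathbf{z}),(x',\mathbf{z}')]-\bar H_q[(x,\mathbf{w}),(x',\mathbf{w}')]$. *)

theory Defs
  imports "HOL-Probability.Probability" "HOL-Library.Real_Mod"
begin

section \<open>Observation spaces and difference operators\<close>

text \<open>Both kinds of observation space live inside \<open>real ^ 'd\<close>, with \<open>D = CARD('d)\<close>: the whole space,
  or the lattice of vectors with entries in \<open>{0, \<dots>, L - 1}\<close>. The space itself, its sigma-algebra
  and the measure with respect to which densities are taken are those of \<open>obs_base\<close>.\<close>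

datatype obs_space = Continuous | Discrete nat

definition grid :: "nat \<Rightarrow> (real ^ 'd::finite) set" where
  "grid L = {x. \<forall>i. \<exists>j<L. x $ i = real j}"

definition obs_base :: "obs_space \<Rightarrow> (real ^ 'd::finite) measure" where
  "obs_base os = (case os of Continuous \<Rightarrow> lborel | Discrete L \<Rightarrow> count_space (grid L))"

definition valid_obs :: "obs_space \<Rightarrow> bool" where
  "valid_obs os \<longleftrightarrow> (case os of Continuous \<Rightarrow> True | Discrete L \<Rightarrow> L > 1)"

definition pderiv_at :: "'d::finite \<Rightarrow> (real ^ 'd \<Rightarrow> real) \<Rightarrow> real ^ 'd \<Rightarrow> real" where
  "pderiv_at d f x = deriv (\<lambda>h. f (x + h *\<^sub>R axis d 1)) 0"

definition cyc_shift :: "nat \<Rightarrow> 'd::finite \<Rightarrow> real \<Rightarrow> real ^ 'd \<Rightarrow> real ^ 'd" where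
  "cyc_shift L d c x = (\<chi> i. if i = d then (x $ d + c) rmod real L else x $ i)"

text \<open>\<open>fwd\<close> is the operator in the scores (partial derivative, or forward cyclic difference);
  \<open>bwd\<close> is the one applied to kernels and test functions (partial derivative, or backward cyclic
  difference).\<close>

definition fwd :: "obs_space \<Rightarrow> 'd::finite \<Rightarrow> (real ^ 'd \<Rightarrow> real) \<Rightarrow> real ^ 'd \<Rightarrow> real" where
  "fwd os d f x =
     (case os of Continuous \<Rightarrow> pderiv_at d f x | Discrete L \<Rightarrow> f (cyc_shift L d 1 x) - f x)"

definition bwd :: "obs_space \<Rightarrow> 'd::finite \<Rightarrow> (real ^ 'd \<Rightarrow> real) \<Rightarrow> real ^ 'd \<Rightarrow> real" where
  "bwd os d f x =
     (case os of Continuous \<Rightarrow> pderiv_at d f x | Discrete L \<Rightarrow> f x - f (cyc_shift L d (-1) x))"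

definition cont_diff :: "(real ^ 'd::finite \<Rightarrow> real) \<Rightarrow> bool" where
  "cont_diff f \<longleftrightarrow> (\<forall>x. f differentiable (at x)) \<and> (\<forall>d. continuous_on UNIV (pderiv_at d f))"

definition is_density :: "obs_space \<Rightarrow> (real ^ 'd::finite \<Rightarrow> real) \<Rightarrow> bool" where
  "is_density os f \<longleftrightarrow>
     f \<in> borel_measurable (obs_base os) \<and>
     (\<forall>x\<in>space (obs_base os). 0 < f x) \<and>
     (\<integral>\<^sup>+ x. ennreal (f x) \<partial>obs_base os) = 1 \<and>
     (os = Continuous \<longrightarrow> cont_diff f)"


section \<open>Latent variable models and their scores\<close>

record ('z, 'd) lvm =
  lik :: "'z \<Rightarrow> real ^ 'd::finite \<Rightarrow> real"
  prior :: "'z measure"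

definition marginal :: "('z, 'd::finite) lvm \<Rightarrow> real ^ 'd \<Rightarrow> real" where
  "marginal P x = (\<integral> z. lik P z x \<partial>prior P)"

definition marginal_dist :: "obs_space \<Rightarrow> ('z, 'd::finite) lvm \<Rightarrow> (real ^ 'd) measure" where
  "marginal_dist os P = density (obs_base os) (\<lambda>x. ennreal (marginal P x))"

definition posterior :: "('z, 'd::finite) lvm \<Rightarrow> real ^ 'd \<Rightarrow> 'z measure" where
  "posterior P x = density (prior P) (\<lambda>z. ennreal (lik P z x / marginal P x))"

definition latent_model :: "obs_space \<Rightarrow> ('z::polish_space, 'd::finite) lvm \<Rightarrow> bool" where
  "latent_model os P \<longleftrightarrow>
     prob_space (prior P) \<and> sets (prior P) = sets borel \<and>
     (\<lambda>(x, z). lik P z x) \<in> borel_measurable (obs_base os \<Otimes>\<^sub>M borel) \<and>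
     (\<forall>z. is_density os (lik P z)) \<and>
     (\<forall>x\<in>space (obs_base os). integrable (prior P) (\<lambda>z. lik P z x)) \<and>
     is_density os (marginal P)"

definition cond_score :: "obs_space \<Rightarrow> ('z, 'd::finite) lvm \<Rightarrow> real ^ 'd \<Rightarrow> 'z \<Rightarrow> real ^ 'd" where
  "cond_score os P x z = (\<chi> d. fwd os d (lik P z) x / lik P z x)"

definition marginal_score :: "obs_space \<Rightarrow> ('z, 'd::finite) lvm \<Rightarrow> real ^ 'd \<Rightarrow> real ^ 'd" where
  "marginal_score os P x = (\<chi> d. fwd os d (marginal P) x / marginal P x)"


section \<open>Kernels, RKHS and the kernel Stein discrepancy\<close>

definition pos_def_kernel :: "'a set \<Rightarrow> ('a \<Rightarrow> 'a \<Rightarrow> real) \<Rightarrow> bool" where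
  "pos_def_kernel X k \<longleftrightarrow>
     (\<forall>x\<in>X. \<forall>y\<in>X. k x y = k y x) \<and>
     (\<forall>S c. finite S \<and> S \<subseteq> X \<longrightarrow> 0 \<le> (\<Sum>x\<in>S. \<Sum>y\<in>S. c x * c y * k x y))"

text \<open>As \<open>deriv\<close> is total, the existence of the mixed partial derivatives is asserted separately.\<close>

definition kernel_smooth :: "(real ^ 'd::finite \<Rightarrow> real ^ 'd \<Rightarrow> real) \<Rightarrow> bool" where
  "kernel_smooth k \<longleftrightarrow>
     (\<forall>b. cont_diff (\<lambda>a. k a b)) \<and> (\<forall>a. cont_diff (\<lambda>b. k a b)) \<and>
     (\<forall>i j a b. (\<lambda>h. pderiv_at j (k (a + h *\<^sub>R axis i 1)) b) field_differentiable (at 0)) \<and>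
     (\<forall>i j. continuous_on UNIV (\<lambda>(a, b). pderiv_at i (\<lambda>a'. pderiv_at j (k a') b) a))"

definition stein_kernel :: "obs_space \<Rightarrow> (real ^ 'd::finite \<Rightarrow> real ^ 'd \<Rightarrow> real) \<Rightarrow> bool" where
  "stein_kernel os k \<longleftrightarrow>
     pos_def_kernel (space (obs_base os)) k \<and> (os = Continuous \<longrightarrow> kernel_smooth k)"

text \<open>\<open>H\<close> with inner product \<open>ip\<close> is the reproducing kernel Hilbert space of \<open>k\<close> on \<open>X\<close>. Functions
  on \<open>X\<close> are represented by functions vanishing off \<open>X\<close>.\<close>

definition is_rkhs ::
  "'a set \<Rightarrow> ('a \<Rightarrow> 'a \<Rightarrow> real) \<Rightarrow> ('a \<Rightarrow> real) set \<Rightarrow> (('a \<Rightarrow> real) \<Rightarrow> ('a \<Rightarrow> real) \<Rightarrow> real) \<Rightarrow> bool"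
where
  "is_rkhs X k H ip \<longleftrightarrow>
     (\<forall>f\<in>H. \<forall>x. x \<notin> X \<longrightarrow> f x = 0) \<and>
     (\<lambda>_. 0) \<in> H \<and>
     (\<forall>f\<in>H. \<forall>g\<in>H. (\<lambda>x. f x + g x) \<in> H) \<and>
     (\<forall>f\<in>H. \<forall>c. (\<lambda>x. c * f x) \<in> H) \<and>
     (\<forall>f\<in>H. \<forall>g\<in>H. ip f g = ip g f) \<and>
     (\<forall>f\<in>H. \<forall>g\<in>H. \<forall>h\<in>H. ip (\<lambda>x. f x + g x) h = ip f h + ip g h) \<and>
     (\<forall>f\<in>H. \<forall>g\<in>H. \<forall>c. ip (\<lambda>x. c * f x) g = c * ip f g) \<and>
     (\<forall>f\<in>H. 0 \<le> ip f f \<and> (ip f f = 0 \<longrightarrow> f = (\<lambda>_. 0))) \<and>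
     (\<forall>F :: nat \<Rightarrow> 'a \<Rightarrow> real.
        (\<forall>n. F n \<in> H) \<and>
        (\<forall>e>0. \<exists>N. \<forall>m\<ge>N. \<forall>n\<ge>N. sqrt (ip (\<lambda>x. F m x - F n x) (\<lambda>x. F m x - F n x)) < e) \<longrightarrow>
        (\<exists>f\<in>H. (\<lambda>n. sqrt (ip (\<lambda>x. F n x - f x) (\<lambda>x. F n x - f x))) \<longlonglongrightarrow> 0)) \<and>
     (\<forall>y\<in>X. (\<lambda>x. if x \<in> X then k x y else 0) \<in> H \<and>
        (\<forall>f\<in>H. ip f (\<lambda>x. if x \<in> X then k x y else 0) = f y))"

definition stein_op ::
  "obs_space \<Rightarrow> ('z, 'd::finite) lvm \<Rightarrow> ('d \<Rightarrow> real ^ 'd \<Rightarrow> real) \<Rightarrow> real ^ 'd \<Rightarrow> real" where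
  "stein_op os P f x = (\<Sum>d\<in>UNIV. marginal_score os P x $ d * f d x + bwd os d (f d) x)"

definition product_ball ::
  "(real ^ 'd::finite \<Rightarrow> real) set \<Rightarrow> ((real ^ 'd \<Rightarrow> real) \<Rightarrow> (real ^ 'd \<Rightarrow> real) \<Rightarrow> real) \<Rightarrow>
     ('d \<Rightarrow> real ^ 'd \<Rightarrow> real) set" where
  "product_ball H ip = {f. (\<forall>d. f d \<in> H) \<and> sqrt (\<Sum>d\<in>UNIV. ip (f d) (f d)) \<le> 1}"

definition ksd ::
  "obs_space \<Rightarrow> (real ^ 'd::finite \<Rightarrow> real) set \<Rightarrow>
     ((real ^ 'd \<Rightarrow> real) \<Rightarrow> (real ^ 'd \<Rightarrow> real) \<Rightarrow> real) \<Rightarrow>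
     ('z, 'd) lvm \<Rightarrow> (real ^ 'd) measure \<Rightarrow> ereal" where
  "ksd os H ip P R =
     (SUP f\<in>product_ball H ip.
        ereal \<bar>(\<integral> x. stein_op os P f x \<partial>R) - (\<integral> y. stein_op os P f y \<partial>marginal_dist os P)\<bar>)"

text \<open>The standing assumptions on the discrepancy. Integrability says that the expectations in
  \<open>ksd\<close> exist; the Bochner integral of a non-integrable function would be \<open>0\<close>.\<close>

definition ksd_assms ::
  "obs_space \<Rightarrow> (real ^ 'd::finite \<Rightarrow> real) set \<Rightarrow>
     ((real ^ 'd \<Rightarrow> real) \<Rightarrow> (real ^ 'd \<Rightarrow> real) \<Rightarrow> real) \<Rightarrow>
     ('z, 'd) lvm \<Rightarrow> (real ^ 'd) measure \<Rightarrow> bool" where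
  "ksd_assms os H ip P R \<longleftrightarrow>
     (\<forall>f. (\<forall>d. f d \<in> H) \<longrightarrow>
        integrable (marginal_dist os P) (stein_op os P f) \<and>
        (\<integral> y. stein_op os P f y \<partial>marginal_dist os P) = 0 \<and>
        integrable R (stein_op os P f)) \<and>
     ksd os H ip P R < \<infinity>"


section \<open>The difference kernel\<close>

definition ker1 ::
  "obs_space \<Rightarrow> (real ^ 'd::finite \<Rightarrow> real ^ 'd \<Rightarrow> real) \<Rightarrow> real ^ 'd \<Rightarrow> real ^ 'd \<Rightarrow> real ^ 'd" where
  "ker1 os k a b = (\<chi> d. bwd os d (\<lambda>x. k x b) a)"

definition ker12 ::
  "obs_space \<Rightarrow> (real ^ 'd::finite \<Rightarrow> real ^ 'd \<Rightarrow> real) \<Rightarrow> real ^ 'd \<Rightarrow> real ^ 'd \<Rightarrow> real" where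
  "ker12 os k a b = (\<Sum>d\<in>UNIV. bwd os d (\<lambda>x. bwd os d (\<lambda>x'. k x x') b) a)"

text \<open>A tuple of \<open>m\<close> latent values is a function on \<open>{1..m}\<close>, an element of a product space
  \<open>PiM {1..m}\<close>.\<close>

definition mean_score ::
  "obs_space \<Rightarrow> ('z, 'd::finite) lvm \<Rightarrow> nat \<Rightarrow> real ^ 'd \<Rightarrow> (nat \<Rightarrow> 'z) \<Rightarrow> real ^ 'd" where
  "mean_score os P m x zs = (1 / real m) *\<^sub>R (\<Sum>j\<in>{1..m}. cond_score os P x (zs j))"

definition Hbar ::
  "obs_space \<Rightarrow> (real ^ 'd::finite \<Rightarrow> real ^ 'd \<Rightarrow> real) \<Rightarrow> nat \<Rightarrow> ('z, 'd) lvm \<Rightarrow>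
     (real ^ 'd) \<times> (nat \<Rightarrow> 'z) \<Rightarrow> (real ^ 'd) \<times> (nat \<Rightarrow> 'z) \<Rightarrow> real" where
  "Hbar os k m P = (\<lambda>(x, zs) (x', zs').
     (mean_score os P m x zs \<bullet> mean_score os P m x' zs') * k x x'
     + mean_score os P m x zs \<bullet> ker1 os k x' x
     + ker1 os k x x' \<bullet> mean_score os P m x' zs'
     + ker12 os k x x')"

definition Hdiff ::
  "obs_space \<Rightarrow> (real ^ 'd::finite \<Rightarrow> real ^ 'd \<Rightarrow> real) \<Rightarrow> nat \<Rightarrow> ('z, 'd) lvm \<Rightarrow> ('w, 'd) lvm \<Rightarrow>
     (real ^ 'd) \<times> (nat \<Rightarrow> 'z) \<times> (nat \<Rightarrow> 'w) \<Rightarrow> (real ^ 'd) \<times> (nat \<Rightarrow> 'z) \<times> (nat \<Rightarrow> 'w) \<Rightarrow> real" where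
  "Hdiff os k m P Q = (\<lambda>(x, zs, ws) (x', zs', ws').
     Hbar os k m P (x, zs) (x', zs') - Hbar os k m Q (x, ws) (x', ws'))"


section \<open>Markov chain samples\<close>

text \<open>For every observation \<open>x\<close>, a time-homogeneous chain on the latent space with initial
  distribution \<open>chain_init c x\<close> and transition kernel \<open>chain_step c x\<close>.\<close>

record ('z, 'd) sampler =
  chain_init :: "real ^ 'd::finite \<Rightarrow> 'z measure"
  chain_step :: "real ^ 'd \<Rightarrow> 'z \<Rightarrow> 'z measure"

definition targets_posterior ::
  "obs_space \<Rightarrow> ('z::polish_space, 'd::finite) lvm \<Rightarrow> ('z, 'd) sampler \<Rightarrow> bool" where
  "targets_posterior os P c \<longleftrightarrow>
     chain_init c \<in> obs_base os \<rightarrow>\<^sub>M prob_algebra borel \<and>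
     (\<lambda>(x, z). chain_step c x z) \<in> obs_base os \<Otimes>\<^sub>M borel \<rightarrow>\<^sub>M prob_algebra borel \<and>
     (\<forall>x\<in>space (obs_base os). posterior P x \<bind> chain_step c x = posterior P x)"

text \<open>The law of the first \<open>n\<close> states of the chain.\<close>

definition chain_path ::
  "('z::polish_space, 'd::finite) sampler \<Rightarrow> real ^ 'd \<Rightarrow> nat \<Rightarrow> (nat \<Rightarrow> 'z) measure" where
  "chain_path c x n =
     Ionescu_Tulcea.C
       (\<lambda>s \<omega>. if s = 0 then chain_init c x else chain_step c x (\<omega> (s - 1))) (\<lambda>_. borel)
       0 n (\<lambda>_. undefined)"

text \<open>State \<open>0\<close> is the initial one, so the \<open>m\<close> states following \<open>t\<close> burn-in steps are
  \<open>t + 1, \<dots>, t + m\<close>.\<close>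

definition chain_sample ::
  "('z::polish_space, 'd::finite) sampler \<Rightarrow> nat \<Rightarrow> nat \<Rightarrow> real ^ 'd \<Rightarrow> (nat \<Rightarrow> 'z) measure" where
  "chain_sample c m t x =
     distr (chain_path c x (t + m + 1)) (PiM {1..m} (\<lambda>_. borel))
       (\<lambda>\<omega>. \<lambda>j\<in>{1..m}. \<omega> (t + j))"

text \<open>\<open>X\<close> has law \<open>R\<close>, and \<open>\<kappa>\<close> is a regular version of the conditional law of \<open>Z\<close> given \<open>X\<close>.\<close>

definition has_cond_law ::
  "'o measure \<Rightarrow> ('o \<Rightarrow> 'a) \<Rightarrow> 'a measure \<Rightarrow> ('o \<Rightarrow> 'b) \<Rightarrow> 'b measure \<Rightarrow> ('a \<Rightarrow> 'b measure) \<Rightarrow> bool"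
where
  "has_cond_law M X R Z N \<kappa> \<longleftrightarrow>
     distr M R X = R \<and>
     (\<forall>A\<in>sets R. \<forall>B\<in>sets N.
        emeasure M {\<omega>\<in>space M. X \<omega> \<in> A \<and> Z \<omega> \<in> B} = (\<integral>\<^sup>+ x\<in>A. emeasure (\<kappa> x) B \<partial>R))"

definition sample_space ::
  "obs_space \<Rightarrow> nat \<Rightarrow>
     ((real ^ 'd::finite) \<times> (nat \<Rightarrow> 'z::polish_space) \<times> (nat \<Rightarrow> 'w::polish_space)) measure" where
  "sample_space os m =
     obs_base os \<Otimes>\<^sub>M (PiM {1..m} (\<lambda>_. borel) \<Otimes>\<^sub>M PiM {1..m} (\<lambda>_. borel))"

text \<open>\<open>y\<close> is a random variable \<open>(x, z, w)\<close> with \<open>x\<close> drawn from \<open>R\<close> and, given \<open>x\<close>, \<open>z\<close> and \<open>w\<close>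
  drawn from the respective chains after \<open>t\<close> burn-in steps.\<close>

definition is_chain_draw ::
  "obs_space \<Rightarrow> (real ^ 'd::finite) measure \<Rightarrow> ('z::polish_space, 'd) sampler \<Rightarrow>
     ('w::polish_space, 'd) sampler \<Rightarrow> nat \<Rightarrow> nat \<Rightarrow> 'o measure \<Rightarrow>
     ('o \<Rightarrow> (real ^ 'd) \<times> (nat \<Rightarrow> 'z) \<times> (nat \<Rightarrow> 'w)) \<Rightarrow> bool" where
  "is_chain_draw os R cP cQ m t M y \<longleftrightarrow>
     y \<in> M \<rightarrow>\<^sub>M sample_space os m \<and>
     has_cond_law M (\<lambda>\<omega>. fst (y \<omega>)) R
       (\<lambda>\<omega>. fst (snd (y \<omega>))) (PiM {1..m} (\<lambda>_. borel)) (chain_sample cP m t) \<and>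
     has_cond_law M (\<lambda>\<omega>. fst (y \<omega>)) R
       (\<lambda>\<omega>. snd (snd (y \<omega>))) (PiM {1..m} (\<lambda>_. borel)) (chain_sample cQ m t)"


section \<open>U-statistics and their jackknife variance\<close>

definition iid_vars :: "'o measure \<Rightarrow> 'y measure \<Rightarrow> (nat \<Rightarrow> 'o \<Rightarrow> 'y) \<Rightarrow> nat set \<Rightarrow> bool" where
  "iid_vars M N Y I \<longleftrightarrow>
     prob_space.indep_vars M (\<lambda>_. N) Y I \<and> (\<forall>i\<in>I. \<forall>j\<in>I. distr M N (Y i) = distr M N (Y j))"

definition ustat :: "('y \<Rightarrow> 'y \<Rightarrow> real) \<Rightarrow> nat set \<Rightarrow> (nat \<Rightarrow> 'y) \<Rightarrow> real" where
  "ustat h I y =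
     (\<Sum>(i, j) | i \<in> I \<and> j \<in> I \<and> i \<noteq> j. h (y i) (y j)) / (real (card I) * (real (card I) - 1))"

definition jackknife_var :: "('y \<Rightarrow> 'y \<Rightarrow> real) \<Rightarrow> nat \<Rightarrow> (nat \<Rightarrow> 'y) \<Rightarrow> real" where
  "jackknife_var h n y =
     (real n - 1) * (\<Sum>i\<in>{1..n}. (ustat h ({1..n} - {i}) y - ustat h {1..n} y)\<^sup>2)"

text \<open>The quantity E[|X|^p]^(1/p), infinite if the moment is.\<close>

definition moment_norm :: "real \<Rightarrow> 'o measure \<Rightarrow> ('o \<Rightarrow> real) \<Rightarrow> ereal" where
  "moment_norm p M X =
     (if integrable M (\<lambda>\<omega>. \<bar>X \<omega>\<bar> powr p)
      then ereal ((\<integral> \<omega>. \<bar>X \<omega>\<bar> powr p \<partial>M) powr (1 / p)) else \<infinity>)"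

end

theory Submission
  imports Defs "HOL-Real_Asymp.Real_Asymp"
begin

text \<open>For fixed \<open>t\<close> put \<open>g(a) = E h(a, y) - \<theta>\<close>. Hoeffding's decomposition gives
  \<open>U - \<theta> = 2/n * (sum of g(y_i)) + R\<close>, where \<open>R\<close> is an average of pairwise orthogonal terms, so
  \<open>E R\<^sup>2 = O(1/n\<^sup>2)\<close>. The jackknife standard deviation is, up to a factor tending to \<open>2\<close>, the root mean
  square of \<open>q_i - U\<close> with \<open>q_i\<close> the mean of \<open>h(y_i, y_j)\<close> over \<open>j \<noteq> i\<close>; as \<open>q_i - \<theta> - g(y_i)\<close> is
  \<open>O(1 / sqrt n)\<close> in \<open>L\<^sup>2\<close>, it is close in \<open>L\<^sup>2\<close> to \<open>2 sqrt(E g\<^sup>2) = \<sigma>_t\<close>. All error bounds depend only on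
  the fourth moment of \<open>h\<close>, hence hold uniformly along \<open>t = t(n)\<close>; the same bound gives a central
  limit theorem for the triangular array \<open>g(y_i)\<close> through characteristic functions.\<close>

section \<open>U-statistics and the jackknife\<close>

text \<open>The law of the sample moves with \<open>t(n)\<close>, so there is no single i.i.d.
  sequence behind the limit. Every asymptotic step is therefore an explicit inequality at fixed
  \<open>n\<close>, in which the law enters only through the fourth moment of \<open>h\<close>, the
  variance of \<open>g\<close> and the bias; limits are taken once, at the end. The jackknife works
  because deleting a point changes \<open>U\<close> by exactly \<open>-2/(n-2)\<close> times
  \<open>q_i - U\<close>. The weak law for the mean of \<open>g(y_i)^2\<close> requires the variance
  of \<open>g^2\<close>, which is what calls for fourth moments. The bias
  \<open>sqrt n (\<theta> - \<mu>)\<close> is carried as one more linearisation error. The concrete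
  kernel must still be shown jointly measurable, for Fubini, and symmetric, for the deletion formula
  and for degeneracy in both arguments; on a continuous space symmetry includes that of the mixed
  derivatives under exchange of the two points. Finally the conditional expectation that defines
  \<open>\<sigma>_t\<close> has to be identified with an integral over a section of
  \<open>h\<close>.\<close>

lemma ustat_altdef:
  assumes "finite I"
  shows "ustat h I y =
    (\<Sum>i\<in>I. \<Sum>j\<in>I - {i}. h (y i) (y j)) / (real (card I) * (real (card I) - 1))"
proof -
  have "{(i, j). i \<in> I \<and> j \<in> I \<and> i \<noteq> j} = Sigma I (\<lambda>i. I - {i})"
    by auto
  then show ?thesis
    unfolding ustat_def using assms by (simp add: sum.Sigma)
qed

text \<open>The \<open>q_i\<close> of the overview: the sample analogue of the conditional mean of
  the kernel given the \<open>i\<close>-th point, with the diagonal term left out.\<close>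

definition row_mean :: "('y \<Rightarrow> 'y \<Rightarrow> real) \<Rightarrow> nat \<Rightarrow> (nat \<Rightarrow> 'y) \<Rightarrow> nat \<Rightarrow> real" where
  "row_mean h n y i = (\<Sum>j\<in>{1..n} - {i}. h (y i) (y j)) / (real n - 1)"

lemma ustat_eq_mean_row_mean:
  "ustat h {1..n} y = (\<Sum>i\<in>{1..n}. row_mean h n y i) / real n"
  by (simp add: ustat_altdef row_mean_def sum_divide_distrib mult.commute)

text \<open>Removing point \<open>i\<close> deletes row \<open>i\<close> and column \<open>i\<close>
  from the array of off-diagonal values. By symmetry both have the sum \<open>T\<close>, so the
  total falls from \<open>S\<close> to \<open>S - 2 * T\<close>, and the rest is algebra. The bound
  \<open>n \<ge> 3\<close> keeps the denominator \<open>n - 2\<close> positive.\<close>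

lemma ustat_minus_point:
  assumes n: "n \<ge> 3" and i: "i \<in> {1..n}"
    and sym: "\<And>j. j \<in> {1..n} \<Longrightarrow> h (y j) (y i) = h (y i) (y j)"
  shows "ustat h ({1..n} - {i}) y - ustat h {1..n} y =
    - (2 / (real n - 2)) * (row_mean h n y i - ustat h {1..n} y)"
proof -
  let ?I = "{1..n}"
  define S where "S = (\<Sum>a\<in>?I. \<Sum>b\<in>?I - {a}. h (y a) (y b))"
  define T where "T = (\<Sum>b\<in>?I - {i}. h (y i) (y b))"
  have "(\<Sum>a\<in>?I - {i}. \<Sum>b\<in>?I - {i} - {a}. h (y a) (y b)) =
      (\<Sum>a\<in>?I - {i}. (\<Sum>b\<in>?I - {a}. h (y a) (y b)) - h (y a) (y i))"
  proof (rule sum.cong)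
    fix a assume a: "a \<in> ?I - {i}"
    have "?I - {i} - {a} = (?I - {a}) - {i}" by auto
    then show "(\<Sum>b\<in>?I - {i} - {a}. h (y a) (y b)) = (\<Sum>b\<in>?I - {a}. h (y a) (y b)) - h (y a) (y i)"
      using a i by (simp add: sum_diff1)
  qed simp
  also have "\<dots> = (S - T) - (\<Sum>a\<in>?I - {i}. h (y a) (y i))"
    using i by (simp add: sum_subtractf S_def T_def sum_diff1)
  also have "(\<Sum>a\<in>?I - {i}. h (y a) (y i)) = T"
    unfolding T_def using sym by (intro sum.cong) auto
  finally have S': "(\<Sum>a\<in>?I - {i}. \<Sum>b\<in>?I - {i} - {a}. h (y a) (y b)) = S - 2 * T"
    by simp
  have card: "card (?I - {i}) = n - 1"
    using i by simp
  have n': "real n > 2" using n by simp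
  have e1: "ustat h (?I - {i}) y = (S - 2 * T) / ((real n - 1) * (real n - 2))"
    using n unfolding ustat_altdef[OF finite_Diff[OF finite_atLeastAtMost]] S' card
    by (simp add: of_nat_diff diff_diff_eq)
  have e2: "ustat h ?I y = S / (real n * (real n - 1))"
    by (simp add: ustat_altdef S_def)
  have e3: "row_mean h n y i = T / (real n - 1)"
    by (simp add: row_mean_def T_def)
  show ?thesis
    unfolding e1 e2 e3 using n' by (simp add: divide_simps) (simp add: algebra_simps)
qed

text \<open>The prefactor \<open>4 * (n - 1) / (n - 2)^2\<close> of the sum of squares is rewritten
  as a square divided by \<open>n\<close>: a mean of squares appears, and the root of the constant
  can be extracted.\<close>

lemma jackknife_var_eq:
  assumes n: "n \<ge> 3"
    and sym: "\<And>i j. i \<in> {1..n} \<Longrightarrow> j \<in> {1..n} \<Longrightarrow> h (y i) (y j) = h (y j) (y i)"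
  shows "jackknife_var h n y =
    (2 * sqrt (real n * (real n - 1)) / (real n - 2))\<^sup>2 *
    ((\<Sum>i\<in>{1..n}. (row_mean h n y i - ustat h {1..n} y)\<^sup>2) / real n)"
proof -
  have "(\<Sum>i\<in>{1..n}. (ustat h ({1..n} - {i}) y - ustat h {1..n} y)\<^sup>2) =
     (2 / (real n - 2))\<^sup>2 * (\<Sum>i\<in>{1..n}. (row_mean h n y i - ustat h {1..n} y)\<^sup>2)"
    unfolding sum_distrib_left
  proof (rule sum.cong)
    fix i assume i: "i \<in> {1..n}"
    have "ustat h ({1..n} - {i}) y - ustat h {1..n} y =
        - (2 / (real n - 2)) * (row_mean h n y i - ustat h {1..n} y)"
      by (rule ustat_minus_point[OF n i]) (rule sym[OF _ i])
    then show "(ustat h ({1..n} - {i}) y - ustat h {1..n} y)\<^sup>2 =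
        (2 / (real n - 2))\<^sup>2 * (row_mean h n y i - ustat h {1..n} y)\<^sup>2"
      by (simp only: power_mult_distrib power2_minus)
  qed simp
  moreover have "(2 * sqrt (real n * (real n - 1)) / (real n - 2))\<^sup>2 =
      4 * (real n * (real n - 1)) / (real n - 2)\<^sup>2"
    using n by (simp add: power_mult_distrib power_divide)
  ultimately show ?thesis
    using n by (simp add: jackknife_var_def power_divide)
qed

text \<open>The jackknife standard deviation is \<open>2 * sqrt (n * (n - 1)) / (n - 2)\<close> times the root mean square
  of the centred row means; the triangle inequality in \<open>\<real>\<^sup>n\<close> then compares it with that of
  any other family \<open>g\<close>.\<close>

lemma sqrt_jackknife_var_dist:
  fixes g :: "nat \<Rightarrow> real" and c s \<theta> :: real
  assumes n: "n \<ge> 3" and s: "s > 0"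
    and sym: "\<And>i j. i \<in> {1..n} \<Longrightarrow> j \<in> {1..n} \<Longrightarrow> h (y i) (y j) = h (y j) (y i)"
  defines "c \<equiv> 2 * sqrt (real n * (real n - 1)) / (real n - 2)"
  shows "(sqrt (jackknife_var h n y) - c * s)\<^sup>2 \<le>
    c\<^sup>2 * (3 * ((\<Sum>i\<in>{1..n}. (row_mean h n y i - \<theta> - g i)\<^sup>2) / real n
          + (ustat h {1..n} y - \<theta>)\<^sup>2
          + ((\<Sum>i\<in>{1..n}. (g i)\<^sup>2) / real n - s\<^sup>2)\<^sup>2 / s\<^sup>2))"
proof -
  let ?I = "{1..n}"
  define U where "U = ustat h ?I y"
  define rms where "rms f = L2_set f ?I / sqrt (real n)" for f :: "nat \<Rightarrow> real"
  have rms2: "(rms f)\<^sup>2 = (\<Sum>i\<in>?I. (f i)\<^sup>2) / real n" for f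
    by (simp add: rms_def power_divide L2_set_def sum_nonneg)
  have rms0: "rms f \<ge> 0" for f
    by (simp add: rms_def L2_set_nonneg)
  have tri: "rms (\<lambda>i. f i + f' i) \<le> rms f + rms f'" for f f'
    unfolding rms_def add_divide_distrib[symmetric]
    by (intro divide_right_mono L2_set_triangle_ineq) auto
  have const: "rms (\<lambda>i. a) = \<bar>a\<bar>" for a
    using n by (simp add: rms_def L2_set_def real_sqrt_mult)
  have minus: "rms (\<lambda>i. - f i) = rms f" for f
    by (simp add: rms_def L2_set_def)
  let ?q = "\<lambda>i. row_mean h n y i - U" and ?r = "\<lambda>i. row_mean h n y i - \<theta> - g i"
  have c: "c \<ge> 0" using n by (simp add: c_def)
  have "jackknife_var h n y = (c * rms ?q)\<^sup>2"
    using jackknife_var_eq[of n h y, OF n sym]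
    by (simp only: power_mult_distrib rms2 c_def U_def)
  then have v: "sqrt (jackknife_var h n y) = c * rms ?q"
    using c rms0 by simp
  have "rms ?q \<le> rms g + (rms ?r + \<bar>U - \<theta>\<bar>)"
    using tri[of g "\<lambda>i. ?r i + (\<theta> - U)"] tri[of ?r "\<lambda>i. \<theta> - U"]
    by (simp add: const algebra_simps abs_minus_commute)
  moreover have "rms (\<lambda>i. - ?r i) = rms ?r"
    by (rule minus)
  then have "rms g \<le> rms ?q + (rms ?r + \<bar>U - \<theta>\<bar>)"
    using tri[of ?q "\<lambda>i. - ?r i + (U - \<theta>)"] tri[of "\<lambda>i. - ?r i" "\<lambda>i. U - \<theta>"]
    by (simp add: const algebra_simps)
  ultimately have 1: "\<bar>rms ?q - rms g\<bar> \<le> rms ?r + \<bar>U - \<theta>\<bar>" by linarith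
  \<comment> \<open>Passing from variances to standard deviations costs a factor
    \<open>1 / s\<close>: for \<open>a \<ge> 0\<close>, \<open>\<bar>a - s\<bar>\<close> is at most
    \<open>\<bar>a^2 - s^2\<bar> / s\<close>.\<close>
  have "\<bar>rms g - s\<bar> * s \<le> \<bar>rms g - s\<bar> * (rms g + s)"
    using rms0[of g] s by (intro mult_left_mono) auto
  also have "\<dots> = \<bar>(rms g)\<^sup>2 - s\<^sup>2\<bar>"
    using rms0[of g] s by (simp add: square_diff_square_factored power2_eq_square abs_mult)
  finally have 2: "\<bar>rms g - s\<bar> \<le> \<bar>(rms g)\<^sup>2 - s\<^sup>2\<bar> / s"
    using s by (simp add: pos_le_divide_eq)
  define x1 x2 x3 where "x1 = rms ?r" and "x2 = \<bar>U - \<theta>\<bar>" and "x3 = \<bar>(rms g)\<^sup>2 - s\<^sup>2\<bar> / s"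
  have "\<bar>rms ?q - s\<bar> \<le> x1 + x2 + x3"
    using 1 2 unfolding x1_def x2_def x3_def by linarith
  then have "(rms ?q - s)\<^sup>2 \<le> (x1 + x2 + x3)\<^sup>2"
    by (metis abs_ge_zero abs_le_square_iff abs_of_nonneg order_trans)
  \<comment> \<open>The right side minus the left side is the sum of the three squared pairwise
    differences.\<close>
  also have "\<dots> \<le> 3 * (x1\<^sup>2 + x2\<^sup>2 + x3\<^sup>2)"
    using sum_squares_ge_zero[of "x1 - x2" "x2 - x3"] zero_le_power2[of "x1 - x3"]
    by (simp add: power2_eq_square algebra_simps)
  finally have "(rms ?q - s)\<^sup>2 \<le> 3 * ((rms ?r)\<^sup>2 + (U - \<theta>)\<^sup>2 + ((rms g)\<^sup>2 - s\<^sup>2)\<^sup>2 / s\<^sup>2)"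
    by (simp add: x1_def x2_def x3_def power_divide)
  then have "c\<^sup>2 * (rms ?q - s)\<^sup>2 \<le> c\<^sup>2 * (3 * ((rms ?r)\<^sup>2 + (U - \<theta>)\<^sup>2 + ((rms g)\<^sup>2 - s\<^sup>2)\<^sup>2 / s\<^sup>2))"
    by (intro mult_left_mono) auto
  moreover have "(sqrt (jackknife_var h n y) - c * s)\<^sup>2 = c\<^sup>2 * (rms ?q - s)\<^sup>2"
    unfolding v by (simp add: power2_eq_square algebra_simps)
  ultimately show ?thesis
    by (simp add: rms2 U_def)
qed

section \<open>Normal limits and orthogonal sums\<close>

text \<open>A quantitative form of Slutsky's lemma: \<open>iexp\<close> is 1-Lipschitz, which is
  used where \<open>A\<close> and \<open>B\<close> are within \<open>\<epsilon>\<close>, and has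
  modulus 1, which costs at most 2 on the exceptional event.\<close>

lemma (in prob_space) norm_char_diff_le:
  fixes A B :: "'a \<Rightarrow> real"
  assumes [measurable]: "A \<in> borel_measurable M" "B \<in> borel_measurable M" and \<epsilon>: "\<epsilon> > 0"
  shows "norm (char (distr M borel A) x - char (distr M borel B) x) \<le>
    \<bar>x\<bar> * \<epsilon> + 2 * prob {\<omega>\<in>space M. \<bar>A \<omega> - B \<omega>\<bar> > \<epsilon>}"
proof -
  let ?E = "{\<omega>\<in>space M. \<bar>A \<omega> - B \<omega>\<bar> > \<epsilon>}"
  have int: "integrable M (\<lambda>\<omega>. iexp (x * A \<omega>))" "integrable M (\<lambda>\<omega>. iexp (x * B \<omega>))"
    by (auto intro!: integrable_const_bound[where B=1] simp: norm_exp_i_times)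
  have ind: "integrable M (\<lambda>\<omega>. indicator ?E \<omega> :: real)"
    by (rule integrable_const_bound[where B = 1]) (auto simp: indicator_def)
  have bound: "norm (iexp (x * A \<omega>) - iexp (x * B \<omega>)) \<le> \<bar>x\<bar> * \<epsilon> + 2 * indicator ?E \<omega>"
    if "\<omega> \<in> space M" for \<omega>
  proof (cases "\<omega> \<in> ?E")
    case True
    have "norm (iexp (x * A \<omega>) - iexp (x * B \<omega>)) \<le> 1 + 1"
      by (rule order_trans[OF norm_triangle_ineq4]) simp
    then show ?thesis using True \<epsilon> by (simp add: add_increasing)
  next
    case False
    have "iexp (x * A \<omega>) - iexp (x * B \<omega>) = iexp (x * B \<omega>) * (iexp (x * A \<omega> - x * B \<omega>) - 1)"
      by (simp add: right_diff_distrib exp_add[symmetric])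
    then have "norm (iexp (x * A \<omega>) - iexp (x * B \<omega>)) = norm (iexp (x * A \<omega> - x * B \<omega>) - 1)"
      by (simp add: norm_mult)
    also have "\<dots> \<le> \<bar>x * A \<omega> - x * B \<omega>\<bar>"
      using iexp_approx1[of "x * A \<omega> - x * B \<omega>" 0] by simp
    also have "\<dots> = \<bar>x\<bar> * \<bar>A \<omega> - B \<omega>\<bar>"
      by (simp add: abs_mult flip: right_diff_distrib)
    also have "\<dots> \<le> \<bar>x\<bar> * \<epsilon>"
      using False that by (intro mult_left_mono) auto
    finally show ?thesis using False by simp
  qed
  have "char (distr M borel A) x - char (distr M borel B) x =
      (CLINT \<omega>|M. iexp (x * A \<omega>) - iexp (x * B \<omega>))"
    unfolding Bochner_Integration.integral_diff[OF int] by (simp add: char_def integral_distr)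
  also have "norm \<dots> \<le> (LINT \<omega>|M. norm (iexp (x * A \<omega>) - iexp (x * B \<omega>)))"
    by (rule integral_norm_bound)
  also have "\<dots> \<le> (LINT \<omega>|M. \<bar>x\<bar> * \<epsilon> + 2 * indicator ?E \<omega>)"
  proof (rule integral_mono)
    show "integrable M (\<lambda>\<omega>. \<bar>x\<bar> * \<epsilon> + 2 * indicator ?E \<omega>)"
      using ind by (intro Bochner_Integration.integrable_add integrable_mult_right) auto
  qed (use int bound in \<open>auto simp del: of_real_mult\<close>)
  also have "\<dots> = \<bar>x\<bar> * \<epsilon> + 2 * prob ?E"
    using Bochner_Integration.integral_add[of M "\<lambda>_. \<bar>x\<bar> * \<epsilon>" "\<lambda>\<omega>. 2 * indicator ?E \<omega>"] ind
    by (simp add: prob_space)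
  finally show ?thesis .
qed

text \<open>Slutsky's lemma on the level of characteristic functions. \<open>A n\<close> will be
  built from a Hoeffding projection, whose properties are available only for large \<open>n\<close>,
  so it is measurable only eventually; \<open>B n\<close> must be measurable for every
  \<open>n\<close>, as Levy's continuity theorem speaks of a whole sequence of
  distributions.\<close>

theorem (in prob_space) weak_conv_std_normal_perturb:
  fixes A B :: "nat \<Rightarrow> 'a \<Rightarrow> real"
  assumes [measurable]: "\<And>n. B n \<in> borel_measurable M"
    and A: "eventually (\<lambda>n. A n \<in> borel_measurable M) sequentially"
    and char: "\<And>x. (\<lambda>n. char (distr M borel (A n)) x) \<longlonglongrightarrow> exp (- x\<^sup>2 / 2)"
    and close: "\<And>\<epsilon>. \<epsilon> > 0 \<Longrightarrow> (\<lambda>n. prob {\<omega>\<in>space M. \<bar>A n \<omega> - B n \<omega>\<bar> > \<epsilon>}) \<longlonglongrightarrow> 0"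
  shows "weak_conv_m (\<lambda>n. distr M borel (B n)) std_normal_distribution"
proof (rule levy_continuity)
  fix x
  have "(\<lambda>n. char (distr M borel (A n)) x - char (distr M borel (B n)) x) \<longlonglongrightarrow> 0"
  proof (rule LIMSEQ_I)
    fix r :: real assume r: "r > 0"
    define \<epsilon> where "\<epsilon> = r / (2 * (\<bar>x\<bar> + 1))"
    have \<epsilon>: "\<epsilon> > 0" using r by (simp add: \<epsilon>_def)
    have "\<bar>x\<bar> * \<epsilon> \<le> r / 2" using r by (simp add: \<epsilon>_def field_simps)
    moreover have "eventually (\<lambda>n. prob {\<omega>\<in>space M. \<bar>A n \<omega> - B n \<omega>\<bar> > \<epsilon>} < r / 4) sequentially"
      using order_tendstoD(2)[OF close[OF \<epsilon>], of "r / 4"] r by simp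
    then have "eventually (\<lambda>n. norm (char (distr M borel (A n)) x - char (distr M borel (B n)) x) <
        \<bar>x\<bar> * \<epsilon> + r / 2) sequentially"
      using A
    proof eventually_elim
      case (elim n)
      then show ?case using norm_char_diff_le[OF elim(2) _ \<epsilon>, of "B n" x] by simp
    qed
    ultimately have "eventually (\<lambda>n. norm (char (distr M borel (A n)) x - char (distr M borel (B n)) x) < r)
        sequentially"
      by (auto elim!: eventually_mono)
    then show "\<exists>no. \<forall>n\<ge>no. norm (char (distr M borel (A n)) x - char (distr M borel (B n)) x - 0) < r"
      by (simp add: eventually_sequentially)
  qed
  from tendsto_diff[OF char[of x] this]
  show "(\<lambda>n. char (distr M borel (B n)) x) \<longlonglongrightarrow> char std_normal_distribution x"
    by (simp add: char_std_normal_distribution)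
qed (auto intro!: real_dist_normal_dist)

lemma (in prob_space) markov_square:
  fixes X :: "'a \<Rightarrow> real"
  assumes [measurable]: "X \<in> borel_measurable M" and "integrable M (\<lambda>\<omega>. (X \<omega>)\<^sup>2)" and a: "a > 0"
  shows "prob {\<omega>\<in>space M. \<bar>X \<omega>\<bar> \<ge> a} \<le> expectation (\<lambda>\<omega>. (X \<omega>)\<^sup>2) / a\<^sup>2"
proof -
  have "{\<omega>\<in>space M. \<bar>X \<omega>\<bar> \<ge> a} = {\<omega>\<in>space M. (X \<omega>)\<^sup>2 \<ge> a\<^sup>2}"
    using a by (auto simp: abs_le_square_iff[symmetric])
  then show ?thesis
    using integral_Markov_inequality_measure[of M "\<lambda>\<omega>. (X \<omega>)\<^sup>2" "space M" "a\<^sup>2"] assms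
    by (simp add: power_eq_0_iff)
qed

lemma (in prob_space) integrable_mult_square_integrable:
  fixes X Y :: "'a \<Rightarrow> real"
  assumes [measurable]: "X \<in> borel_measurable M" "Y \<in> borel_measurable M"
    and "integrable M (\<lambda>\<omega>. (X \<omega>)\<^sup>2)" "integrable M (\<lambda>\<omega>. (Y \<omega>)\<^sup>2)"
  shows "integrable M (\<lambda>\<omega>. X \<omega> * Y \<omega>)"
proof (rule Bochner_Integration.integrable_bound)
  show "integrable M (\<lambda>\<omega>. (X \<omega>)\<^sup>2 + (Y \<omega>)\<^sup>2)" using assms by simp
  have "\<bar>x * y\<bar> \<le> x\<^sup>2 + y\<^sup>2" for x y :: real
    using sum_squares_bound[of "\<bar>x\<bar>" "\<bar>y\<bar>"] mult_nonneg_nonneg[of "\<bar>x\<bar>" "\<bar>y\<bar>"]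
    unfolding abs_mult power2_abs by linarith
  then show "AE \<omega> in M. norm (X \<omega> * Y \<omega>) \<le> norm ((X \<omega>)\<^sup>2 + (Y \<omega>)\<^sup>2)"
    by simp
qed simp

text \<open>Pythagoras in \<open>L^2\<close>. Each component of the Hoeffding decomposition supplies
  an orthogonal family, so second moments of sums grow like the number of terms and not like its
  square.\<close>

lemma (in prob_space) expectation_sum_square_orthogonal:
  fixes X :: "'i \<Rightarrow> 'a \<Rightarrow> real"
  assumes A: "finite A"
    and [measurable]: "\<And>a. a \<in> A \<Longrightarrow> X a \<in> borel_measurable M"
    and sq: "\<And>a. a \<in> A \<Longrightarrow> integrable M (\<lambda>\<omega>. (X a \<omega>)\<^sup>2)"
    and orth: "\<And>a b. a \<in> A \<Longrightarrow> b \<in> A \<Longrightarrow> a \<noteq> b \<Longrightarrow> expectation (\<lambda>\<omega>. X a \<omega> * X b \<omega>) = 0"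
  shows "integrable M (\<lambda>\<omega>. (\<Sum>a\<in>A. X a \<omega>)\<^sup>2)"
    and "expectation (\<lambda>\<omega>. (\<Sum>a\<in>A. X a \<omega>)\<^sup>2) = (\<Sum>a\<in>A. expectation (\<lambda>\<omega>. (X a \<omega>)\<^sup>2))"
proof -
  have eq: "(\<Sum>a\<in>A. X a \<omega>)\<^sup>2 = (\<Sum>a\<in>A. \<Sum>b\<in>A. X a \<omega> * X b \<omega>)" for \<omega>
    by (simp add: power2_eq_square sum_product)
  have int: "integrable M (\<lambda>\<omega>. X a \<omega> * X b \<omega>)" if "a \<in> A" "b \<in> A" for a b
    using that sq by (intro integrable_mult_square_integrable) auto
  then show "integrable M (\<lambda>\<omega>. (\<Sum>a\<in>A. X a \<omega>)\<^sup>2)"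
    unfolding eq by (intro Bochner_Integration.integrable_sum) auto
  have "expectation (\<lambda>\<omega>. (\<Sum>a\<in>A. X a \<omega>)\<^sup>2) = (\<Sum>a\<in>A. \<Sum>b\<in>A. expectation (\<lambda>\<omega>. X a \<omega> * X b \<omega>))"
    unfolding eq using int by (simp add: Bochner_Integration.integral_sum)
  also have "\<dots> = (\<Sum>a\<in>A. expectation (\<lambda>\<omega>. X a \<omega> * X a \<omega>))"
  proof (rule sum.cong)
    fix a assume a: "a \<in> A"
    have "(\<Sum>b\<in>A. expectation (\<lambda>\<omega>. X a \<omega> * X b \<omega>)) =
        (\<Sum>b\<in>A. if b = a then expectation (\<lambda>\<omega>. X a \<omega> * X a \<omega>) else 0)"
      using a orth by (intro sum.cong) auto
    then show "(\<Sum>b\<in>A. expectation (\<lambda>\<omega>. X a \<omega> * X b \<omega>)) = expectation (\<lambda>\<omega>. X a \<omega> * X a \<omega>)"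
      using a A by simp
  qed simp
  finally show "expectation (\<lambda>\<omega>. (\<Sum>a\<in>A. X a \<omega>)\<^sup>2) = (\<Sum>a\<in>A. expectation (\<lambda>\<omega>. (X a \<omega>)\<^sup>2))"
    by (simp add: power2_eq_square)
qed

section \<open>Hoeffding decomposition of a kernel of two variables\<close>

lemma (in prob_space) square_expectation_le:
  fixes X :: "'a \<Rightarrow> real"
  assumes "X \<in> borel_measurable M" "integrable M (\<lambda>\<omega>. (X \<omega>)\<^sup>2)"
  shows "(expectation X)\<^sup>2 \<le> expectation (\<lambda>\<omega>. (X \<omega>)\<^sup>2)"
proof -
  have "integrable M X"
    using assms by (rule square_integrable_imp_integrable)
  from variance_eq[OF this assms(2)] variance_positive[of X] show ?thesis
    by linarith
qed

text \<open>Allows every second moment to be bounded through the fourth moment alone; the recurring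
  factor \<open>1 + moment4\<close> comes from here.\<close>

lemma square_le_one_plus_fourth: "x\<^sup>2 \<le> 1 + x ^ 4" for x :: real
proof -
  have "(x\<^sup>2 - 1)\<^sup>2 \<ge> 0" by simp
  then have "2 * x\<^sup>2 \<le> 1 + x ^ 4"
    by (simp add: power2_diff flip: power_mult)
  then show ?thesis using zero_le_power2[of x] by linarith
qed

text \<open>One row of the triangular array, with its law held fixed. Measurability and equality of
  laws are required at every index, 0 included, so that facts about a single \<open>Y i\<close>
  carry no side condition; independence is required from index 1 on, where the U-statistics
  live.\<close>

locale kernel_sample = prob_space M for M :: "'o measure" +
  fixes N :: "'a measure" and Y :: "nat \<Rightarrow> 'o \<Rightarrow> 'a" and h :: "'a \<Rightarrow> 'a \<Rightarrow> real"
  assumes indep: "indep_vars (\<lambda>_. N) Y {1..}"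
    and Y_measurable [measurable]: "\<And>i. Y i \<in> M \<rightarrow>\<^sub>M N"
    and same_law: "\<And>i. distr M N (Y i) = distr M N (Y 1)"
    and h_measurable: "(\<lambda>(a, b). h a b) \<in> borel_measurable (N \<Otimes>\<^sub>M N)"
    and h_sym: "\<And>a b. a \<in> space N \<Longrightarrow> b \<in> space N \<Longrightarrow> h a b = h b a"
    and h4: "integrable M (\<lambda>\<omega>. h (Y 1 \<omega>) (Y 2 \<omega>) ^ 4)"
begin

definition law :: "'a measure" where "law = distr M N (Y 1)"

lemma sets_law [measurable_cong, simp]: "sets law = sets N"
  by (simp add: law_def)

lemma space_law [simp]: "space law = space N"
  by (simp add: law_def)

sublocale law: prob_space law
  unfolding law_def by (rule prob_space_distr) simp

sublocale law2: pair_prob_space law law ..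

lemma Y_space: "\<omega> \<in> space M \<Longrightarrow> Y i \<omega> \<in> space N"
  using measurable_space[OF Y_measurable] .

lemma h_measurable' [measurable]:
  assumes "f \<in> A \<rightarrow>\<^sub>M N" "f' \<in> A \<rightarrow>\<^sub>M N"
  shows "(\<lambda>x. h (f x) (f' x)) \<in> borel_measurable A"
  using measurable_compose[OF measurable_Pair[OF assms] h_measurable] by simp

lemma distr_Y_pair:
  assumes "i \<ge> 1" "j \<ge> 1" "i \<noteq> j"
  shows "distr M (N \<Otimes>\<^sub>M N) (\<lambda>\<omega>. (Y i \<omega>, Y j \<omega>)) = law \<Otimes>\<^sub>M law"
proof -
  have "indep_var (PiM {i} (\<lambda>_. N)) (\<lambda>\<omega>. restrict (\<lambda>i. Y i \<omega>) {i})
      (PiM {j} (\<lambda>_. N)) (\<lambda>\<omega>. restrict (\<lambda>i. Y i \<omega>) {j})"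
    using assms by (intro indep_var_restrict[OF indep]) auto
  then have "indep_var N ((\<lambda>f. f i) \<circ> (\<lambda>\<omega>. restrict (\<lambda>i. Y i \<omega>) {i}))
      N ((\<lambda>f. f j) \<circ> (\<lambda>\<omega>. restrict (\<lambda>i. Y i \<omega>) {j}))"
    by (rule indep_var_compose) simp_all
  then have "indep_var N (Y i) N (Y j)"
    by (simp add: comp_def)
  then show ?thesis
    unfolding indep_var_distribution_eq by (simp add: law_def same_law[of j] same_law[of i])
qed

text \<open>Integrate over \<open>Y j\<close> first: it is independent of the other three variables,
  the factor \<open>F\<close> does not involve it, and \<open>\<psi>\<close> has mean zero in that
  slot. All orthogonality relations below, and the characterisation of the conditional expectation,
  are instances.\<close>

lemma expectation_pair_eq_0:
  fixes \<psi> F :: "'a \<Rightarrow> 'a \<Rightarrow> real"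
  assumes [measurable]: "(\<lambda>(a, b). \<psi> a b) \<in> borel_measurable (N \<Otimes>\<^sub>M N)"
      "(\<lambda>(a, b). F a b) \<in> borel_measurable (N \<Otimes>\<^sub>M N)"
    and 0: "\<And>a. a \<in> space N \<Longrightarrow> (\<integral>b. \<psi> a b \<partial>law) = 0"
    and "j \<ge> 1" "i \<ge> 1" "k \<ge> 1" "l \<ge> 1" "j \<noteq> i" "j \<noteq> k" "j \<noteq> l"
  shows "expectation (\<lambda>\<omega>. \<psi> (Y i \<omega>) (Y j \<omega>) * F (Y k \<omega>) (Y l \<omega>)) = 0"
proof -
  let ?K = "{i, k, l}"
  \<comment> \<open>The indices \<open>i\<close>, \<open>k\<close>, \<open>l\<close> may coincide,
    so those variables are packed into one element of a product over the set \<open>?K\<close>; only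
    its disjointness from \<open>{j}\<close> matters.\<close>
  define W where "W = distr M (PiM {j} (\<lambda>_. N)) (\<lambda>\<omega>. restrict (\<lambda>i. Y i \<omega>) {j})"
  define Z where "Z = distr M (PiM ?K (\<lambda>_. N)) (\<lambda>\<omega>. restrict (\<lambda>i. Y i \<omega>) ?K)"
  have [measurable]: "(\<lambda>\<omega>. restrict (\<lambda>i. Y i \<omega>) J) \<in> M \<rightarrow>\<^sub>M PiM J (\<lambda>_. N)" for J
    by (intro measurable_restrict) simp
  interpret W: prob_space W
    unfolding W_def by (rule prob_space_distr) simp
  interpret Z: prob_space Z
    unfolding Z_def by (rule prob_space_distr) simp
  interpret P: pair_prob_space W Z ..
  have [measurable_cong]: "sets Z = sets (PiM ?K (\<lambda>_. N))" "sets W = sets (PiM {j} (\<lambda>_. N))"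
    and spZ: "space Z = space (PiM ?K (\<lambda>_. N))"
    by (simp_all add: Z_def W_def)
  have [measurable]: "(\<lambda>z. z j) \<in> W \<rightarrow>\<^sub>M N"
    using measurable_component_singleton[of j "{j}" "\<lambda>_. N"] by measurable
  have [measurable]: "(\<lambda>z. z x) \<in> Z \<rightarrow>\<^sub>M N" if "x \<in> ?K" for x
    using measurable_component_singleton[OF that, of "\<lambda>_. N"] by measurable
  have W: "distr W N (\<lambda>w. w j) = law"
    unfolding W_def by (subst distr_distr) (simp_all add: comp_def law_def same_law[of j])
  have joint: "distr M (PiM {j} (\<lambda>_. N) \<Otimes>\<^sub>M PiM ?K (\<lambda>_. N))
      (\<lambda>\<omega>. (restrict (\<lambda>i. Y i \<omega>) {j}, restrict (\<lambda>i. Y i \<omega>) ?K)) = W \<Otimes>\<^sub>M Z"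
    using indep_var_restrict[OF indep, of "{j}" ?K] assms
    unfolding indep_var_distribution_eq W_def Z_def by auto
  let ?f = "\<lambda>(w, z). \<psi> (z i) (w j) * F (z k) (z l)"
  have [measurable]: "?f \<in> borel_measurable (W \<Otimes>\<^sub>M Z)"
    by measurable
  have "expectation (\<lambda>\<omega>. \<psi> (Y i \<omega>) (Y j \<omega>) * F (Y k \<omega>) (Y l \<omega>)) = (\<integral>p. ?f p \<partial>(W \<Otimes>\<^sub>M Z))"
    unfolding joint[symmetric] by (subst integral_distr) simp_all
  also have "\<dots> = 0"
  \<comment> \<open>No integrability is assumed: a non-integrable product has Bochner integral 0, so
    the claim holds in that case by convention.\<close>
  proof (cases "integrable (W \<Otimes>\<^sub>M Z) ?f")
    case True
    have "(\<integral>p. ?f p \<partial>(W \<Otimes>\<^sub>M Z)) = (\<integral>z. (\<integral>w. \<psi> (z i) (w j) * F (z k) (z l) \<partial>W) \<partial>Z)"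
      using P.integral_snd[OF True] by simp
    also have "\<dots> = (\<integral>z. 0 \<partial>Z)"
    proof (rule Bochner_Integration.integral_cong)
      fix z assume "z \<in> space Z"
      then have z: "z i \<in> space N"
        by (auto simp: spZ space_PiM)
      have "(\<integral>w. \<psi> (z i) (w j) \<partial>W) = (\<integral>b. \<psi> (z i) b \<partial>law)"
        unfolding W[symmetric] using z by (subst integral_distr) simp_all
      then show "(\<integral>w. \<psi> (z i) (w j) * F (z k) (z l) \<partial>W) = 0"
        by (simp add: 0[OF z])
    qed simp
    finally show ?thesis by simp
  qed (simp add: not_integrable_integral_eq)
  finally show ?thesis .
qed

lemma
  fixes F :: "'a \<Rightarrow> 'a \<Rightarrow> real"
  assumes F: "(\<lambda>(a, b). F a b) \<in> borel_measurable (N \<Otimes>\<^sub>M N)"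
    and ij: "i \<ge> 1" "j \<ge> 1" "i \<noteq> j"
  shows integrable_Y_pair:
      "integrable M (\<lambda>\<omega>. F (Y i \<omega>) (Y j \<omega>)) \<longleftrightarrow> integrable (law \<Otimes>\<^sub>M law) (\<lambda>(a, b). F a b)"
    and expectation_Y_pair:
      "expectation (\<lambda>\<omega>. F (Y i \<omega>) (Y j \<omega>)) = (\<integral>(a, b). F a b \<partial>(law \<Otimes>\<^sub>M law))"
  unfolding distr_Y_pair[OF ij, symmetric]
  using integrable_distr_eq[OF _ F, of "\<lambda>\<omega>. (Y i \<omega>, Y j \<omega>)" M]
    integral_distr[OF _ F, of "\<lambda>\<omega>. (Y i \<omega>, Y j \<omega>)" M]
  by simp_all

lemma
  fixes F :: "'a \<Rightarrow> real"
  assumes F: "F \<in> borel_measurable N"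
  shows integrable_Y: "integrable M (\<lambda>\<omega>. F (Y i \<omega>)) \<longleftrightarrow> integrable law F"
    and expectation_Y: "expectation (\<lambda>\<omega>. F (Y i \<omega>)) = (\<integral>a. F a \<partial>law)"
  using integrable_distr_eq[OF _ F, of "Y i" M] integral_distr[OF _ F, of "Y i" M]
  by (simp_all add: law_def same_law[of i])

end

lemma fourth_power_diff_le: "(x - y) ^ 4 \<le> 8 * (x ^ 4 + y ^ 4)" for x y :: real
proof -
  have sq: "(a - b)\<^sup>2 \<le> 2 * (a\<^sup>2 + b\<^sup>2)" for a b :: real
    using zero_le_power2[of "a + b"] by (simp add: power2_eq_square algebra_simps)
  have "((x - y)\<^sup>2)\<^sup>2 \<le> (2 * (x\<^sup>2 + y\<^sup>2))\<^sup>2"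
    by (intro power_mono sq) simp
  \<comment> \<open>The sum of squares is written as a difference with second term
    \<open>-(y^2)\<close>, so that \<open>sq\<close> applies once more; the two uses give the
    constant \<open>4 * 2 = 8\<close>.\<close>
  also have "\<dots> = 4 * (x\<^sup>2 - (- y\<^sup>2))\<^sup>2"
    by (simp only: power_mult_distrib) simp
  also have "\<dots> \<le> 4 * (2 * ((x\<^sup>2)\<^sup>2 + (y\<^sup>2)\<^sup>2))"
    using sq[of "x\<^sup>2" "- y\<^sup>2"] by simp
  finally show ?thesis by (simp flip: power_mult)
qed

section \<open>Components of the Hoeffding decomposition and their moments\<close>

context kernel_sample
begin

lemma prob_law_space [simp]: "measure law (space N) = 1"
  using law.prob_space by simp

definition moment4 :: real where
  "moment4 = expectation (\<lambda>\<omega>. h (Y 1 \<omega>) (Y 2 \<omega>) ^ 4)"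

text \<open>The conditional expectation of the kernel given one argument. Where the section
  \<open>h a\<close> is not integrable, which happens only on a null set of \<open>a\<close>, the
  value is 0.\<close>

definition section_mean :: "'a \<Rightarrow> real" where
  "section_mean a = (\<integral>b. h a b \<partial>law)"

definition mean :: real where
  "mean = (\<integral>a. section_mean a \<partial>law)"

definition proj :: "'a \<Rightarrow> real" where
  "proj a = section_mean a - mean"

definition proj_var :: real where
  "proj_var = (\<integral>a. (proj a)\<^sup>2 \<partial>law)"

text \<open>Centred in the second argument only, which is enough for a row mean, where the first
  argument stays fixed.\<close>

definition row_part :: "'a \<Rightarrow> 'a \<Rightarrow> real" where
  "row_part a b = h a b - section_mean a"

text \<open>The completely degenerate part: \<open>h a b\<close> is the sum of \<open>mean\<close>,
  \<open>proj a\<close>, \<open>proj b\<close> and \<open>degen_part a b\<close>, and for symmetric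
  \<open>h\<close> the last one has mean zero in either argument.\<close>

definition degen_part :: "'a \<Rightarrow> 'a \<Rightarrow> real" where
  "degen_part a b = h a b - section_mean a - section_mean b + mean"

lemma section_mean_measurable [measurable]: "section_mean \<in> borel_measurable N"
proof -
  have "section_mean \<in> borel_measurable law"
    unfolding section_mean_def by measurable
  then show ?thesis by simp
qed

lemma proj_measurable [measurable]: "proj \<in> borel_measurable N"
  unfolding proj_def by measurable

lemma row_part_measurable [measurable]: "(\<lambda>(a, b). row_part a b) \<in> borel_measurable (N \<Otimes>\<^sub>M N)"
  unfolding row_part_def by measurable

lemma degen_part_measurable [measurable]:
  "(\<lambda>(a, b). degen_part a b) \<in> borel_measurable (N \<Otimes>\<^sub>M N)"
  unfolding degen_part_def by measurable

lemma row_part_measurable' [measurable]: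
  assumes "f \<in> A \<rightarrow>\<^sub>M N" "f' \<in> A \<rightarrow>\<^sub>M N"
  shows "(\<lambda>x. row_part (f x) (f' x)) \<in> borel_measurable A"
  using measurable_compose[OF measurable_Pair[OF assms] row_part_measurable] by simp

lemma degen_part_measurable' [measurable]:
  assumes "f \<in> A \<rightarrow>\<^sub>M N" "f' \<in> A \<rightarrow>\<^sub>M N"
  shows "(\<lambda>x. degen_part (f x) (f' x)) \<in> borel_measurable A"
  using measurable_compose[OF measurable_Pair[OF assms] degen_part_measurable] by simp

lemma integrable_fourth: "integrable (law \<Otimes>\<^sub>M law) (\<lambda>(a, b). h a b ^ 4)"
  using h4 integrable_Y_pair[of "\<lambda>a b. h a b ^ 4" 1 2] by simp

lemma integral_fourth: "(\<integral>(a, b). h a b ^ 4 \<partial>(law \<Otimes>\<^sub>M law)) = moment4"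
  unfolding moment4_def using expectation_Y_pair[of "\<lambda>a b. h a b ^ 4" 1 2] by simp

lemma moment4_nonneg: "moment4 \<ge> 0"
  unfolding moment4_def by (intro Bochner_Integration.integral_nonneg) simp

lemma square_integrable:
  "integrable (law \<Otimes>\<^sub>M law) (\<lambda>(a, b). (h a b)\<^sup>2)" "(\<integral>(a, b). (h a b)\<^sup>2 \<partial>(law \<Otimes>\<^sub>M law)) \<le> 1 + moment4"
proof -
  let ?P = "law \<Otimes>\<^sub>M law"
  have int: "integrable ?P (\<lambda>p. 1 + (case p of (a, b) \<Rightarrow> h a b ^ 4))"
    using integrable_fourth by simp
  then show sq: "integrable ?P (\<lambda>(a, b). (h a b)\<^sup>2)"
    by (rule Bochner_Integration.integrable_bound)
       (auto intro!: AE_I2 simp: square_le_one_plus_fourth)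
  have "(\<integral>(a, b). (h a b)\<^sup>2 \<partial>?P) \<le> (\<integral>p. 1 + (case p of (a, b) \<Rightarrow> h a b ^ 4) \<partial>?P)"
    by (intro integral_mono sq int) (auto simp: square_le_one_plus_fourth)
  also have "\<dots> = 1 + moment4"
    using integrable_fourth by (simp add: integral_fourth law2.P.prob_space)
  finally show "(\<integral>(a, b). (h a b)\<^sup>2 \<partial>?P) \<le> 1 + moment4" .
qed

lemma integrable_pair: "integrable (law \<Otimes>\<^sub>M law) (\<lambda>(a, b). h a b)"
  by (rule law2.P.square_integrable_imp_integrable)
     (use square_integrable(1) in \<open>auto simp: case_prod_beta'\<close>)

lemma mean_eq: "i \<ge> 1 \<Longrightarrow> j \<ge> 1 \<Longrightarrow> i \<noteq> j \<Longrightarrow> expectation (\<lambda>\<omega>. h (Y i \<omega>) (Y j \<omega>)) = mean"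
  using expectation_Y_pair[OF h_measurable, of i j] law2.integral_fst'[OF integrable_pair]
  by (simp add: mean_def section_mean_def[abs_def])

text \<open>Jensen's inequality for the fourth power, obtained by using the one for squares twice.
  Fubini makes the section of \<open>h ^ 4\<close> integrable only for almost every
  \<open>a\<close>, hence the form of the claim.\<close>

lemma section_mean_fourth_le: "AE a in law. section_mean a ^ 4 \<le> (\<integral>b. h a b ^ 4 \<partial>law)"
  using law2.AE_integrable_fst'[OF integrable_fourth] AE_space
proof eventually_elim
  case (elim a)
  then have [measurable]: "a \<in> space N" by simp
  have int4: "integrable law (\<lambda>b. ((h a b)\<^sup>2)\<^sup>2)"
    using elim(1) by (simp flip: power_mult)
  then have int2: "integrable law (\<lambda>b. (h a b)\<^sup>2)"
    by (rule law.square_integrable_imp_integrable[rotated]) measurable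
  have "(section_mean a)\<^sup>2 \<le> (\<integral>b. (h a b)\<^sup>2 \<partial>law)"
    unfolding section_mean_def using int2 by (intro law.square_expectation_le) measurable
  then have "((section_mean a)\<^sup>2)\<^sup>2 \<le> (\<integral>b. (h a b)\<^sup>2 \<partial>law)\<^sup>2"
    by (intro power_mono) auto
  also have "\<dots> \<le> (\<integral>b. ((h a b)\<^sup>2)\<^sup>2 \<partial>law)"
    using int4 by (intro law.square_expectation_le) measurable
  finally show ?case by (simp flip: power_mult)
qed

lemma section_mean_fourth:
  "integrable law (\<lambda>a. section_mean a ^ 4)" "(\<integral>a. section_mean a ^ 4 \<partial>law) \<le> moment4"
proof -
  have int: "integrable law (\<lambda>a. \<integral>b. h a b ^ 4 \<partial>law)"
    using law2.integrable_fst'[OF integrable_fourth] by simp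
  then show int': "integrable law (\<lambda>a. section_mean a ^ 4)"
  proof (rule Bochner_Integration.integrable_bound)
    show "AE a in law. norm (section_mean a ^ 4) \<le> norm (\<integral>b. h a b ^ 4 \<partial>law)"
      using section_mean_fourth_le by eventually_elim simp
  qed measurable
  have "(\<integral>a. section_mean a ^ 4 \<partial>law) \<le> (\<integral>a. (\<integral>b. h a b ^ 4 \<partial>law) \<partial>law)"
    using section_mean_fourth_le by (rule integral_mono_AE[OF int' int])
  also have "\<dots> = moment4"
    using law2.integral_fst'[OF integrable_fourth] integral_fourth by simp
  finally show "(\<integral>a. section_mean a ^ 4 \<partial>law) \<le> moment4" .
qed

lemma section_mean_square:
  "integrable law (\<lambda>a. (section_mean a)\<^sup>2)" "(\<integral>a. (section_mean a)\<^sup>2 \<partial>law) \<le> 1 + moment4"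
proof -
  have int: "integrable law (\<lambda>a. 1 + section_mean a ^ 4)"
    using section_mean_fourth by simp
  then show sq: "integrable law (\<lambda>a. (section_mean a)\<^sup>2)"
    by (rule Bochner_Integration.integrable_bound)
       (auto intro!: AE_I2 simp: square_le_one_plus_fourth)
  have "(\<integral>a. (section_mean a)\<^sup>2 \<partial>law) \<le> (\<integral>a. 1 + section_mean a ^ 4 \<partial>law)"
    by (intro integral_mono sq int square_le_one_plus_fourth)
  also have "\<dots> \<le> 1 + moment4"
    using section_mean_fourth by simp
  finally show "(\<integral>a. (section_mean a)\<^sup>2 \<partial>law) \<le> 1 + moment4" .
qed

lemma integrable_section_mean: "integrable law section_mean"
  by (rule law.square_integrable_imp_integrable) (use section_mean_square(1) in auto)

lemma mean_power_le: "mean\<^sup>2 \<le> 1 + moment4" "mean ^ 4 \<le> moment4"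
proof -
  have sq: "mean\<^sup>2 \<le> (\<integral>a. (section_mean a)\<^sup>2 \<partial>law)"
    unfolding mean_def using section_mean_square(1) by (intro law.square_expectation_le) auto
  then show "mean\<^sup>2 \<le> 1 + moment4"
    using section_mean_square(2) by linarith
  have "(mean\<^sup>2)\<^sup>2 \<le> (\<integral>a. (section_mean a)\<^sup>2 \<partial>law)\<^sup>2"
    using sq by (intro power_mono) auto
  also have "\<dots> \<le> (\<integral>a. ((section_mean a)\<^sup>2)\<^sup>2 \<partial>law)"
    using section_mean_fourth(1) by (intro law.square_expectation_le) (auto simp flip: power_mult)
  also have "\<dots> \<le> moment4"
    using section_mean_fourth(2) by (simp flip: power_mult)
  finally show "mean ^ 4 \<le> moment4" by (simp flip: power_mult)
qed

text \<open>The constant is \<open>8 * (1 + 1)\<close>: both \<open>section_mean\<close> and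
  \<open>mean\<close> have fourth moment at most \<open>moment4\<close> by Jensen.\<close>

lemma proj_fourth: "integrable law (\<lambda>a. proj a ^ 4)" "(\<integral>a. proj a ^ 4 \<partial>law) \<le> 16 * moment4"
proof -
  have int: "integrable law (\<lambda>a. 8 * (section_mean a ^ 4 + mean ^ 4))"
    using section_mean_fourth by simp
  then show int': "integrable law (\<lambda>a. proj a ^ 4)"
    by (rule Bochner_Integration.integrable_bound)
       (use fourth_power_diff_le[of _ mean] in \<open>auto intro!: AE_I2 simp: proj_def abs_of_nonneg\<close>)
  have "(\<integral>a. proj a ^ 4 \<partial>law) \<le> (\<integral>a. 8 * (section_mean a ^ 4 + mean ^ 4) \<partial>law)"
    unfolding proj_def by (intro integral_mono int int'[unfolded proj_def] fourth_power_diff_le)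
  also have "\<dots> \<le> 16 * moment4"
    using section_mean_fourth mean_power_le by simp
  finally show "(\<integral>a. proj a ^ 4 \<partial>law) \<le> 16 * moment4" .
qed

lemma proj_square: "integrable law (\<lambda>a. (proj a)\<^sup>2)" "proj_var \<le> 4 * (1 + moment4)"
proof -
  have le: "(x - y)\<^sup>2 \<le> 2 * (x\<^sup>2 + y\<^sup>2)" for x y :: real
    using zero_le_power2[of "x + y"] by (simp add: power2_eq_square algebra_simps)
  have int: "integrable law (\<lambda>a. 2 * ((section_mean a)\<^sup>2 + mean\<^sup>2))"
    using section_mean_square by simp
  then show int': "integrable law (\<lambda>a. (proj a)\<^sup>2)"
    by (rule Bochner_Integration.integrable_bound)
       (use le[of _ mean] in \<open>auto intro!: AE_I2 simp: proj_def abs_of_nonneg\<close>)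
  have "(\<integral>a. (proj a)\<^sup>2 \<partial>law) \<le> (\<integral>a. 2 * ((section_mean a)\<^sup>2 + mean\<^sup>2) \<partial>law)"
    unfolding proj_def by (intro integral_mono int int'[unfolded proj_def] le)
  also have "\<dots> \<le> 4 * (1 + moment4)"
    using section_mean_square mean_power_le by simp
  finally show "proj_var \<le> 4 * (1 + moment4)"
    unfolding proj_var_def .
qed

lemma integral_proj: "(\<integral>a. proj a \<partial>law) = 0"
  unfolding proj_def using integrable_section_mean
  by (simp add: mean_def)

lemma integrable_proj: "integrable law proj"
  unfolding proj_def using integrable_section_mean by simp

text \<open>Both identities hold for every \<open>a\<close>: if the section \<open>h a\<close> is not integrable, neither is the
  integrand, and both Bochner integrals are \<open>0\<close>.\<close>

lemma integral_row_part: "(\<integral>b. row_part a b \<partial>law) = 0"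
proof (cases "integrable law (h a)")
  case True
  then show ?thesis by (simp add: row_part_def section_mean_def)
next
  case False
  have "\<not> integrable law (\<lambda>b. row_part a b)"
  proof
    assume "integrable law (\<lambda>b. row_part a b)"
    then have "integrable law (\<lambda>b. row_part a b + section_mean a)" by simp
    with False show False by (simp add: row_part_def)
  qed
  then show ?thesis by (rule not_integrable_integral_eq)
qed

lemma integral_degen_part: "(\<integral>b. degen_part a b \<partial>law) = 0"
proof (cases "integrable law (h a)")
  case True
  then have "(\<integral>b. degen_part a b \<partial>law) = section_mean a - section_mean a - mean + mean"
    unfolding degen_part_def using integrable_section_mean
    by simp (simp add: section_mean_def mean_def)
  then show ?thesis by simp
next
  case False
  have "\<not> integrable law (\<lambda>b. degen_part a b)"
  proof
    assume "integrable law (\<lambda>b. degen_part a b)"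
    then have "integrable law (\<lambda>b. degen_part a b + section_mean a + section_mean b - mean)"
      using integrable_section_mean by simp
    with False show False by (simp add: degen_part_def)
  qed
  then show ?thesis by (rule not_integrable_integral_eq)
qed

lemma degen_part_sym: "a \<in> space N \<Longrightarrow> b \<in> space N \<Longrightarrow> degen_part a b = degen_part b a"
  using h_sym[of a b] by (simp add: degen_part_def)

section \<open>Moments over a sample\<close>

lemma proj_square_sample: "integrable M (\<lambda>\<omega>. (proj (Y i \<omega>))\<^sup>2)"
    "expectation (\<lambda>\<omega>. (proj (Y i \<omega>))\<^sup>2) = proj_var"
  using integrable_Y[of "\<lambda>a. (proj a)\<^sup>2" i] expectation_Y[of "\<lambda>a. (proj a)\<^sup>2" i] proj_square(1)
  by (auto simp: proj_var_def)

lemma section_mean_sample: "integrable M (\<lambda>\<omega>. (section_mean (Y i \<omega>))\<^sup>2)"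
    "expectation (\<lambda>\<omega>. (section_mean (Y i \<omega>))\<^sup>2) \<le> 1 + moment4"
  using integrable_Y[of "\<lambda>a. (section_mean a)\<^sup>2" i] expectation_Y[of "\<lambda>a. (section_mean a)\<^sup>2" i]
    section_mean_square
  by auto

lemma square_sample:
  assumes "i \<ge> 1" "j \<ge> 1" "i \<noteq> j"
  shows "integrable M (\<lambda>\<omega>. (h (Y i \<omega>) (Y j \<omega>))\<^sup>2)"
    "expectation (\<lambda>\<omega>. (h (Y i \<omega>) (Y j \<omega>))\<^sup>2) \<le> 1 + moment4"
  using integrable_Y_pair[of "\<lambda>a b. (h a b)\<^sup>2" i j] expectation_Y_pair[of "\<lambda>a b. (h a b)\<^sup>2" i j]
    square_integrable assms
  by auto

lemma row_part_square:
  assumes "i \<ge> 1" "j \<ge> 1" "i \<noteq> j"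
  shows "integrable M (\<lambda>\<omega>. (row_part (Y i \<omega>) (Y j \<omega>))\<^sup>2)"
    "expectation (\<lambda>\<omega>. (row_part (Y i \<omega>) (Y j \<omega>))\<^sup>2) \<le> 4 * (1 + moment4)"
proof -
  have le: "(row_part a b)\<^sup>2 \<le> 2 * ((h a b)\<^sup>2 + (section_mean a)\<^sup>2)" for a b
    using zero_le_power2[of "h a b + section_mean a"]
    by (simp add: row_part_def power2_eq_square algebra_simps)
  have int: "integrable M (\<lambda>\<omega>. 2 * ((h (Y i \<omega>) (Y j \<omega>))\<^sup>2 + (section_mean (Y i \<omega>))\<^sup>2))"
    using square_sample[OF assms] section_mean_sample by simp
  then show int': "integrable M (\<lambda>\<omega>. (row_part (Y i \<omega>) (Y j \<omega>))\<^sup>2)"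
    by (rule Bochner_Integration.integrable_bound)
       (use le in \<open>auto intro!: AE_I2 simp: abs_of_nonneg\<close>)
  have "expectation (\<lambda>\<omega>. (row_part (Y i \<omega>) (Y j \<omega>))\<^sup>2) \<le>
      expectation (\<lambda>\<omega>. 2 * ((h (Y i \<omega>) (Y j \<omega>))\<^sup>2 + (section_mean (Y i \<omega>))\<^sup>2))"
    by (intro integral_mono int int' le)
  also have "\<dots> \<le> 4 * (1 + moment4)"
    using square_sample[OF assms] section_mean_sample[of i] by simp
  finally show "expectation (\<lambda>\<omega>. (row_part (Y i \<omega>) (Y j \<omega>))\<^sup>2) \<le> 4 * (1 + moment4)" .
qed

lemma degen_part_square:
  assumes "i \<ge> 1" "j \<ge> 1" "i \<noteq> j"
  shows "integrable M (\<lambda>\<omega>. (degen_part (Y i \<omega>) (Y j \<omega>))\<^sup>2)"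
    "expectation (\<lambda>\<omega>. (degen_part (Y i \<omega>) (Y j \<omega>))\<^sup>2) \<le> 16 * (1 + moment4)"
proof -
  let ?b = "\<lambda>\<omega>. 4 * ((h (Y i \<omega>) (Y j \<omega>))\<^sup>2 + (section_mean (Y i \<omega>))\<^sup>2
    + (section_mean (Y j \<omega>))\<^sup>2 + mean\<^sup>2)"
  \<comment> \<open>The right side minus the left side is the sum of the six squared differences of
    the signed terms \<open>x\<close>, \<open>-y\<close>, \<open>-z\<close>,
    \<open>w\<close>.\<close>
  have "(x - y - z + w)\<^sup>2 \<le> 4 * (x\<^sup>2 + y\<^sup>2 + z\<^sup>2 + w\<^sup>2)" for x y z w :: real
    using zero_le_power2[of "x + y"] zero_le_power2[of "x + z"] zero_le_power2[of "x - w"]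
      zero_le_power2[of "y - z"] zero_le_power2[of "y + w"] zero_le_power2[of "z + w"]
    by (simp add: power2_eq_square algebra_simps)
  then have le: "(degen_part (Y i \<omega>) (Y j \<omega>))\<^sup>2 \<le> ?b \<omega>" for \<omega>
    by (simp add: degen_part_def)
  have int: "integrable M ?b"
    using square_sample[OF assms] section_mean_sample by simp
  then show int': "integrable M (\<lambda>\<omega>. (degen_part (Y i \<omega>) (Y j \<omega>))\<^sup>2)"
    by (rule Bochner_Integration.integrable_bound)
       (use le in \<open>auto intro!: AE_I2 simp: abs_of_nonneg\<close>)
  have "expectation (\<lambda>\<omega>. (degen_part (Y i \<omega>) (Y j \<omega>))\<^sup>2) \<le> expectation ?b"
    by (intro integral_mono int int' le)
  also have "\<dots> \<le> 16 * (1 + moment4)"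
    using square_sample[OF assms] section_mean_sample[of i] section_mean_sample[of j] mean_power_le(1)
    by (simp add: prob_space)
  finally show "expectation (\<lambda>\<omega>. (degen_part (Y i \<omega>) (Y j \<omega>))\<^sup>2) \<le> 16 * (1 + moment4)" .
qed

lemma expectation_sum_centred_square:
  fixes f :: "'a \<Rightarrow> real"
  assumes [measurable]: "f \<in> borel_measurable N"
    and sq: "integrable law (\<lambda>a. (f a)\<^sup>2)" and 0: "(\<integral>a. f a \<partial>law) = 0"
  shows "integrable M (\<lambda>\<omega>. (\<Sum>i\<in>{1..n}. f (Y i \<omega>))\<^sup>2)"
    and "expectation (\<lambda>\<omega>. (\<Sum>i\<in>{1..n}. f (Y i \<omega>))\<^sup>2) = real n * (\<integral>a. (f a)\<^sup>2 \<partial>law)"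
proof -
  have int: "integrable M (\<lambda>\<omega>. (f (Y i \<omega>))\<^sup>2)" for i
    using sq integrable_Y[of "\<lambda>a. (f a)\<^sup>2" i] by simp
  have orth: "expectation (\<lambda>\<omega>. f (Y i \<omega>) * f (Y j \<omega>)) = 0"
    if "i \<in> {1..n}" "j \<in> {1..n}" "i \<noteq> j" for i j
  proof -
    \<comment> \<open>The first factor ignores its first argument, so \<open>Y i\<close> is the
      variable integrated out and \<open>Y j\<close> fills the three remaining slots.\<close>
    have "expectation (\<lambda>\<omega>. (\<lambda>a b. f b) (Y j \<omega>) (Y i \<omega>) * (\<lambda>a b. f a) (Y j \<omega>) (Y j \<omega>)) = 0"
      by (rule expectation_pair_eq_0) (use that 0 in simp_all)
    then show ?thesis by simp
  qed
  show "integrable M (\<lambda>\<omega>. (\<Sum>i\<in>{1..n}. f (Y i \<omega>))\<^sup>2)"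
    by (rule expectation_sum_square_orthogonal) (auto intro!: int orth)
  have "expectation (\<lambda>\<omega>. (\<Sum>i\<in>{1..n}. f (Y i \<omega>))\<^sup>2) =
      (\<Sum>i\<in>{1..n}. expectation (\<lambda>\<omega>. (f (Y i \<omega>))\<^sup>2))"
    by (rule expectation_sum_square_orthogonal) (auto intro!: int orth)
  also have "\<dots> = real n * (\<integral>a. (f a)\<^sup>2 \<partial>law)"
    using expectation_Y[of "\<lambda>a. (f a)\<^sup>2"] by simp
  finally show "expectation (\<lambda>\<omega>. (\<Sum>i\<in>{1..n}. f (Y i \<omega>))\<^sup>2) = real n * (\<integral>a. (f a)\<^sup>2 \<partial>law)" .
qed

lemma proj_sum_square:
  "integrable M (\<lambda>\<omega>. (\<Sum>i\<in>{1..n}. proj (Y i \<omega>))\<^sup>2)"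
  "expectation (\<lambda>\<omega>. (\<Sum>i\<in>{1..n}. proj (Y i \<omega>))\<^sup>2) = real n * proj_var"
  using expectation_sum_centred_square[of proj n] proj_square(1) integral_proj
  by (simp_all add: proj_var_def)

text \<open>A weak law of large numbers with a rate that is uniform over laws with bounded fourth
  moment. The variance of the squared projection is at most the fourth moment of
  \<open>proj\<close>, and averaging over \<open>n\<close> independent points divides it by
  \<open>n\<close>.\<close>

lemma proj_square_sum_deviation:
  assumes "n \<ge> 1"
  shows "integrable M (\<lambda>\<omega>. ((\<Sum>i\<in>{1..n}. (proj (Y i \<omega>))\<^sup>2) / real n - proj_var)\<^sup>2)"
    and "expectation (\<lambda>\<omega>. ((\<Sum>i\<in>{1..n}. (proj (Y i \<omega>))\<^sup>2) / real n - proj_var)\<^sup>2) \<le>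
      16 * moment4 / real n"
proof -
  define f where "f a = (proj a)\<^sup>2 - proj_var" for a
  have [measurable]: "f \<in> borel_measurable N"
    unfolding f_def by measurable
  have f0: "(\<integral>a. f a \<partial>law) = 0"
    unfolding f_def using proj_square(1) by (simp add: proj_var_def)
  have f2: "(f a)\<^sup>2 = proj a ^ 4 - 2 * proj_var * (proj a)\<^sup>2 + proj_var\<^sup>2" for a
    by (simp add: f_def power2_diff flip: power_mult)
  have int: "integrable law (\<lambda>a. (f a)\<^sup>2)"
    unfolding f2 using proj_fourth(1) proj_square(1) by simp
  have "(\<integral>a. (f a)\<^sup>2 \<partial>law) = (\<integral>a. proj a ^ 4 \<partial>law) - 2 * proj_var * proj_var + proj_var\<^sup>2"
    unfolding f2 using proj_fourth(1) proj_square(1) by (simp add: proj_var_def)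
  also have "\<dots> \<le> 16 * moment4"
    using proj_fourth(2) zero_le_power2[of proj_var] unfolding power2_eq_square by linarith
  finally have f2_le: "(\<integral>a. (f a)\<^sup>2 \<partial>law) \<le> 16 * moment4" .
  have eq: "((\<Sum>i\<in>{1..n}. (proj (Y i \<omega>))\<^sup>2) / real n - proj_var)\<^sup>2 =
      (\<Sum>i\<in>{1..n}. f (Y i \<omega>))\<^sup>2 / (real n)\<^sup>2" for \<omega>
    using assms by (simp add: f_def sum_subtractf diff_divide_distrib flip: power_divide)
  note s = expectation_sum_centred_square[of f n, OF _ int f0]
  show "integrable M (\<lambda>\<omega>. ((\<Sum>i\<in>{1..n}. (proj (Y i \<omega>))\<^sup>2) / real n - proj_var)\<^sup>2)"
    unfolding eq using s by simp
  have "expectation (\<lambda>\<omega>. ((\<Sum>i\<in>{1..n}. (proj (Y i \<omega>))\<^sup>2) / real n - proj_var)\<^sup>2) =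
      (\<integral>a. (f a)\<^sup>2 \<partial>law) / real n"
    unfolding eq using s assms by (simp add: power2_eq_square)
  also have "\<dots> \<le> 16 * moment4 / real n"
    using f2_le by (rule divide_right_mono) simp
  finally show "expectation (\<lambda>\<omega>. ((\<Sum>i\<in>{1..n}. (proj (Y i \<omega>))\<^sup>2) / real n - proj_var)\<^sup>2) \<le>
      16 * moment4 / real n" .
qed

lemma row_mean_decomp:
  assumes "n \<ge> 2" "i \<in> {1..n}"
  shows "row_mean h n (\<lambda>i. Y i \<omega>) i - mean - proj (Y i \<omega>) =
    (\<Sum>j\<in>{1..n} - {i}. row_part (Y i \<omega>) (Y j \<omega>)) / (real n - 1)"
proof -
  have "(\<Sum>j\<in>{1..n} - {i}. row_part (Y i \<omega>) (Y j \<omega>)) =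
      (\<Sum>j\<in>{1..n} - {i}. h (Y i \<omega>) (Y j \<omega>)) - (real n - 1) * section_mean (Y i \<omega>)"
    using assms by (simp add: row_part_def sum_subtractf card_Diff_singleton of_nat_diff)
  then show ?thesis
    using assms by (simp add: row_mean_def proj_def field_simps)
qed

text \<open>Given \<open>Y i\<close>, the \<open>n - 1\<close> summands
  \<open>row_part (Y i) (Y j)\<close> are independent and centred, so their average has second
  moment of order \<open>1 / (n - 1)\<close>.\<close>

lemma row_mean_remainder:
  assumes n: "n \<ge> 2" and i: "i \<in> {1..n}"
  shows "integrable M (\<lambda>\<omega>. (row_mean h n (\<lambda>i. Y i \<omega>) i - mean - proj (Y i \<omega>))\<^sup>2)"
    and "expectation (\<lambda>\<omega>. (row_mean h n (\<lambda>i. Y i \<omega>) i - mean - proj (Y i \<omega>))\<^sup>2) \<le>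
      4 * (1 + moment4) / (real n - 1)"
proof -
  let ?J = "{1..n} - {i}"
  have int: "integrable M (\<lambda>\<omega>. (row_part (Y i \<omega>) (Y j \<omega>))\<^sup>2)" if "j \<in> ?J" for j
    using that i by (intro row_part_square) auto
  have orth: "expectation (\<lambda>\<omega>. row_part (Y i \<omega>) (Y j \<omega>) * row_part (Y i \<omega>) (Y k \<omega>)) = 0"
    if "j \<in> ?J" "k \<in> ?J" "j \<noteq> k" for j k
    using that i by (intro expectation_pair_eq_0) (auto simp: integral_row_part)
  have 1: "integrable M (\<lambda>\<omega>. (\<Sum>j\<in>?J. row_part (Y i \<omega>) (Y j \<omega>))\<^sup>2)"
    by (rule expectation_sum_square_orthogonal) (auto intro!: int orth)
  then show "integrable M (\<lambda>\<omega>. (row_mean h n (\<lambda>i. Y i \<omega>) i - mean - proj (Y i \<omega>))\<^sup>2)"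
    unfolding row_mean_decomp[OF n i] power_divide by simp
  have "expectation (\<lambda>\<omega>. (\<Sum>j\<in>?J. row_part (Y i \<omega>) (Y j \<omega>))\<^sup>2) =
      (\<Sum>j\<in>?J. expectation (\<lambda>\<omega>. (row_part (Y i \<omega>) (Y j \<omega>))\<^sup>2))"
    by (rule expectation_sum_square_orthogonal) (auto intro!: int orth)
  also have "\<dots> \<le> (\<Sum>j\<in>?J. 4 * (1 + moment4))"
    using i by (intro sum_mono row_part_square) auto
  also have "\<dots> = (real n - 1) * (4 * (1 + moment4))"
    using n i by (simp add: card_Diff_singleton of_nat_diff)
  finally have "expectation (\<lambda>\<omega>. (\<Sum>j\<in>?J. row_part (Y i \<omega>) (Y j \<omega>))\<^sup>2) / (real n - 1)\<^sup>2 \<le>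
      (real n - 1) * (4 * (1 + moment4)) / (real n - 1)\<^sup>2"
    by (rule divide_right_mono) simp
  also have "\<dots> = 4 * (1 + moment4) / (real n - 1)"
    using n by (simp add: power2_eq_square)
  finally show "expectation (\<lambda>\<omega>. (row_mean h n (\<lambda>i. Y i \<omega>) i - mean - proj (Y i \<omega>))\<^sup>2) \<le>
      4 * (1 + moment4) / (real n - 1)"
    unfolding row_mean_decomp[OF n i] power_divide by simp
qed

section \<open>The degenerate remainder of the U-statistic\<close>

definition degen_sum :: "nat \<Rightarrow> 'o \<Rightarrow> real" where
  "degen_sum n \<omega> = (\<Sum>i\<in>{1..n}. \<Sum>j\<in>{1..n} - {i}. degen_part (Y i \<omega>) (Y j \<omega>))"

lemma ustat_decomp:
  assumes n: "n \<ge> 2"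
  shows "ustat h {1..n} (\<lambda>i. Y i \<omega>) - mean - 2 / real n * (\<Sum>i\<in>{1..n}. proj (Y i \<omega>)) =
    degen_sum n \<omega> / (real n * (real n - 1))"
proof -
  let ?I = "{1..n}" and ?p = "\<lambda>i. proj (Y i \<omega>)"
  define S where "S = (\<Sum>i\<in>?I. ?p i)"
  have deg: "degen_part a b = h a b - proj a - proj b - mean" for a b
    by (simp add: degen_part_def proj_def)
  have "(\<Sum>j\<in>?I - {i}. degen_part (Y i \<omega>) (Y j \<omega>)) =
      (\<Sum>j\<in>?I - {i}. h (Y i \<omega>) (Y j \<omega>)) - (real n - 2) * ?p i - S - (real n - 1) * mean"
    if "i \<in> ?I" for i
    using n that
    by (simp add: deg sum_subtractf card_Diff_singleton of_nat_diff sum_diff1 S_def)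
       (simp add: algebra_simps)
  then have "(\<Sum>i\<in>?I. \<Sum>j\<in>?I - {i}. degen_part (Y i \<omega>) (Y j \<omega>)) =
      (\<Sum>i\<in>?I. (\<Sum>j\<in>?I - {i}. h (Y i \<omega>) (Y j \<omega>)) - (real n - 2) * ?p i - S - (real n - 1) * mean)"
    by simp
  also have "\<dots> = (\<Sum>i\<in>?I. \<Sum>j\<in>?I - {i}. h (Y i \<omega>) (Y j \<omega>))
      - (real n - 2) * S - real n * S - real n * (real n - 1) * mean"
    by (simp add: sum_subtractf S_def sum_distrib_left)
  finally have D: "(\<Sum>i\<in>?I. \<Sum>j\<in>?I - {i}. degen_part (Y i \<omega>) (Y j \<omega>)) =
      (\<Sum>i\<in>?I. \<Sum>j\<in>?I - {i}. h (Y i \<omega>) (Y j \<omega>))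
      - (real n - 2) * S - real n * S - real n * (real n - 1) * mean" .
  have U: "ustat h ?I (\<lambda>i. Y i \<omega>) =
      (\<Sum>i\<in>?I. \<Sum>j\<in>?I - {i}. h (Y i \<omega>) (Y j \<omega>)) / (real n * (real n - 1))"
    by (simp add: ustat_altdef)
  show ?thesis
    unfolding degen_sum_def D U S_def[symmetric] using n by (simp add: divide_simps) (simp add: algebra_simps)
qed

text \<open>When the unordered pairs differ, one of \<open>i\<close>, \<open>j\<close> lies outside
  \<open>{k, l}\<close> and can be integrated out. If it is \<open>i\<close>, symmetry first moves
  it into the second slot.\<close>

lemma degen_part_orthogonal:
  assumes "i \<ge> 1" "j \<ge> 1" "k \<ge> 1" "l \<ge> 1" "i \<noteq> j" "k \<noteq> l" "{i, j} \<noteq> {k, l}"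
  shows "expectation (\<lambda>\<omega>. degen_part (Y i \<omega>) (Y j \<omega>) * degen_part (Y k \<omega>) (Y l \<omega>)) = 0"
proof -
  have "j \<notin> {k, l} \<or> i \<notin> {k, l}"
    using assms by auto
  then show ?thesis
  proof
    assume "j \<notin> {k, l}"
    then show ?thesis
      using assms by (intro expectation_pair_eq_0) (auto simp: integral_degen_part)
  next
    assume "i \<notin> {k, l}"
    then have "expectation (\<lambda>\<omega>. degen_part (Y j \<omega>) (Y i \<omega>) * degen_part (Y k \<omega>) (Y l \<omega>)) = 0"
      using assms by (intro expectation_pair_eq_0) (auto simp: integral_degen_part)
    then show ?thesis
      using degen_part_sym[OF Y_space Y_space, of _ _ i j]
      by (simp cong: Bochner_Integration.integral_cong)
  qed
qed

text \<open>The terms of \<open>(i, j)\<close> and \<open>(j, i)\<close> are equal, hence not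
  orthogonal, so the sum is folded onto \<open>i < j\<close> with a factor 2. Then
  \<open>64 = 2^2 * 16\<close>, and the number of pairs is bounded crudely by
  \<open>n * (n - 1)\<close>.\<close>

lemma degen_sum_square:
  assumes n: "n \<ge> 2"
  shows "integrable M (\<lambda>\<omega>. (degen_sum n \<omega>)\<^sup>2)"
    and "expectation (\<lambda>\<omega>. (degen_sum n \<omega>)\<^sup>2) \<le>
      64 * (1 + moment4) * (real n * (real n - 1))"
proof -
  let ?I = "{1..n}"
  define A where "A = {(i, j). i \<in> ?I \<and> j \<in> ?I \<and> i < j}"
  define X where "X p \<omega> = 2 * degen_part (Y (fst p) \<omega>) (Y (snd p) \<omega>)" for p \<omega>
  have A: "A \<subseteq> Sigma ?I (\<lambda>i. ?I - {i})"
    by (auto simp: A_def)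
  have fin: "finite A"
    by (rule finite_subset[OF A]) simp
  have "card A \<le> card (Sigma ?I (\<lambda>i. ?I - {i}))"
    by (rule card_mono[OF _ A]) simp
  also have "\<dots> = n * (n - 1)"
    by (simp add: card_SigmaI card_Diff_singleton)
  finally have "real (card A) \<le> real (n * (n - 1))"
    by linarith
  then have card: "real (card A) \<le> real n * (real n - 1)"
    using n by (simp add: of_nat_diff)
  \<comment> \<open>Restricted to points of the space because \<open>h\<close> is symmetric only on
    \<open>space N\<close>.\<close>
  have sum: "degen_sum n \<omega> = (\<Sum>p\<in>A. X p \<omega>)"
    if \<omega>: "\<omega> \<in> space M" for \<omega>
  proof -
    let ?d = "\<lambda>p. degen_part (Y (fst p) \<omega>) (Y (snd p) \<omega>)"
    have "degen_sum n \<omega> = (\<Sum>p\<in>Sigma ?I (\<lambda>i. ?I - {i}). ?d p)"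
      unfolding degen_sum_def by (subst sum.Sigma) (auto simp: case_prod_beta')
    also have "Sigma ?I (\<lambda>i. ?I - {i}) = A \<union> prod.swap ` A"
      by (auto simp: A_def image_iff)
    also have "(\<Sum>p\<in>A \<union> prod.swap ` A. ?d p) = (\<Sum>p\<in>A. ?d p) + (\<Sum>p\<in>prod.swap ` A. ?d p)"
      using fin by (intro sum.union_disjoint) (auto simp: A_def)
    also have "(\<Sum>p\<in>prod.swap ` A. ?d p) = (\<Sum>p\<in>A. ?d (prod.swap p))"
      by (subst sum.reindex) (auto simp: comp_def)
    also have "\<dots> = (\<Sum>p\<in>A. ?d p)"
      using degen_part_sym[OF Y_space[OF \<omega>] Y_space[OF \<omega>]] by (intro sum.cong) auto
    finally show ?thesis
      by (simp add: X_def sum_distrib_left[symmetric])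
  qed
  have [measurable]: "X p \<in> borel_measurable M" for p
    unfolding X_def by measurable
  have X2: "integrable M (\<lambda>\<omega>. (X p \<omega>)\<^sup>2)"
      "expectation (\<lambda>\<omega>. (X p \<omega>)\<^sup>2) \<le> 64 * (1 + moment4)" if "p \<in> A" for p
    using that degen_part_square[of "fst p" "snd p"] by (auto simp: A_def X_def power_mult_distrib)
  have orth: "expectation (\<lambda>\<omega>. X p \<omega> * X q \<omega>) = 0" if "p \<in> A" "q \<in> A" "p \<noteq> q" for p q
  proof -
    have "{fst p, snd p} \<noteq> {fst q, snd q}"
      using that by (auto simp: A_def doubleton_eq_iff)
    then have "expectation (\<lambda>\<omega>. degen_part (Y (fst p) \<omega>) (Y (snd p) \<omega>) *
        degen_part (Y (fst q) \<omega>) (Y (snd q) \<omega>)) = 0"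
      using that by (intro degen_part_orthogonal) (auto simp: A_def)
    then show ?thesis
      by (simp add: X_def mult.assoc mult.left_commute)
  qed
  have "integrable M (\<lambda>\<omega>. (\<Sum>p\<in>A. X p \<omega>)\<^sup>2)"
    using fin by (rule expectation_sum_square_orthogonal) (auto intro!: X2 orth)
  then show "integrable M (\<lambda>\<omega>. (degen_sum n \<omega>)\<^sup>2)"
    by (subst Bochner_Integration.integrable_cong[OF refl, where g = "\<lambda>\<omega>. (\<Sum>p\<in>A. X p \<omega>)\<^sup>2"])
       (simp_all only: sum)
  have "expectation (\<lambda>\<omega>. (degen_sum n \<omega>)\<^sup>2) =
      expectation (\<lambda>\<omega>. (\<Sum>p\<in>A. X p \<omega>)\<^sup>2)"
    by (rule Bochner_Integration.integral_cong[OF refl]) (simp only: sum)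
  also have "\<dots> = (\<Sum>p\<in>A. expectation (\<lambda>\<omega>. (X p \<omega>)\<^sup>2))"
    using fin by (rule expectation_sum_square_orthogonal) (auto intro!: X2 orth)
  also have "\<dots> \<le> (\<Sum>p\<in>A. 64 * (1 + moment4))"
    by (intro sum_mono X2)
  also have "\<dots> = real (card A) * (64 * (1 + moment4))"
    by simp
  also have "\<dots> \<le> (real n * (real n - 1)) * (64 * (1 + moment4))"
    using card moment4_nonneg by (intro mult_right_mono) auto
  finally show "expectation (\<lambda>\<omega>. (degen_sum n \<omega>)\<^sup>2) \<le>
      64 * (1 + moment4) * (real n * (real n - 1))"
    by (simp add: mult.commute)
qed

text \<open>By orthogonality the second moment of \<open>degen_sum\<close> grows like the number of
  pairs only. So the remainder, even blown up by \<open>sqrt n\<close>, has second moment of order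
  \<open>1 / (n - 1)\<close>.\<close>

lemma ustat_projection_error:
  assumes n: "n \<ge> 2"
  defines "E \<equiv> \<lambda>\<omega>. sqrt (real n) * (ustat h {1..n} (\<lambda>i. Y i \<omega>) - mean)
      - 2 * (\<Sum>i\<in>{1..n}. proj (Y i \<omega>)) / sqrt (real n)"
  shows "integrable M (\<lambda>\<omega>. (E \<omega>)\<^sup>2)" "expectation (\<lambda>\<omega>. (E \<omega>)\<^sup>2) \<le> 64 * (1 + moment4) / (real n - 1)"
proof -
  have sn: "sqrt (real n) * sqrt (real n) = real n" by simp
  have "E \<omega> = sqrt (real n) * (ustat h {1..n} (\<lambda>i. Y i \<omega>) - mean
      - 2 / real n * (\<Sum>i\<in>{1..n}. proj (Y i \<omega>)))" for \<omega>
    using n sn unfolding E_def by (simp add: field_simps)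
  then have "E \<omega> = sqrt (real n) * (degen_sum n \<omega> / (real n * (real n - 1)))" for \<omega>
    unfolding ustat_decomp[OF n] .
  then have E: "E = (\<lambda>\<omega>. sqrt (real n) * (degen_sum n \<omega> / (real n * (real n - 1))))"
    by blast
  have E2: "(\<lambda>\<omega>. (E \<omega>)\<^sup>2) = (\<lambda>\<omega>. (degen_sum n \<omega>)\<^sup>2 / (real n * (real n - 1)\<^sup>2))"
    unfolding E power_mult_distrib power_divide
    using n by (simp add: power2_eq_square[of "real n"])
  show "integrable M (\<lambda>\<omega>. (E \<omega>)\<^sup>2)"
    unfolding E2 using degen_sum_square(1)[OF n] by simp
  have "expectation (\<lambda>\<omega>. (E \<omega>)\<^sup>2) = expectation (\<lambda>\<omega>. (degen_sum n \<omega>)\<^sup>2) / (real n * (real n - 1)\<^sup>2)"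
    unfolding E2 by simp
  also have "\<dots> \<le> 64 * (1 + moment4) * (real n * (real n - 1)) / (real n * (real n - 1)\<^sup>2)"
    using degen_sum_square(2)[OF n] by (rule divide_right_mono) simp
  also have "\<dots> = 64 * (1 + moment4) / (real n - 1)"
    using n by (simp add: power2_eq_square)
  finally show "expectation (\<lambda>\<omega>. (E \<omega>)\<^sup>2) \<le> 64 * (1 + moment4) / (real n - 1)" .
qed

section \<open>Mean-square errors entering the jackknife\<close>

lemma row_mean_remainder_mean:
  assumes n: "n \<ge> 2"
  shows "integrable M (\<lambda>\<omega>. (\<Sum>i\<in>{1..n}. (row_mean h n (\<lambda>i. Y i \<omega>) i - mean - proj (Y i \<omega>))\<^sup>2) / real n)"
    and "expectation (\<lambda>\<omega>. (\<Sum>i\<in>{1..n}. (row_mean h n (\<lambda>i. Y i \<omega>) i - mean - proj (Y i \<omega>))\<^sup>2) / real n) \<le>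
      4 * ((1 + moment4) / (real n - 1))"
proof -
  define R where "R i \<omega> = (row_mean h n (\<lambda>i. Y i \<omega>) i - mean - proj (Y i \<omega>))\<^sup>2" for i \<omega>
  have R: "integrable M (R i)" "expectation (R i) \<le> 4 * (1 + moment4) / (real n - 1)"
    if "i \<in> {1..n}" for i
    unfolding R_def using row_mean_remainder[OF n that] by auto
  then have "integrable M (\<lambda>\<omega>. (\<Sum>i\<in>{1..n}. R i \<omega>) / real n)"
    by (intro integrable_divide Bochner_Integration.integrable_sum)
  then show "integrable M (\<lambda>\<omega>. (\<Sum>i\<in>{1..n}. (row_mean h n (\<lambda>i. Y i \<omega>) i - mean - proj (Y i \<omega>))\<^sup>2) / real n)"
    unfolding R_def .
  have "expectation (\<lambda>\<omega>. (\<Sum>i\<in>{1..n}. R i \<omega>) / real n) = (\<Sum>i\<in>{1..n}. expectation (R i)) / real n"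
    using R(1) by (simp add: Bochner_Integration.integral_sum)
  also have "\<dots> \<le> (\<Sum>i\<in>{1..n}. 4 * (1 + moment4) / (real n - 1)) / real n"
    by (intro divide_right_mono sum_mono R) auto
  also have "\<dots> = 4 * ((1 + moment4) / (real n - 1))"
    using n by simp
  finally show "expectation (\<lambda>\<omega>. (\<Sum>i\<in>{1..n}. (row_mean h n (\<lambda>i. Y i \<omega>) i - mean - proj (Y i \<omega>))\<^sup>2) / real n) \<le>
      4 * ((1 + moment4) / (real n - 1))"
    unfolding R_def .
qed

text \<open>\<open>U\<close> is the mean of the row means, so it deviates from \<open>mean\<close>
  by the average projection plus the average row remainder; Cauchy-Schwarz bounds the square of the
  latter by the average square. The constant is \<open>2 * 4 + 2 * 4\<close>.\<close>

lemma ustat_mean_square: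
  assumes n: "n \<ge> 2"
  shows "integrable M (\<lambda>\<omega>. (ustat h {1..n} (\<lambda>i. Y i \<omega>) - mean)\<^sup>2)"
    and "expectation (\<lambda>\<omega>. (ustat h {1..n} (\<lambda>i. Y i \<omega>) - mean)\<^sup>2) \<le> 16 * ((1 + moment4) / (real n - 1))"
proof -
  let ?U = "\<lambda>\<omega>. ustat h {1..n} (\<lambda>i. Y i \<omega>) - mean"
  define R where "R i \<omega> = row_mean h n (\<lambda>i. Y i \<omega>) i - mean - proj (Y i \<omega>)" for i \<omega>
  define Q where "Q \<omega> = (\<Sum>i\<in>{1..n}. (R i \<omega>)\<^sup>2) / real n" for \<omega>
  define b where "b \<omega> = 2 * ((\<Sum>i\<in>{1..n}. proj (Y i \<omega>))\<^sup>2 / (real n)\<^sup>2) + 2 * Q \<omega>" for \<omega>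
  have meas: "(\<lambda>\<omega>. (?U \<omega>)\<^sup>2) \<in> borel_measurable M"
    unfolding ustat_altdef[OF finite_atLeastAtMost] by measurable
  have U: "?U \<omega> = (\<Sum>i\<in>{1..n}. proj (Y i \<omega>)) / real n + (\<Sum>i\<in>{1..n}. R i \<omega>) / real n" for \<omega>
    unfolding ustat_eq_mean_row_mean
    using n by (simp add: R_def sum_subtractf) (simp add: field_simps)
  have le: "(?U \<omega>)\<^sup>2 \<le> b \<omega>" for \<omega>
  proof -
    have sq: "(x + y)\<^sup>2 \<le> 2 * x\<^sup>2 + 2 * y\<^sup>2" for x y :: real
      using zero_le_power2[of "x - y"] by (simp add: power2_eq_square algebra_simps)
    have "((\<Sum>i\<in>{1..n}. R i \<omega>) / real n)\<^sup>2 \<le> (\<Sum>i\<in>{1..n}. (R i \<omega>)\<^sup>2) * real n / (real n)\<^sup>2"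
      using sum_squared_le_sum_of_squares[of "\<lambda>i. R i \<omega>" "{1..n}"]
      by (simp add: power_divide divide_right_mono)
    also have "\<dots> = (\<Sum>i\<in>{1..n}. (R i \<omega>)\<^sup>2) / real n"
      using n by (simp add: power2_eq_square)
    finally show ?thesis
      unfolding U b_def Q_def using sq[of "(\<Sum>i\<in>{1..n}. proj (Y i \<omega>)) / real n" "(\<Sum>i\<in>{1..n}. R i \<omega>) / real n"]
      by (simp add: power_divide)
  qed
  have Q: "integrable M Q" "expectation Q \<le> 4 * ((1 + moment4) / (real n - 1))"
    unfolding Q_def R_def using row_mean_remainder_mean[OF n] by auto
  have b: "integrable M b"
    unfolding b_def using proj_sum_square(1) Q(1) by simp
  then show int: "integrable M (\<lambda>\<omega>. (?U \<omega>)\<^sup>2)"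
    by (rule Bochner_Integration.integrable_bound) (use le meas in \<open>auto intro!: AE_I2 order_trans[OF _ abs_ge_self]\<close>)
  have "expectation (\<lambda>\<omega>. (?U \<omega>)\<^sup>2) \<le> expectation b"
    by (intro integral_mono int b le)
  also have "\<dots> = 2 * (real n * proj_var / (real n)\<^sup>2) + 2 * expectation Q"
    unfolding b_def using proj_sum_square Q(1) by simp
  also have "real n * proj_var / (real n)\<^sup>2 = proj_var / real n"
    using n by (simp add: power2_eq_square)
  also have "proj_var / real n \<le> 4 * (1 + moment4) / (real n - 1)"
    using n proj_square(2) moment4_nonneg by (intro frac_le) auto
  also note Q(2)
  finally show "expectation (\<lambda>\<omega>. (?U \<omega>)\<^sup>2) \<le> 16 * ((1 + moment4) / (real n - 1))"
    by simp
qed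

lemma jackknife_sd_measurable [measurable]:
  "(\<lambda>\<omega>. sqrt (jackknife_var h n (\<lambda>i. Y i \<omega>))) \<in> borel_measurable M"
  unfolding jackknife_var_def ustat_altdef[OF finite_Diff[OF finite_atLeastAtMost]]
    ustat_altdef[OF finite_atLeastAtMost] by measurable

text \<open>Expectation of the deterministic bound \<open>sqrt_jackknife_var_dist\<close>, with
  \<open>g\<close> the projections and \<open>\<theta>\<close> their mean level: each of the three
  error terms is of order \<open>1 / n\<close>. Here \<open>s\<close> is half of
  \<open>\<sigma>_t\<close>, and the finite-sample factor \<open>c\<close> is kept exact.\<close>

lemma jackknife_sd_error:
  fixes n :: nat and s :: real
  assumes n: "n \<ge> 3" and s: "s > 0" "s\<^sup>2 = proj_var"
  defines "c \<equiv> 2 * sqrt (real n * (real n - 1)) / (real n - 2)"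
  shows "integrable M (\<lambda>\<omega>. (sqrt (jackknife_var h n (\<lambda>i. Y i \<omega>)) - c * s)\<^sup>2)"
    and "expectation (\<lambda>\<omega>. (sqrt (jackknife_var h n (\<lambda>i. Y i \<omega>)) - c * s)\<^sup>2) \<le>
      c\<^sup>2 * (60 * ((1 + moment4) / (real n - 1)) * (1 + 1 / s\<^sup>2))"
proof -
  let ?W = "\<lambda>\<omega>. sqrt (jackknife_var h n (\<lambda>i. Y i \<omega>)) - c * s"
  define \<kappa> where "\<kappa> = (1 + moment4) / (real n - 1)"
  have \<kappa>: "\<kappa> \<ge> 0" using n moment4_nonneg by (simp add: \<kappa>_def)
  have n': "n \<ge> 2" "n \<ge> 1" using n by auto
  define R where "R i \<omega> = row_mean h n (\<lambda>i. Y i \<omega>) i - mean - proj (Y i \<omega>)" for i \<omega>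
  define Q where "Q \<omega> = (\<Sum>i\<in>{1..n}. (R i \<omega>)\<^sup>2) / real n" for \<omega>
  define U where "U \<omega> = ustat h {1..n} (\<lambda>i. Y i \<omega>) - mean" for \<omega>
  define V where "V \<omega> = (\<Sum>i\<in>{1..n}. (proj (Y i \<omega>))\<^sup>2) / real n - proj_var" for \<omega>
  let ?b = "\<lambda>\<omega>. c\<^sup>2 * (3 * (Q \<omega> + (U \<omega>)\<^sup>2 + (V \<omega>)\<^sup>2 / s\<^sup>2))"
  have le: "(?W \<omega>)\<^sup>2 \<le> ?b \<omega>" if "\<omega> \<in> space M" for \<omega>
    using sqrt_jackknife_var_dist[of n s h "\<lambda>i. Y i \<omega>" mean "\<lambda>i. proj (Y i \<omega>)",
        OF n s(1) h_sym[OF Y_space Y_space, OF that that]]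
    by (simp only: c_def Q_def R_def U_def V_def s(2))
  have Q: "integrable M Q" "expectation Q \<le> 4 * \<kappa>"
    unfolding Q_def R_def \<kappa>_def using row_mean_remainder_mean[OF n'(1)] by auto
  have U2: "integrable M (\<lambda>\<omega>. (U \<omega>)\<^sup>2)" "expectation (\<lambda>\<omega>. (U \<omega>)\<^sup>2) \<le> 16 * \<kappa>"
    unfolding U_def \<kappa>_def using ustat_mean_square[OF n'(1)] by auto
  have V2: "integrable M (\<lambda>\<omega>. (V \<omega>)\<^sup>2)" "expectation (\<lambda>\<omega>. (V \<omega>)\<^sup>2) \<le> 16 * moment4 / real n"
    unfolding V_def using proj_square_sum_deviation[OF n'(2)] by auto
  have "16 * moment4 / real n \<le> 16 * (1 + moment4) / (real n - 1)"
    using n moment4_nonneg by (intro frac_le) auto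
  then have V3: "expectation (\<lambda>\<omega>. (V \<omega>)\<^sup>2) \<le> 16 * \<kappa>"
    using V2(2) by (simp add: \<kappa>_def)
  have b: "integrable M ?b"
    using Q(1) U2(1) V2(1) by simp
  then show int: "integrable M (\<lambda>\<omega>. (?W \<omega>)\<^sup>2)"
    by (rule Bochner_Integration.integrable_bound) (use le in \<open>auto intro!: AE_I2 order_trans[OF _ abs_ge_self]\<close>)
  have "expectation (\<lambda>\<omega>. (?W \<omega>)\<^sup>2) \<le> expectation ?b"
    by (intro integral_mono int b le)
  also have "\<dots> = c\<^sup>2 * (3 * (expectation Q + expectation (\<lambda>\<omega>. (U \<omega>)\<^sup>2) + expectation (\<lambda>\<omega>. (V \<omega>)\<^sup>2) / s\<^sup>2))"
    using Q(1) U2(1) V2(1) by simp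
  also have "\<dots> \<le> c\<^sup>2 * (3 * (4 * \<kappa> + 16 * \<kappa> + 16 * \<kappa> / s\<^sup>2))"
    using Q(2) U2(2) V3 by (intro mult_left_mono add_mono divide_right_mono) auto
  \<comment> \<open>The coefficient \<open>3 * (4 + 16)\<close> is 60; the other one,
    \<open>3 * 16\<close>, is rounded up to 60 so that \<open>1 + 1 / s^2\<close> factors
    out.\<close>
  also have "\<dots> \<le> c\<^sup>2 * (60 * \<kappa> * (1 + 1 / s\<^sup>2))"
  proof (rule mult_left_mono)
    have "48 * (\<kappa> / s\<^sup>2) \<le> 60 * (\<kappa> / s\<^sup>2)"
      using \<kappa> by (intro mult_right_mono) auto
    then show "3 * (4 * \<kappa> + 16 * \<kappa> + 16 * \<kappa> / s\<^sup>2) \<le> 60 * \<kappa> * (1 + 1 / s\<^sup>2)"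
      by (simp add: algebra_simps)
  qed simp
  finally show "expectation (\<lambda>\<omega>. (?W \<omega>)\<^sup>2) \<le> c\<^sup>2 * (60 * ((1 + moment4) / (real n - 1)) * (1 + 1 / s\<^sup>2))"
    unfolding \<kappa>_def .
qed

text \<open>A central limit theorem of Lyapunov type with an explicit error at fixed
  \<open>n\<close>. The characteristic function of the sum is an \<open>n\<close>-th power; its base
  is compared with the second-order Taylor polynomial, the error being cubic, and the absolute third
  moment is at most 1 plus the fourth. A triangular array needs precisely such a bound, uniform in
  the law.\<close>

lemma char_proj_sum:
  fixes n :: nat and s x :: real
  assumes n: "n \<ge> 1" "real n \<ge> x\<^sup>2 / 4" and s: "s > 0" "s\<^sup>2 = proj_var"
  shows "norm (char (distr M borel (\<lambda>\<omega>. (\<Sum>i\<in>{1..n}. proj (Y i \<omega>)) / (sqrt (real n) * s))) x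
      - (1 + (- (x\<^sup>2) / 2) / real n) ^ n) \<le> \<bar>x\<bar> ^ 3 / (6 * sqrt (real n)) * (1 + 16 * moment4 / s ^ 4)"
proof -
  define f where "f a = proj a / s" for a
  have [measurable]: "f \<in> borel_measurable N" unfolding f_def by measurable
  have f1: "integrable law f" "(\<integral>a. f a \<partial>law) = 0"
    unfolding f_def using integrable_proj integral_proj by auto
  have f2: "integrable law (\<lambda>a. (f a)\<^sup>2)" "(\<integral>a. (f a)\<^sup>2 \<partial>law) = 1"
    unfolding f_def power_divide using proj_square(1) s by (auto simp: proj_var_def)
  have f4: "integrable law (\<lambda>a. f a ^ 4)" "(\<integral>a. f a ^ 4 \<partial>law) \<le> 16 * moment4 / s ^ 4"
    unfolding f_def power_divide using proj_fourth s by (auto intro: divide_right_mono)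
  define \<nu> where "\<nu> = distr law borel f"
  interpret \<nu>: real_distribution \<nu>
    unfolding \<nu>_def by (rule law.real_distribution_distr) simp
  let ?t = "x / sqrt (real n)"
  have var: "law.variance f = 1"
    using f1 f2 by (simp add: law.variance_eq)
  have cube: "\<bar>y\<bar> ^ 3 \<le> 1 + y ^ 4" for y :: real
  proof -
    have "\<bar>y\<bar> ^ 3 \<le> 1 + \<bar>y\<bar> ^ 4"
    proof (cases "\<bar>y\<bar> \<le> 1")
      case True
      then show ?thesis by (simp add: power_le_one add_increasing2)
    next
      case False
      then have "\<bar>y\<bar> ^ 3 \<le> \<bar>y\<bar> ^ 4" by (intro power_increasing) auto
      then show ?thesis by simp
    qed
    then show ?thesis by simp
  qed
  have int3: "integrable law (\<lambda>a. \<bar>f a\<bar> ^ 3)"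
    by (rule Bochner_Integration.integrable_bound[where f = "\<lambda>a. 1 + f a ^ 4"])
       (use f4 cube in auto)
  have "norm (char \<nu> ?t - (1 - ?t\<^sup>2 * 1 / 2)) \<le> ?t\<^sup>2 / 6 * (\<integral>a. min (6 * (f a)\<^sup>2) (\<bar>?t\<bar> * \<bar>f a\<bar> ^ 3) \<partial>law)"
    by (rule law.char_approx3') (use f1 f2 var in \<open>simp_all add: \<nu>_def\<close>)
  \<comment> \<open>The cubic branch of the minimum is kept, since it brings the extra factor
    \<open>1 / sqrt n\<close>.\<close>
  also have "\<dots> \<le> ?t\<^sup>2 / 6 * (\<integral>a. \<bar>?t\<bar> * \<bar>f a\<bar> ^ 3 \<partial>law)"
  proof (intro mult_left_mono integral_mono)
    show "integrable law (\<lambda>a. min (6 * (f a)\<^sup>2) (\<bar>?t\<bar> * \<bar>f a\<bar> ^ 3))"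
      using f2 int3 by (intro integrable_min) auto
  qed (use int3 in auto)
  also have "\<dots> \<le> ?t\<^sup>2 / 6 * (\<bar>?t\<bar> * (1 + 16 * moment4 / s ^ 4))"
  proof -
    have "(\<integral>a. \<bar>f a\<bar> ^ 3 \<partial>law) \<le> (\<integral>a. 1 + f a ^ 4 \<partial>law)"
      using f4 int3 cube by (intro integral_mono) auto
    also have "\<dots> \<le> 1 + 16 * moment4 / s ^ 4"
      using f4 by simp
    finally have "?t\<^sup>2 / 6 * (\<bar>?t\<bar> * (\<integral>a. \<bar>f a\<bar> ^ 3 \<partial>law)) \<le>
        ?t\<^sup>2 / 6 * (\<bar>?t\<bar> * (1 + 16 * moment4 / s ^ 4))"
      by (intro mult_left_mono) auto
    then show ?thesis by (simp only: integral_mult_right_zero)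
  qed
  finally have approx: "norm (char \<nu> ?t - (1 - ?t\<^sup>2 * 1 / 2)) \<le> ?t\<^sup>2 / 6 * (\<bar>?t\<bar> * (1 + 16 * moment4 / s ^ 4))" .
  have t2: "?t\<^sup>2 = x\<^sup>2 / real n"
    by (simp add: power_divide)
  have w: "1 - ?t\<^sup>2 * 1 / 2 = 1 + (- (x\<^sup>2) / 2) / real n"
    unfolding t2 by simp
  have same: "char (distr M borel (\<lambda>\<omega>. f (Y i \<omega>) / sqrt (real n))) x = char \<nu> ?t" for i
  proof -
    have "char (distr M borel (\<lambda>\<omega>. f (Y i \<omega>) / sqrt (real n))) x = (CLINT \<omega>|M. iexp (?t * f (Y i \<omega>)))"
      by (simp add: char_def integral_distr)
    also have "\<dots> = (CLINT a|distr M N (Y i). iexp (?t * f a))"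
      by (subst integral_distr) simp_all
    also have "\<dots> = char \<nu> ?t"
      unfolding same_law[of i] law_def[symmetric] by (simp add: char_def \<nu>_def integral_distr)
    finally show ?thesis .
  qed
  have "(\<lambda>\<omega>. (\<Sum>i\<in>{1..n}. proj (Y i \<omega>)) / (sqrt (real n) * s)) =
      (\<lambda>\<omega>. \<Sum>i\<in>{1..n}. f (Y i \<omega>) / sqrt (real n))"
    by (simp add: f_def sum_divide_distrib mult.commute)
  moreover have "char (distr M borel (\<lambda>\<omega>. \<Sum>i\<in>{1..n}. f (Y i \<omega>) / sqrt (real n))) x =
      (\<Prod>i\<in>{1..n}. char (distr M borel (\<lambda>\<omega>. f (Y i \<omega>) / sqrt (real n))) x)"
    by (rule char_distr_sum, rule indep_vars_compose2[where X = Y and M' = "\<lambda>_. N"],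
        rule indep_vars_subset[OF indep]) auto
  ultimately have pow: "char (distr M borel (\<lambda>\<omega>. (\<Sum>i\<in>{1..n}. proj (Y i \<omega>)) / (sqrt (real n) * s))) x =
      char \<nu> ?t ^ n"
    by (simp only: same prod_constant card_atLeastAtMost) simp
  \<comment> \<open>For numbers of modulus at most 1, \<open>n\<close>-th powers differ by at most
    \<open>n\<close> times the difference of the bases. The polynomial
    \<open>1 - x^2 / (2 n)\<close> satisfies this because \<open>n \<ge> x^2 / 4\<close>.\<close>
  have "norm (char \<nu> ?t ^ n - (complex_of_real (1 + (- (x\<^sup>2) / 2) / real n)) ^ n) \<le>
      real n * norm (char \<nu> ?t - complex_of_real (1 + (- (x\<^sup>2) / 2) / real n))"
    using n by (auto intro!: norm_power_diff \<nu>.cmod_char_le_1 abs_leI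
        simp del: of_real_diff simp: of_real_diff[symmetric] divide_le_eq)
  also have "\<dots> \<le> real n * (?t\<^sup>2 / 6 * (\<bar>?t\<bar> * (1 + 16 * moment4 / s ^ 4)))"
    using approx unfolding w by (intro mult_left_mono) simp_all
  also have "\<dots> = \<bar>x\<bar> ^ 3 / (6 * sqrt (real n)) * (1 + 16 * moment4 / s ^ 4)"
    unfolding t2 using n(1) by (simp add: power3_eq_cube power2_eq_square abs_mult)
  finally show ?thesis
    unfolding pow by simp
qed

section \<open>The studentized U-statistic\<close>

text \<open>The studentized statistic is compared with the normalised sum \<open>A\<close> of projections through
  \<open>(A - T) W = A (W - S) - E\<close>, where \<open>W\<close> is the jackknife standard deviation, \<open>S\<close> its limit, and
  \<open>E\<close> the error of the linearisation.\<close>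

lemma studentized_deviation:
  fixes n :: nat and s \<epsilon> \<mu> :: real
  assumes n: "n \<ge> 3" and s: "s > 0" "s\<^sup>2 = proj_var" and \<epsilon>: "\<epsilon> > 0"
  defines "c \<equiv> 2 * sqrt (real n * (real n - 1)) / (real n - 2)"
    and "\<kappa> \<equiv> (1 + moment4) / (real n - 1)"
  defines "d \<equiv> 2 * (c\<^sup>2 * (60 * \<kappa> * (1 + 1 / s\<^sup>2))) + 2 * ((c - 2) * s)\<^sup>2"
  shows "prob {\<omega>\<in>space M. \<bar>(\<Sum>i\<in>{1..n}. proj (Y i \<omega>)) / (sqrt (real n) * s) -
        sqrt (real n) * (ustat h {1..n} (\<lambda>i. Y i \<omega>) - \<mu>) / sqrt (jackknife_var h n (\<lambda>i. Y i \<omega>))\<bar> > \<epsilon>}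
      \<le> d / s\<^sup>2 + 2 * sqrt d / (\<epsilon> * s)
        + 8 * (64 * \<kappa> + (sqrt (real n) * (mean - \<mu>))\<^sup>2) / (\<epsilon> * s)\<^sup>2"
    (is "prob ?bad \<le> _")
proof -
  define A where "A \<omega> = (\<Sum>i\<in>{1..n}. proj (Y i \<omega>)) / (sqrt (real n) * s)" for \<omega>
  define W where "W \<omega> = sqrt (jackknife_var h n (\<lambda>i. Y i \<omega>))" for \<omega>
  \<comment> \<open>The limit \<open>S\<close> is \<open>2 * s\<close>, as \<open>s\<close> is half
    of \<open>\<sigma>_t\<close>. The gap between \<open>c\<close> and 2 is deterministic and makes
    up the second summand of \<open>d\<close>.\<close>
  define D where "D \<omega> = W \<omega> - 2 * s" for \<omega>
  define E0 where "E0 \<omega> = sqrt (real n) * (ustat h {1..n} (\<lambda>i. Y i \<omega>) - mean)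
      - 2 * (\<Sum>i\<in>{1..n}. proj (Y i \<omega>)) / sqrt (real n)" for \<omega>
  \<comment> \<open>Recentring from \<open>mean\<close> to \<open>\<mu>\<close> is absorbed into the
    linearisation error \<open>E\<close>.\<close>
  define b where "b = sqrt (real n) * (mean - \<mu>)"
  define E where "E \<omega> = E0 \<omega> + b" for \<omega>
  have sq: "(x + y)\<^sup>2 \<le> 2 * x\<^sup>2 + 2 * y\<^sup>2" for x y :: real
    using zero_le_power2[of "x - y"] by (simp add: power2_eq_square algebra_simps)
  have [measurable]: "A \<in> borel_measurable M" "W \<in> borel_measurable M" "E0 \<in> borel_measurable M"
    unfolding A_def W_def E0_def ustat_altdef[OF finite_atLeastAtMost] by measurable
  have [measurable]: "D \<in> borel_measurable M" "E \<in> borel_measurable M"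
    unfolding D_def E_def by measurable

  have A2: "integrable M (\<lambda>\<omega>. (A \<omega>)\<^sup>2)" "expectation (\<lambda>\<omega>. (A \<omega>)\<^sup>2) = 1"
    unfolding A_def power_divide using proj_sum_square[of n] n s
    by (auto simp: power_mult_distrib)
  have n': "n \<ge> 2" using n by simp
  have "(E \<omega>)\<^sup>2 \<le> 2 * (E0 \<omega>)\<^sup>2 + 2 * b\<^sup>2" for \<omega>
    unfolding E_def by (rule sq)
  moreover have E0: "integrable M (\<lambda>\<omega>. (E0 \<omega>)\<^sup>2)" "expectation (\<lambda>\<omega>. (E0 \<omega>)\<^sup>2) \<le> 64 * \<kappa>"
    unfolding E0_def \<kappa>_def using ustat_projection_error[OF n'] by auto
  ultimately have E2: "integrable M (\<lambda>\<omega>. (E \<omega>)\<^sup>2)" "expectation (\<lambda>\<omega>. (E \<omega>)\<^sup>2) \<le> 2 * (64 * \<kappa> + b\<^sup>2)"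
  proof -
    assume le: "\<And>\<omega>. (E \<omega>)\<^sup>2 \<le> 2 * (E0 \<omega>)\<^sup>2 + 2 * b\<^sup>2"
    have int: "integrable M (\<lambda>\<omega>. 2 * (E0 \<omega>)\<^sup>2 + 2 * b\<^sup>2)"
      using E0 by simp
    then show E2: "integrable M (\<lambda>\<omega>. (E \<omega>)\<^sup>2)"
      by (rule Bochner_Integration.integrable_bound) (use le in \<open>auto intro!: AE_I2 order_trans[OF _ abs_ge_self]\<close>)
    have "expectation (\<lambda>\<omega>. (E \<omega>)\<^sup>2) \<le> expectation (\<lambda>\<omega>. 2 * (E0 \<omega>)\<^sup>2 + 2 * b\<^sup>2)"
      by (intro integral_mono E2 int le)
    also have "\<dots> \<le> 2 * (64 * \<kappa> + b\<^sup>2)"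
      using E0 by (simp add: prob_space)
    finally show "expectation (\<lambda>\<omega>. (E \<omega>)\<^sup>2) \<le> 2 * (64 * \<kappa> + b\<^sup>2)" .
  qed
  have D2: "integrable M (\<lambda>\<omega>. (D \<omega>)\<^sup>2)" "expectation (\<lambda>\<omega>. (D \<omega>)\<^sup>2) \<le> d"
  proof -
    have le: "(D \<omega>)\<^sup>2 \<le> 2 * (W \<omega> - c * s)\<^sup>2 + 2 * ((c - 2) * s)\<^sup>2" for \<omega>
      using sq[of "W \<omega> - c * s" "(c - 2) * s"] by (simp add: D_def algebra_simps)
    have W2: "integrable M (\<lambda>\<omega>. (W \<omega> - c * s)\<^sup>2)"
        "expectation (\<lambda>\<omega>. (W \<omega> - c * s)\<^sup>2) \<le> c\<^sup>2 * (60 * \<kappa> * (1 + 1 / s\<^sup>2))"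
      unfolding W_def c_def \<kappa>_def using jackknife_sd_error[OF n s] by auto
    have int: "integrable M (\<lambda>\<omega>. 2 * (W \<omega> - c * s)\<^sup>2 + 2 * ((c - 2) * s)\<^sup>2)"
      using W2 by simp
    then show D2: "integrable M (\<lambda>\<omega>. (D \<omega>)\<^sup>2)"
      by (rule Bochner_Integration.integrable_bound) (use le in \<open>auto intro!: AE_I2 order_trans[OF _ abs_ge_self]\<close>)
    have "expectation (\<lambda>\<omega>. (D \<omega>)\<^sup>2) \<le> expectation (\<lambda>\<omega>. 2 * (W \<omega> - c * s)\<^sup>2 + 2 * ((c - 2) * s)\<^sup>2)"
      by (intro integral_mono D2 int le)
    also have "\<dots> \<le> d"
      using W2 by (simp add: prob_space d_def ac_simps)
    finally show "expectation (\<lambda>\<omega>. (D \<omega>)\<^sup>2) \<le> d" .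
  qed
  \<comment> \<open>Strict positivity of \<open>d\<close> is required because the estimate of
    \<open>A * D\<close> divides by \<open>sqrt d\<close>.\<close>
  have "\<kappa> > 0"
    using n moment4_nonneg by (simp add: \<kappa>_def add_pos_nonneg)
  moreover have "c > 0"
    using n by (simp add: c_def)
  ultimately have d: "d > 0"
    unfolding d_def by (intro add_pos_nonneg mult_pos_pos) (auto intro: add_pos_nonneg)

  \<comment> \<open>Cauchy-Schwarz through the weighted inequality between arithmetic and geometric
    means. The weight \<open>sqrt d\<close> makes both terms contribute at most
    \<open>sqrt d / 2\<close>, since \<open>A\<close> has second moment 1 and \<open>D\<close> at
    most \<open>d\<close>.\<close>
  have AD: "expectation (\<lambda>\<omega>. \<bar>A \<omega> * D \<omega>\<bar>) \<le> sqrt d"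
  proof -
    have le: "\<bar>A \<omega> * D \<omega>\<bar> \<le> sqrt d / 2 * (A \<omega>)\<^sup>2 + 1 / (2 * sqrt d) * (D \<omega>)\<^sup>2" for \<omega>
    proof -
      have "0 \<le> (sqrt d * \<bar>A \<omega>\<bar> - \<bar>D \<omega>\<bar>)\<^sup>2" by simp
      then have "2 * sqrt d * \<bar>A \<omega> * D \<omega>\<bar> \<le> (sqrt d)\<^sup>2 * (A \<omega>)\<^sup>2 + (D \<omega>)\<^sup>2"
        by (simp add: power2_diff power_mult_distrib abs_mult)
      then have "\<bar>A \<omega> * D \<omega>\<bar> \<le> ((sqrt d)\<^sup>2 * (A \<omega>)\<^sup>2 + (D \<omega>)\<^sup>2) / (2 * sqrt d)"
        using d by (simp add: pos_le_divide_eq mult.commute)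
      also have "\<dots> = sqrt d / 2 * (A \<omega>)\<^sup>2 + 1 / (2 * sqrt d) * (D \<omega>)\<^sup>2"
        using d by (simp add: add_divide_distrib power2_eq_square[of "sqrt d"] del: real_sqrt_mult_self)
      finally show ?thesis .
    qed
    have "integrable M (\<lambda>\<omega>. A \<omega> * D \<omega>)"
      by (intro integrable_mult_square_integrable A2 D2) auto
    then have "expectation (\<lambda>\<omega>. \<bar>A \<omega> * D \<omega>\<bar>) \<le>
        expectation (\<lambda>\<omega>. sqrt d / 2 * (A \<omega>)\<^sup>2 + 1 / (2 * sqrt d) * (D \<omega>)\<^sup>2)"
      using A2(1) D2(1) le by (intro integral_mono) auto
    also have "\<dots> = sqrt d / 2 + 1 / (2 * sqrt d) * expectation (\<lambda>\<omega>. (D \<omega>)\<^sup>2)"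
      using A2 D2(1) by simp
    also have "\<dots> \<le> sqrt d / 2 + 1 / (2 * sqrt d) * d"
      using D2(2) d by (intro add_left_mono mult_left_mono) auto
    also have "\<dots> = sqrt d"
      using d real_div_sqrt[of d] by (simp add: field_simps)
    finally show ?thesis .
  qed

  \<comment> \<open>Outside \<open>?B1\<close> the jackknife deviation \<open>W\<close> exceeds
    \<open>s\<close>, so it is bounded away from 0 and a deviation above \<open>\<epsilon>\<close>
    forces \<open>\<bar>A * D - E\<bar>\<close> to be at least \<open>\<epsilon> * s\<close>; one of
    the two terms then carries half of it.\<close>
  let ?B1 = "{\<omega>\<in>space M. \<bar>D \<omega>\<bar> \<ge> s}"
    and ?B2 = "{\<omega>\<in>space M. \<bar>A \<omega> * D \<omega>\<bar> \<ge> \<epsilon> * s / 2}"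
    and ?B3 = "{\<omega>\<in>space M. \<bar>E \<omega>\<bar> \<ge> \<epsilon> * s / 2}"
  have "?bad \<subseteq> ?B1 \<union> (?B2 \<union> ?B3)"
  proof
    fix \<omega> assume \<omega>: "\<omega> \<in> ?bad"
    show "\<omega> \<in> ?B1 \<union> (?B2 \<union> ?B3)"
    proof (cases "\<bar>D \<omega>\<bar> \<ge> s")
      case False
      then have W: "W \<omega> > s" by (simp add: D_def)
      define T where "T = sqrt (real n) * (ustat h {1..n} (\<lambda>i. Y i \<omega>) - \<mu>) / W \<omega>"
      have dev: "\<bar>A \<omega> - T\<bar> > \<epsilon>"
        using \<omega> by (simp add: A_def T_def W_def)
      have TW: "T * W \<omega> = sqrt (real n) * (ustat h {1..n} (\<lambda>i. Y i \<omega>) - \<mu>)"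
        using W s by (simp add: T_def)
      have "2 * s * A \<omega> = 2 * (\<Sum>i\<in>{1..n}. proj (Y i \<omega>)) / sqrt (real n)"
        using s by (simp add: A_def)
      then have "(A \<omega> - T) * W \<omega> = A \<omega> * D \<omega> - E \<omega>"
        using TW by (simp add: D_def E_def E0_def b_def algebra_simps)
      then have "\<bar>A \<omega> - T\<bar> * W \<omega> = \<bar>A \<omega> * D \<omega> - E \<omega>\<bar>"
        using W s by (metis abs_mult abs_of_pos less_trans)
      moreover have "\<epsilon> * s \<le> \<bar>A \<omega> - T\<bar> * W \<omega>"
        using dev W s \<epsilon> by (intro mult_mono) auto
      ultimately have "\<epsilon> * s / 2 \<le> \<bar>A \<omega> * D \<omega>\<bar> \<or> \<epsilon> * s / 2 \<le> \<bar>E \<omega>\<bar>"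
        by linarith
      then show ?thesis using \<omega> by auto
    qed (use \<omega> in auto)
  qed
  then have "prob ?bad \<le> prob (?B1 \<union> (?B2 \<union> ?B3))"
    by (intro finite_measure_mono) auto
  also have "\<dots> \<le> prob ?B1 + prob (?B2 \<union> ?B3)"
    by (intro measure_Un_le) auto
  also have "prob (?B2 \<union> ?B3) \<le> prob ?B2 + prob ?B3"
    by (intro measure_Un_le) auto
  also have "prob ?B1 \<le> d / s\<^sup>2"
    by (rule order_trans[OF markov_square divide_right_mono]) (use D2 s(1) in auto)
  also have "prob ?B2 \<le> 2 * sqrt d / (\<epsilon> * s)"
  proof -
    have "integrable M (\<lambda>\<omega>. \<bar>A \<omega> * D \<omega>\<bar>)"
      by (intro integrable_abs integrable_mult_square_integrable A2 D2) auto
    then have "prob ?B2 \<le> expectation (\<lambda>\<omega>. \<bar>A \<omega> * D \<omega>\<bar>) / (\<epsilon> * s / 2)"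
      using \<epsilon> s integral_Markov_inequality_measure[of M "\<lambda>\<omega>. \<bar>A \<omega> * D \<omega>\<bar>" "space M" "\<epsilon> * s / 2"]
      by simp
    also have "\<dots> \<le> sqrt d / (\<epsilon> * s / 2)"
      using AD \<epsilon> s by (intro divide_right_mono) auto
    finally show ?thesis by (simp add: mult.commute)
  qed
  also have "prob ?B3 \<le> 8 * (64 * \<kappa> + b\<^sup>2) / (\<epsilon> * s)\<^sup>2"
  proof -
    have "prob ?B3 \<le> expectation (\<lambda>\<omega>. (E \<omega>)\<^sup>2) / (\<epsilon> * s / 2)\<^sup>2"
      using E2 \<epsilon> s by (intro markov_square) auto
    also have "\<dots> \<le> 2 * (64 * \<kappa> + b\<^sup>2) / (\<epsilon> * s / 2)\<^sup>2"
      using E2 by (intro divide_right_mono) auto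
    finally show ?thesis by (simp add: power_divide)
  qed
  finally show ?thesis by (simp add: b_def)
qed

end

text \<open>The limit theorem for triangular arrays: row \<open>n\<close> is the sample
  \<open>Y n\<close>, whose law may depend on \<open>n\<close>. The assumptions on the rows are
  eventual because the moment condition controls late rows only, whereas measurability of the
  statistic is asked of every \<open>n\<close> by Levy's theorem.\<close>

theorem jackknife_clt:
  fixes M :: "'o measure" and N :: "'a measure" and Y :: "nat \<Rightarrow> nat \<Rightarrow> 'o \<Rightarrow> 'a"
    and h :: "'a \<Rightarrow> 'a \<Rightarrow> real" and \<mu> \<sigma>2 K :: real
  defines "T \<equiv> \<lambda>n \<omega>. sqrt (real n) * (ustat h {1..n} (\<lambda>i. Y n i \<omega>) - \<mu>)
      / sqrt (jackknife_var h n (\<lambda>i. Y n i \<omega>))"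
  assumes M: "prob_space M" and T: "\<And>n. T n \<in> borel_measurable M"
    and sample: "eventually (\<lambda>n. kernel_sample M N (Y n) h) sequentially"
    and moment: "eventually (\<lambda>n. kernel_sample.moment4 M (Y n) h \<le> K) sequentially"
    and var: "(\<lambda>n. 4 * kernel_sample.proj_var M N (Y n) h) \<longlonglongrightarrow> \<sigma>2" "\<sigma>2 > 0"
    and mean: "(\<lambda>n. sqrt (real n) * (kernel_sample.mean M N (Y n) h - \<mu>)) \<longlonglongrightarrow> 0"
  shows "weak_conv_m (\<lambda>n. distr M borel (T n)) std_normal_distribution"
proof -
  interpret prob_space M by (rule M)
  define p where "p n = kernel_sample.proj M N (Y n) h" for n
  define s where "s n = sqrt (kernel_sample.proj_var M N (Y n) h)" for n
  define m4 where "m4 n = kernel_sample.moment4 M (Y n) h" for n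
  define b where "b n = sqrt (real n) * (kernel_sample.mean M N (Y n) h - \<mu>)" for n
  define A where "A n \<omega> = (\<Sum>i\<in>{1..n}. p n (Y n i \<omega>)) / (sqrt (real n) * s n)" for n \<omega>
  define c where "c n = 2 * sqrt (real n * (real n - 1)) / (real n - 2)" for n :: nat
  define \<kappa> where "\<kappa> n = (1 + m4 n) / (real n - 1)" for n
  define d where "d n = 2 * ((c n)\<^sup>2 * (60 * \<kappa> n * (1 + 1 / (s n)\<^sup>2))) + 2 * ((c n - 2) * s n)\<^sup>2" for n

  \<comment> \<open>The limit of \<open>s\<close>, half the limiting standard deviation, because
    \<open>\<sigma>2\<close> is the limit of four times \<open>proj_var\<close>.\<close>
  define \<sigma> where "\<sigma> = sqrt (\<sigma>2 / 4)"
  have \<sigma>: "\<sigma> > 0" using var(2) by (simp add: \<sigma>_def)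
  have pv: "(\<lambda>n. kernel_sample.proj_var M N (Y n) h) \<longlonglongrightarrow> \<sigma>2 / 4"
    using tendsto_divide[OF var(1) tendsto_const[of 4]] by simp
  then have s_lim: "s \<longlonglongrightarrow> \<sigma>"
    unfolding s_def \<sigma>_def by (rule tendsto_real_sqrt)
  have pv_pos: "eventually (\<lambda>n. kernel_sample.proj_var M N (Y n) h > 0) sequentially"
    using order_tendstoD(1)[OF pv, of 0] var(2) by simp
  have b_lim: "b \<longlonglongrightarrow> 0" using mean by (simp add: b_def[abs_def])
  have m4_bounds: "eventually (\<lambda>n. 0 \<le> m4 n \<and> m4 n \<le> K) sequentially"
    using sample moment by eventually_elim (auto simp: m4_def kernel_sample.moment4_nonneg)
  have \<kappa>_lim: "\<kappa> \<longlonglongrightarrow> 0"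
  proof (rule tendsto_sandwich)
    show "eventually (\<lambda>n. 0 \<le> \<kappa> n) sequentially"
      using m4_bounds eventually_ge_at_top[of 2] by eventually_elim (simp add: \<kappa>_def)
    show "eventually (\<lambda>n. \<kappa> n \<le> (1 + K) / (real n - 1)) sequentially"
      using m4_bounds eventually_ge_at_top[of 2]
      by eventually_elim (auto simp: \<kappa>_def intro!: divide_right_mono)
    show "(\<lambda>n. (1 + K) / (real n - 1)) \<longlonglongrightarrow> 0" by real_asymp
  qed simp
  have c_lim: "c \<longlonglongrightarrow> 2"
    unfolding c_def by real_asymp
  have "d \<longlonglongrightarrow> 2 * (2\<^sup>2 * (60 * 0 * (1 + 1 / \<sigma>\<^sup>2))) + 2 * ((2 - 2) * \<sigma>)\<^sup>2"
    unfolding d_def using \<sigma> by (intro tendsto_intros c_lim \<kappa>_lim s_lim) auto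
  then have d_lim: "d \<longlonglongrightarrow> 0" by simp

  show ?thesis
  proof (rule weak_conv_std_normal_perturb)
    show "T n \<in> borel_measurable M" for n by (rule T)
    show "eventually (\<lambda>n. A n \<in> borel_measurable M) sequentially"
      using sample
    proof eventually_elim
      case (elim n)
      interpret kernel_sample M N "Y n" h by (rule elim)
      show ?case unfolding A_def p_def by measurable
    qed
  next
    fix x :: real
    define e where "e n = (1 + (- (x\<^sup>2) / 2) / real n) ^ n" for n :: nat
    define B where "B n = \<bar>x\<bar> ^ 3 / (6 * sqrt (real n)) * (1 + 16 * K / s n ^ 4)" for n :: nat
    have "e \<longlonglongrightarrow> exp (- (x\<^sup>2) / 2)"
      unfolding e_def by (rule tendsto_exp_limit_sequentially)
    then have e_lim: "(\<lambda>n. complex_of_real (e n)) \<longlonglongrightarrow> complex_of_real (exp (- (x\<^sup>2) / 2))"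
      by (rule tendsto_of_real)
    have "(\<lambda>n. \<bar>x\<bar> ^ 3 / (6 * sqrt (real n))) \<longlonglongrightarrow> 0" by real_asymp
    then have "B \<longlonglongrightarrow> 0 * (1 + 16 * K / \<sigma> ^ 4)"
      unfolding B_def using \<sigma> by (intro tendsto_intros s_lim) auto
    then have B_lim: "B \<longlonglongrightarrow> 0" by simp
    have "eventually (\<lambda>n. real n \<ge> x\<^sup>2 / 4) sequentially" by real_asymp
    then have "eventually (\<lambda>n. norm (char (distr M borel (A n)) x - complex_of_real (e n)) \<le> B n) sequentially"
      using sample moment pv_pos eventually_ge_at_top[of 1]
    proof eventually_elim
      case (elim n)
      interpret kernel_sample M N "Y n" h by (rule elim)
      have s: "s n > 0" "(s n)\<^sup>2 = proj_var"
        using elim by (auto simp: s_def)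
      have "norm (char (distr M borel (A n)) x - complex_of_real (e n)) \<le>
          \<bar>x\<bar> ^ 3 / (6 * sqrt (real n)) * (1 + 16 * moment4 / s n ^ 4)"
        using char_proj_sum[OF elim(5,1) s] by (simp add: A_def[abs_def] p_def e_def)
      also have "\<dots> \<le> B n"
        unfolding B_def using elim s by (intro mult_left_mono add_left_mono divide_right_mono) auto
      finally show ?case .
    qed
    then have "(\<lambda>n. char (distr M borel (A n)) x - complex_of_real (e n)) \<longlonglongrightarrow> 0"
      by (rule Lim_null_comparison[OF _ B_lim])
    from tendsto_add[OF this e_lim]
    show "(\<lambda>n. char (distr M borel (A n)) x) \<longlonglongrightarrow> exp (- x\<^sup>2 / 2)"
      by (simp add: exp_of_real)
  next
    fix \<epsilon> :: real assume \<epsilon>: "\<epsilon> > 0"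
    define r where "r n = d n / (s n)\<^sup>2 + 2 * sqrt (d n) / (\<epsilon> * s n) + 8 * (64 * \<kappa> n + (b n)\<^sup>2) / (\<epsilon> * s n)\<^sup>2" for n
    have "r \<longlonglongrightarrow> 0 / \<sigma>\<^sup>2 + 2 * sqrt 0 / (\<epsilon> * \<sigma>) + 8 * (64 * 0 + 0\<^sup>2) / (\<epsilon> * \<sigma>)\<^sup>2"
      unfolding r_def using \<sigma> \<epsilon> by (intro tendsto_intros d_lim s_lim \<kappa>_lim b_lim) auto
    then have r_lim: "r \<longlonglongrightarrow> 0" by simp
    show "(\<lambda>n. prob {\<omega>\<in>space M. \<bar>A n \<omega> - T n \<omega>\<bar> > \<epsilon>}) \<longlonglongrightarrow> 0"
    proof (rule tendsto_sandwich[OF _ _ tendsto_const r_lim])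
      show "eventually (\<lambda>n. prob {\<omega>\<in>space M. \<bar>A n \<omega> - T n \<omega>\<bar> > \<epsilon>} \<le> r n) sequentially"
        using sample pv_pos eventually_ge_at_top[of 3]
      proof eventually_elim
        case (elim n)
        interpret kernel_sample M N "Y n" h by (rule elim)
        have s: "s n > 0" "(s n)\<^sup>2 = proj_var"
          using elim by (auto simp: s_def)
        show ?case
          using studentized_deviation[OF elim(3) s \<epsilon>, of \<mu>]
          unfolding A_def T_def p_def r_def d_def c_def \<kappa>_def m4_def b_def .
      qed
    qed simp
  qed
qed

section \<open>Difference operators and mixed derivatives\<close>

lemma rmod_of_int: "real_of_int a rmod real L = real_of_int (a mod int L)" if "L > 0"
proof (rule rmod_unique)
  have "a mod int L < int L" using that by simp
  then have "real_of_int (a mod int L) < real L" by linarith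
  then show "real_of_int (a mod int L) \<in> {0..<\<bar>real L\<bar>}"
    using that by simp
  have "real_of_int a = real_of_int (a mod int L + (a div int L) * int L)"
    by simp
  then show "real_of_int a = real_of_int (a mod int L) + real_of_int (a div int L) * real L"
    by (metis of_int_add of_int_mult of_int_of_nat_eq)
qed

lemma cyc_shift_grid:
  assumes "x \<in> grid L"
  shows "cyc_shift L d (real_of_int c) x \<in> grid L"
  unfolding grid_def
proof (intro CollectI allI)
  fix i
  obtain j where j: "j < L" "x $ i = real j"
    using assms by (auto simp: grid_def)
  show "\<exists>j<L. cyc_shift L d (real_of_int c) x $ i = real j"
  proof (cases "i = d")
    case True
    have "x $ i + real_of_int c = real_of_int (int j + c)"
      by (simp add: j)
    then have "cyc_shift L d (real_of_int c) x $ i = real_of_int ((int j + c) mod int L)"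
      using True j rmod_of_int[of L "int j + c"] by (simp add: cyc_shift_def)
    also have "\<dots> = real (nat ((int j + c) mod int L))"
      using j by simp
    finally show ?thesis
      using j by (intro exI[of _ "nat ((int j + c) mod int L)"]) (auto simp: nat_less_iff)
  qed (use j in \<open>auto simp: cyc_shift_def\<close>)
qed

lemma cyc_shift_grid_fwd: "x \<in> grid L \<Longrightarrow> cyc_shift L d 1 x \<in> grid L"
  using cyc_shift_grid[of x L d 1] by simp

lemma cyc_shift_grid_bwd: "x \<in> grid L \<Longrightarrow> cyc_shift L d (-1) x \<in> grid L"
  using cyc_shift_grid[of x L d "-1"] by simp

lemma finite_grid: "finite (grid L :: (real ^ 'd::finite) set)"
proof (rule finite_subset)
  show "grid L \<subseteq> vec_lambda ` (\<Pi>\<^sub>E i\<in>(UNIV :: 'd set). real ` {..<L})"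
  proof
    fix x :: "real ^ 'd" assume "x \<in> grid L"
    then have "vec_nth x \<in> (\<Pi>\<^sub>E i\<in>UNIV. real ` {..<L})"
      by (auto simp: grid_def)
    then show "x \<in> vec_lambda ` (\<Pi>\<^sub>E i\<in>UNIV. real ` {..<L})"
      by (metis image_eqI vec_nth_inverse)
  qed
qed (intro finite_imageI finite_PiE, auto)

text \<open>\<open>pderiv_at\<close> is a derivative at parameter 0 of a line; translating the
  parameter gives the derivative at any \<open>s\<close>, the form that the mean value theorem
  consumes.\<close>

lemma differentiable_axis_DERIV:
  assumes "f differentiable (at (x + s *\<^sub>R axis d 1))"
  shows "((\<lambda>h. f (x + h *\<^sub>R axis d 1)) has_real_derivative pderiv_at d f (x + s *\<^sub>R axis d 1)) (at s)"
proof -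
  let ?e = "axis d (1::real)" and ?y = "x + s *\<^sub>R axis d (1::real)"
  obtain f' where f': "(f has_derivative f') (at ?y)"
    using assms by (auto simp: differentiable_def)
  have "((\<lambda>h. f (?y + h *\<^sub>R ?e)) has_derivative (\<lambda>h. f' (h *\<^sub>R ?e))) (at 0)"
    by (rule has_derivative_compose[where g = f and s = UNIV and f = "\<lambda>h. ?y + h *\<^sub>R ?e", simplified])
       (auto intro!: derivative_eq_intros f')
  then have "(\<lambda>h. f (?y + h *\<^sub>R ?e)) differentiable (at 0)"
    by (auto simp: differentiable_def)
  then have "(\<lambda>h. f (?y + h *\<^sub>R ?e)) field_differentiable (at 0)"
    by (simp add: field_differentiable_def real_differentiable_def)
  then have "((\<lambda>h. f (?y + h *\<^sub>R ?e)) has_real_derivative pderiv_at d f ?y) (at 0)"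
    unfolding pderiv_at_def by (rule DERIV_deriv_iff_field_differentiable[THEN iffD2])
  then have "((\<lambda>h. f (?y + (h - s) *\<^sub>R ?e)) has_real_derivative pderiv_at d f ?y) (at s)"
    using DERIV_shift[of "\<lambda>h. f (?y + (h - s) *\<^sub>R ?e)" "pderiv_at d f ?y" 0 s]
    by simp
  then show ?thesis
    by (simp add: scaleR_left_diff_distrib add.assoc)
qed

lemma pderiv_at_limit:
  assumes "f differentiable (at x)"
  shows "(\<lambda>n. (f (x + inverse (real (Suc n)) *\<^sub>R axis d 1) - f x) / inverse (real (Suc n)))
    \<longlonglongrightarrow> pderiv_at d f x"
proof -
  have "((\<lambda>h. f (x + h *\<^sub>R axis d 1)) has_real_derivative pderiv_at d f x) (at 0)"
    using differentiable_axis_DERIV[of f x 0 d] assms by simp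
  then have lim: "((\<lambda>h. (f (x + h *\<^sub>R axis d 1) - f x) / h) \<longlongrightarrow> pderiv_at d f x) (at 0)"
    by (simp add: DERIV_def)
  have "filterlim (\<lambda>n. inverse (real (Suc n))) (at 0) sequentially"
    unfolding filterlim_at using LIMSEQ_inverse_real_of_nat by simp
  from filterlim_compose[OF lim this] show ?thesis .
qed

text \<open>Along the steps \<open>1 / (n + 1)\<close> the difference quotients are jointly
  measurable, as translating the point is, and their pointwise limit is the partial
  derivative.\<close>

lemma measurable_pderiv_at:
  fixes g :: "'z \<Rightarrow> real ^ 'd::finite \<Rightarrow> real"
  assumes [measurable]: "(\<lambda>(x, z). g z x) \<in> borel_measurable (borel \<Otimes>\<^sub>M N)"
    and diff: "\<And>z x. z \<in> space N \<Longrightarrow> g z differentiable (at x)"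
  shows "(\<lambda>(x, z). pderiv_at d (g z) x) \<in> borel_measurable (borel \<Otimes>\<^sub>M N)"
proof (rule borel_measurable_LIMSEQ_real)
  fix p assume "p \<in> space (borel \<Otimes>\<^sub>M N :: ((real ^ 'd) \<times> 'z) measure)"
  then have "snd p \<in> space N" by (auto simp: space_pair_measure)
  then show "(\<lambda>n. (\<lambda>(x, z). (g z (x + inverse (real (Suc n)) *\<^sub>R axis d 1) - g z x)
      / inverse (real (Suc n))) p) \<longlonglongrightarrow> (\<lambda>(x, z). pderiv_at d (g z) x) p"
    using pderiv_at_limit[OF diff, of "snd p" "fst p" d] by (simp add: case_prod_beta')
next
  fix n
  have [measurable]: "(\<lambda>(x, z). g z (x + c)) \<in> borel_measurable (borel \<Otimes>\<^sub>M N)" for c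
  proof -
    have "(\<lambda>p. (fst p + c, snd p)) \<in> (borel \<Otimes>\<^sub>M N) \<rightarrow>\<^sub>M (borel \<Otimes>\<^sub>M N)"
      by measurable
    from measurable_compose[OF this assms(1)] show ?thesis
      by (simp add: case_prod_beta')
  qed
  show "(\<lambda>(x, z). (g z (x + inverse (real (Suc n)) *\<^sub>R axis d 1) - g z x) / inverse (real (Suc n)))
      \<in> borel_measurable (borel \<Otimes>\<^sub>M N)"
    unfolding case_prod_beta' by (intro borel_measurable_divide borel_measurable_diff) measurable
qed

text \<open>The second argument is rounded to the lattice of mesh \<open>1 / (n + 1)\<close>.\<close>

lemma caratheodory_measurable:
  fixes f :: "'x \<Rightarrow> real ^ 'd::finite \<Rightarrow> real"
  assumes meas: "\<And>y. (\<lambda>x. f x y) \<in> borel_measurable N"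
    and cont: "\<And>x. x \<in> space N \<Longrightarrow> continuous_on UNIV (f x)"
  shows "(\<lambda>(x, y). f x y) \<in> borel_measurable (N \<Otimes>\<^sub>M borel)"
proof (rule borel_measurable_LIMSEQ_real)
  let ?h = "\<lambda>n. real (Suc n)"
  define q where "q n y = (\<chi> i. \<lfloor>?h n * (y $ i)\<rfloor>)" for n and y :: "real ^ 'd"
  define r where "r n v = (\<chi> i. real_of_int (v $ i) / ?h n)" for n and v :: "int ^ 'd"
  have r_lim: "(\<lambda>n. r n (q n y)) \<longlonglongrightarrow> y" for y
  proof (rule vec_tendstoI)
    fix i
    have "norm (r n (q n y) $ i - y $ i) \<le> inverse (?h n)" for n
    proof -
      have "r n (q n y) $ i - y $ i = (real_of_int \<lfloor>?h n * (y $ i)\<rfloor> - ?h n * (y $ i)) / ?h n"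
        by (simp add: r_def q_def diff_divide_distrib del: of_nat_Suc)
      moreover have "\<bar>real_of_int \<lfloor>?h n * (y $ i)\<rfloor> - ?h n * (y $ i)\<bar> \<le> 1"
        by linarith
      then have "\<bar>real_of_int \<lfloor>?h n * (y $ i)\<rfloor> - ?h n * (y $ i)\<bar> / ?h n \<le> 1 / ?h n"
        by (rule divide_right_mono) simp
      ultimately show ?thesis
        by (simp add: inverse_eq_divide del: of_nat_Suc)
    qed
    then have "(\<lambda>n. r n (q n y) $ i - y $ i) \<longlonglongrightarrow> 0"
      by (intro Lim_null_comparison[OF _ LIMSEQ_inverse_real_of_nat]) (auto simp del: of_nat_Suc)
    then show "(\<lambda>n. r n (q n y) $ i) \<longlonglongrightarrow> y $ i"
      by (rule LIM_zero_cancel)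
  qed
  show "(\<lambda>n. (\<lambda>(x, y). f x (r n (q n y))) p) \<longlonglongrightarrow> (\<lambda>(x, y). f x y) p"
    if "p \<in> space (N \<Otimes>\<^sub>M borel)" for p
  proof -
    have "fst p \<in> space N" using that by (auto simp: space_pair_measure)
    from cont[OF this] have "isCont (f (fst p)) (snd p)"
      by (simp add: continuous_on_eq_continuous_at)
    from isCont_tendsto_compose[OF this r_lim] show ?thesis
      by (simp add: case_prod_beta')
  qed
  fix n
  have "q n \<in> borel \<rightarrow>\<^sub>M count_space UNIV"
  proof (rule measurableI)
    fix A :: "(int ^ 'd) set"
    have "q n -` {v} = (\<Inter>i\<in>UNIV. (\<lambda>y. \<lfloor>?h n * (y $ i)\<rfloor>) -` {v $ i})" for v
      by (auto simp: q_def vec_eq_iff)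
    moreover have "(\<lambda>y::real ^ 'd. \<lfloor>?h n * (y $ i)\<rfloor>) -` {k} \<in> sets borel" for i k
    proof -
      have "(\<lambda>y::real ^ 'd. \<lfloor>?h n * (y $ i)\<rfloor>) \<in> borel \<rightarrow>\<^sub>M count_space UNIV"
        by measurable
      from measurable_sets[OF this, of "{k}"] show ?thesis by simp
    qed
    ultimately have "q n -` {v} \<in> sets borel" for v
      by (simp add: sets.finite_INT)
    moreover have "q n -` A = (\<Union>v\<in>A. q n -` {v})" by auto
    ultimately show "q n -` A \<inter> space borel \<in> sets borel"
      by (auto intro!: sets.countable_UN'')
  qed simp
  then have [measurable]: "(\<lambda>p. q n (snd p)) \<in> (N \<Otimes>\<^sub>M borel) \<rightarrow>\<^sub>M count_space UNIV"
    by measurable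
  \<comment> \<open>\<open>q n\<close> has values in the countable type \<open>int ^ 'd\<close>. For
    each value the second argument of \<open>f\<close> is frozen, so \<open>meas\<close> applies,
    and countably many measurable pieces are glued.\<close>
  have "(\<lambda>p. f (fst p) (r n (q n (snd p)))) \<in> borel_measurable (N \<Otimes>\<^sub>M borel)"
  proof (rule measurable_compose_countable[where f = "\<lambda>v p. f (fst p) (r n v)"])
    show "(\<lambda>p. f (fst p) (r n v)) \<in> borel_measurable (N \<Otimes>\<^sub>M borel)" for v
      using measurable_compose[OF measurable_fst meas] .
  qed measurable
  then show "(\<lambda>(x, y). f x (r n (q n y))) \<in> borel_measurable (N \<Otimes>\<^sub>M borel)"
    by (simp add: case_prod_beta')
qed

text \<open>Both mixed derivatives are the limit of the same second-order difference quotient over the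
  square with side \<open>s\<close>, which is symmetric when \<open>k\<close> is.\<close>

lemma mixed_pderiv_sym:
  fixes k :: "real ^ 'd::finite \<Rightarrow> real ^ 'd \<Rightarrow> real"
  assumes k: "kernel_smooth k" and sym: "\<And>x y. k x y = k y x"
  shows "pderiv_at d (\<lambda>a'. pderiv_at d (k a') b) a = pderiv_at d (\<lambda>a'. pderiv_at d (k a') a) b"
proof -
  let ?e = "axis d (1::real)"
  define F where "F a b = pderiv_at d (\<lambda>a'. pderiv_at d (k a') b) a" for a b
  define D where "D s a b = k (a + s *\<^sub>R ?e) (b + s *\<^sub>R ?e) - k (a + s *\<^sub>R ?e) b - k a (b + s *\<^sub>R ?e) + k a b"
    for s a b
  have diff2: "k x differentiable (at y)" for x y
    using k by (simp add: kernel_smooth_def cont_diff_def)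
  have d1: "((\<lambda>t. k x (b + t *\<^sub>R ?e)) has_real_derivative pderiv_at d (k x) (b + t *\<^sub>R ?e)) (at t)" for x b t
    using diff2 by (rule differentiable_axis_DERIV)
  have d12: "((\<lambda>h. pderiv_at d (k (a + h *\<^sub>R ?e)) b) has_real_derivative F (a + t *\<^sub>R ?e) b) (at t)" for a b t
  proof -
    let ?g = "\<lambda>h. pderiv_at d (k ((a + t *\<^sub>R ?e) + h *\<^sub>R ?e)) b"
    have "?g field_differentiable (at 0)"
      using k by (simp add: kernel_smooth_def)
    then have "(?g has_real_derivative F (a + t *\<^sub>R ?e) b) (at 0)"
      unfolding F_def pderiv_at_def[of d "\<lambda>a'. pderiv_at d (k a') b"]
      by (rule DERIV_deriv_iff_field_differentiable[THEN iffD2])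
    then have "((\<lambda>h. ?g (h - t)) has_real_derivative F (a + t *\<^sub>R ?e) b) (at t)"
      using DERIV_shift[of "\<lambda>h. ?g (h - t)" "F (a + t *\<^sub>R ?e) b" 0 t] by simp
    then show ?thesis
      by (simp add: scaleR_left_diff_distrib add.assoc)
  qed
  \<comment> \<open>The mean value theorem is used first in the second argument, for the difference
    of two rows of \<open>k\<close>, and then in the first argument of the inner derivative. This is
    the order in which \<open>kernel_smooth\<close> provides the mixed derivative.\<close>
  have mvt: "\<exists>x t. 0 < x \<and> x < s \<and> 0 < t \<and> t < s \<and> D s a b = s\<^sup>2 * F (a + x *\<^sub>R ?e) (b + t *\<^sub>R ?e)"
    if s: "s > 0" for s a b
  proof -
    obtain t where t: "0 < t" "t < s"
      "(k (a + s *\<^sub>R ?e) (b + s *\<^sub>R ?e) - k a (b + s *\<^sub>R ?e)) - (k (a + s *\<^sub>R ?e) (b + 0 *\<^sub>R ?e) - k a (b + 0 *\<^sub>R ?e)) =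
        (s - 0) * (pderiv_at d (k (a + s *\<^sub>R ?e)) (b + t *\<^sub>R ?e) - pderiv_at d (k a) (b + t *\<^sub>R ?e))"
      using MVT2[OF s, of "\<lambda>t. k (a + s *\<^sub>R ?e) (b + t *\<^sub>R ?e) - k a (b + t *\<^sub>R ?e)"
        "\<lambda>t. pderiv_at d (k (a + s *\<^sub>R ?e)) (b + t *\<^sub>R ?e) - pderiv_at d (k a) (b + t *\<^sub>R ?e)",
        OF DERIV_diff[OF d1 d1]] by blast
    obtain x where x: "0 < x" "x < s"
      "pderiv_at d (k (a + s *\<^sub>R ?e)) (b + t *\<^sub>R ?e) - pderiv_at d (k (a + 0 *\<^sub>R ?e)) (b + t *\<^sub>R ?e) =
        (s - 0) * F (a + x *\<^sub>R ?e) (b + t *\<^sub>R ?e)"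
      using MVT2[OF s, of "\<lambda>x. pderiv_at d (k (a + x *\<^sub>R ?e)) (b + t *\<^sub>R ?e)"
        "\<lambda>x. F (a + x *\<^sub>R ?e) (b + t *\<^sub>R ?e)"] d12 by blast
    have "D s a b = s\<^sup>2 * F (a + x *\<^sub>R ?e) (b + t *\<^sub>R ?e)"
      using t(3) x(3) by (simp add: D_def power2_eq_square)
    then show ?thesis using t x by blast
  qed
  have lim: "(\<lambda>n. D (inverse (real (Suc n))) a b / (inverse (real (Suc n)))\<^sup>2) \<longlonglongrightarrow> F a b" for a b
  proof -
    let ?s = "\<lambda>n. inverse (real (Suc n))"
    have "\<forall>n. \<exists>p. 0 < fst p \<and> fst p < ?s n \<and> 0 < snd p \<and> snd p < ?s n \<and>
        D (?s n) a b = (?s n)\<^sup>2 * F (a + fst p *\<^sub>R ?e) (b + snd p *\<^sub>R ?e)"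
      using mvt[of "?s n" a b for n] by simp
    then obtain p where p: "\<And>n. 0 < fst (p n) \<and> fst (p n) < ?s n \<and> 0 < snd (p n) \<and> snd (p n) < ?s n \<and>
        D (?s n) a b = (?s n)\<^sup>2 * F (a + fst (p n) *\<^sub>R ?e) (b + snd (p n) *\<^sub>R ?e)"
      by metis
    have "(\<lambda>n. fst (p n)) \<longlonglongrightarrow> 0"
      by (rule tendsto_sandwich[OF _ _ tendsto_const LIMSEQ_inverse_real_of_nat])
         (use p in \<open>auto intro!: always_eventually less_imp_le simp del: of_nat_Suc\<close>)
    moreover have "(\<lambda>n. snd (p n)) \<longlonglongrightarrow> 0"
      by (rule tendsto_sandwich[OF _ _ tendsto_const LIMSEQ_inverse_real_of_nat])
         (use p in \<open>auto intro!: always_eventually less_imp_le simp del: of_nat_Suc\<close>)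
    ultimately have "(\<lambda>n. (a + fst (p n) *\<^sub>R ?e, b + snd (p n) *\<^sub>R ?e)) \<longlonglongrightarrow> (a + 0 *\<^sub>R ?e, b + 0 *\<^sub>R ?e)"
      by (intro tendsto_intros)
    moreover have "continuous_on UNIV (\<lambda>(a, b). F a b)"
      using k by (simp add: kernel_smooth_def F_def[abs_def])
    then have "isCont (\<lambda>(a, b). F a b) (a + 0 *\<^sub>R ?e, b + 0 *\<^sub>R ?e)"
      by (simp add: continuous_on_eq_continuous_at)
    ultimately have "(\<lambda>n. F (a + fst (p n) *\<^sub>R ?e) (b + snd (p n) *\<^sub>R ?e)) \<longlonglongrightarrow> F a b"
      using isCont_tendsto_compose by fastforce
    moreover have "D (?s n) a b / (?s n)\<^sup>2 = F (a + fst (p n) *\<^sub>R ?e) (b + snd (p n) *\<^sub>R ?e)" for n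
      using p[of n] by (simp del: of_nat_Suc)
    ultimately show ?thesis by simp
  qed
  have "D s a b = D s b a" for s
    unfolding D_def using sym[of "a + s *\<^sub>R ?e" "b + s *\<^sub>R ?e"] sym[of "a + s *\<^sub>R ?e" b]
      sym[of a "b + s *\<^sub>R ?e"] sym[of a b] by simp
  with lim[of a b] have "(\<lambda>n. D (inverse (real (Suc n))) b a / (inverse (real (Suc n)))\<^sup>2) \<longlonglongrightarrow> F a b"
    by simp
  from LIMSEQ_unique[OF this lim[of b a]] show ?thesis
    by (simp add: F_def)
qed

section \<open>Measurability and symmetry of the difference kernel\<close>

lemma obs_base_simps [simp]:
  "obs_base Continuous = lborel" "obs_base (Discrete L) = count_space (grid L)"
  by (simp_all add: obs_base_def)

lemma measurable_vec_lambda: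
  fixes f :: "'d::finite \<Rightarrow> 'a \<Rightarrow> real"
  assumes "\<And>d. f d \<in> borel_measurable M"
  shows "(\<lambda>x. \<chi> d. f d x) \<in> borel_measurable M"
proof (rule borel_measurable_euclidean_space[THEN iffD2], rule ballI)
  fix i :: "real ^ 'd" assume "i \<in> Basis"
  then have "\<exists>d. i = axis d 1"
    unfolding Basis_vec_def by simp
  then obtain d where "i = axis d 1" ..
  then have "(\<chi> d. f d x) \<bullet> i = f d x" for x
    by (simp add: inner_axis)
  with assms[of d] show "(\<lambda>x. (\<chi> d. f d x) \<bullet> i) \<in> borel_measurable M"
    by presburger
qed

lemma measurable_count_space_pair:
  assumes "finite A" "finite B" "range f \<subseteq> space N"
  shows "f \<in> count_space A \<Otimes>\<^sub>M count_space B \<rightarrow>\<^sub>M N"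
  unfolding pair_measure_count_space[OF assms(1,2)] measurable_count_space_eq1
  using assms(3) by blast

context
  fixes os :: obs_space and k :: "real ^ 'd::finite \<Rightarrow> real ^ 'd \<Rightarrow> real"
  assumes k: "stein_kernel os k"
begin

text \<open>On the continuous space smoothness is given in each argument separately, so
  \<open>k\<close> is known to be separately continuous, and \<open>caratheodory_measurable\<close>
  makes that enough. On the lattice the product space is finite and discrete.\<close>

lemma kernel_measurable: "(\<lambda>(x, y). k x y) \<in> borel_measurable (obs_base os \<Otimes>\<^sub>M obs_base os)"
proof (cases os)
  case Continuous
  then have smooth: "kernel_smooth k"
    using k by (simp add: stein_kernel_def)
  have cont: "continuous_on UNIV (k x)" "continuous_on UNIV (\<lambda>x. k x y)" for x y
    using smooth unfolding kernel_smooth_def cont_diff_def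
    by (auto intro!: differentiable_imp_continuous_on simp: differentiable_on_def)
  have "(\<lambda>(x, y). k x y) \<in> borel_measurable (borel \<Otimes>\<^sub>M borel)"
    by (intro caratheodory_measurable cont borel_measurable_continuous_onI)
  then show ?thesis using Continuous by simp
next
  case (Discrete L)
  show ?thesis
    unfolding Discrete obs_base_simps by (rule measurable_count_space_pair[OF finite_grid finite_grid]) simp
qed

lemma ker1_measurable: "(\<lambda>(x, y). ker1 os k x y) \<in> borel_measurable (obs_base os \<Otimes>\<^sub>M obs_base os)"
proof (cases os)
  case Continuous
  then have smooth: "kernel_smooth k"
    using k by (simp add: stein_kernel_def)
  have "(\<lambda>(x, y). pderiv_at d (\<lambda>x. k x y) x) \<in> borel_measurable (borel \<Otimes>\<^sub>M borel)" for d
    using kernel_measurable smooth Continuous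
    by (intro measurable_pderiv_at) (auto simp: kernel_smooth_def cont_diff_def)
  then have "(\<lambda>p. \<chi> d. pderiv_at d (\<lambda>x. k x (snd p)) (fst p)) \<in> borel_measurable (borel \<Otimes>\<^sub>M borel)"
    by (intro measurable_vec_lambda) (simp add: case_prod_beta')
  then show ?thesis
    using Continuous by (simp add: ker1_def bwd_def case_prod_beta')
next
  case (Discrete L)
  show ?thesis
    unfolding Discrete obs_base_simps by (rule measurable_count_space_pair[OF finite_grid finite_grid]) simp
qed

lemma ker12_measurable: "(\<lambda>(x, y). ker12 os k x y) \<in> borel_measurable (obs_base os \<Otimes>\<^sub>M obs_base os)"
proof (cases os)
  case Continuous
  then have smooth: "kernel_smooth k"
    using k by (simp add: stein_kernel_def)
  \<comment> \<open>In contrast to \<open>k\<close> itself, the mixed derivatives are assumed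
    jointly continuous.\<close>
  have "(\<lambda>(a, b). pderiv_at d (\<lambda>a'. pderiv_at d (k a') b) a) \<in> borel_measurable (borel \<Otimes>\<^sub>M borel)" for d
    using smooth unfolding borel_prod
    by (intro borel_measurable_continuous_onI) (simp add: kernel_smooth_def)
  then have "(\<lambda>(a, b). \<Sum>d\<in>UNIV. pderiv_at d (\<lambda>a'. pderiv_at d (k a') b) a) \<in> borel_measurable (borel \<Otimes>\<^sub>M borel)"
    unfolding case_prod_beta' by (intro borel_measurable_sum)
  then show ?thesis
    using Continuous by (simp add: ker12_def bwd_def)
next
  case (Discrete L)
  show ?thesis
    unfolding Discrete obs_base_simps by (rule measurable_count_space_pair[OF finite_grid finite_grid]) simp
qed

lemma kernel_sym: "x \<in> space (obs_base os) \<Longrightarrow> y \<in> space (obs_base os) \<Longrightarrow> k x y = k y x"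
  using k unfolding stein_kernel_def pos_def_kernel_def by blast

lemma ker12_sym:
  assumes "x \<in> space (obs_base os)" "y \<in> space (obs_base os)"
  shows "ker12 os k x y = ker12 os k y x"
proof (cases os)
  case Continuous
  then have "kernel_smooth k" and "\<And>x y. k x y = k y x"
    using k kernel_sym by (auto simp: stein_kernel_def)
  then show ?thesis
    using Continuous mixed_pderiv_sym[of k] by (simp add: ker12_def bwd_def)
next
  case (Discrete L)
  have "bwd os d (\<lambda>a. bwd os d (k a) y) x = bwd os d (\<lambda>a. bwd os d (k a) x) y" for d
  proof -
    \<comment> \<open>The mixed difference has four kernel values. \<open>k\<close> is symmetric
      only on the lattice, so the shifted points must be seen to stay in it.\<close>
    have "x \<in> grid L" "y \<in> grid L"
        "cyc_shift L d (-1) x \<in> grid L" "cyc_shift L d (-1) y \<in> grid L"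
      using assms Discrete cyc_shift_grid_bwd by auto
    then show ?thesis
      using Discrete kernel_sym by (simp add: bwd_def)
  qed
  then show ?thesis by (simp add: ker12_def)
qed

end

lemma cond_score_measurable:
  fixes P :: "('z::polish_space, 'd::finite) lvm"
  assumes P: "latent_model os P"
  shows "(\<lambda>(x, z). cond_score os P x z) \<in> borel_measurable (obs_base os \<Otimes>\<^sub>M borel)"
proof -
  have lik: "(\<lambda>(x, z). lik P z x) \<in> borel_measurable (obs_base os \<Otimes>\<^sub>M borel)"
    using P by (simp add: latent_model_def)
  have "(\<lambda>(x, z). fwd os d (lik P z) x) \<in> borel_measurable (obs_base os \<Otimes>\<^sub>M borel)" for d
  proof (cases os)
    case Continuous
    have "(\<lambda>(x, z). pderiv_at d (lik P z) x) \<in> borel_measurable (borel \<Otimes>\<^sub>M borel)"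
      using lik P Continuous
      by (intro measurable_pderiv_at) (auto simp: latent_model_def is_density_def cont_diff_def)
    then show ?thesis
      using Continuous by (simp add: fwd_def)
  next
    case (Discrete L)
    have "(\<lambda>p. (cyc_shift L d 1 (fst p), snd p)) \<in>
        (count_space (grid L) \<Otimes>\<^sub>M borel) \<rightarrow>\<^sub>M (count_space (grid L) \<Otimes>\<^sub>M (borel :: 'z measure))"
      by (intro measurable_Pair measurable_snd measurable_compose[OF measurable_fst])
         (auto intro: cyc_shift_grid_fwd)
    from measurable_compose[OF this lik[unfolded Discrete obs_base_simps]] show ?thesis
      using lik Discrete by (simp add: fwd_def case_prod_beta')
  qed
  then have "(\<lambda>p. \<chi> d. fwd os d (lik P (snd p)) (fst p) / lik P (snd p) (fst p)) \<in>
      borel_measurable (obs_base os \<Otimes>\<^sub>M borel)"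
    using lik by (intro measurable_vec_lambda borel_measurable_divide) (simp_all add: case_prod_beta')
  then show ?thesis
    by (simp add: cond_score_def case_prod_beta')
qed

lemma mean_score_measurable:
  fixes P :: "('z::polish_space, 'd::finite) lvm"
  assumes P: "latent_model os P"
    and f: "f \<in> A \<rightarrow>\<^sub>M obs_base os" and g: "g \<in> A \<rightarrow>\<^sub>M PiM {1..m} (\<lambda>_. borel)"
  shows "(\<lambda>a. mean_score os P m (f a) (g a)) \<in> borel_measurable A"
proof -
  have "(\<lambda>a. cond_score os P (f a) (g a j)) \<in> borel_measurable A" if j: "j \<in> {1..m}" for j
  proof -
    have "(\<lambda>a. g a j) \<in> A \<rightarrow>\<^sub>M borel"
      by (rule measurable_compose[OF g measurable_component_singleton[OF j]])
    from measurable_compose[OF measurable_Pair[OF f this] cond_score_measurable[OF P]]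
    show ?thesis by (simp only: prod.case)
  qed
  then have "(\<lambda>a. \<Sum>j\<in>{1..m}. cond_score os P (f a) (g a j)) \<in> borel_measurable A"
    by (rule borel_measurable_sum)
  then show ?thesis
    unfolding mean_score_def by (rule borel_measurable_scaleR[OF borel_measurable_const])
qed

lemma Hbar_measurable:
  fixes P :: "('z::polish_space, 'd::finite) lvm"
  assumes k: "stein_kernel os k" and P: "latent_model os P"
    and f: "f \<in> A \<rightarrow>\<^sub>M obs_base os" and g: "g \<in> A \<rightarrow>\<^sub>M PiM {1..m} (\<lambda>_. borel)"
    and f': "f' \<in> A \<rightarrow>\<^sub>M obs_base os" and g': "g' \<in> A \<rightarrow>\<^sub>M PiM {1..m} (\<lambda>_. borel)"
  shows "(\<lambda>a. Hbar os k m P (f a, g a) (f' a, g' a)) \<in> borel_measurable A"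
proof -
  have [measurable]: "(\<lambda>a. mean_score os P m (f a) (g a)) \<in> borel_measurable A"
      "(\<lambda>a. mean_score os P m (f' a) (g' a)) \<in> borel_measurable A"
    by (rule mean_score_measurable[OF P f g] mean_score_measurable[OF P f' g'])+
  have [measurable]: "(\<lambda>a. k (f a) (f' a)) \<in> borel_measurable A"
      "(\<lambda>a. ker1 os k (f' a) (f a)) \<in> borel_measurable A"
      "(\<lambda>a. ker1 os k (f a) (f' a)) \<in> borel_measurable A"
      "(\<lambda>a. ker12 os k (f a) (f' a)) \<in> borel_measurable A"
    using measurable_compose[OF measurable_Pair[OF f f'] kernel_measurable[OF k]]
      measurable_compose[OF measurable_Pair[OF f' f] ker1_measurable[OF k]]
      measurable_compose[OF measurable_Pair[OF f f'] ker1_measurable[OF k]]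
      measurable_compose[OF measurable_Pair[OF f f'] ker12_measurable[OF k]]
    by (simp_all only: prod.case)
  show ?thesis
    unfolding Hbar_def prod.case by measurable
qed

lemma Hdiff_measurable:
  fixes P :: "('z::polish_space, 'd::finite) lvm" and Q :: "('w::polish_space, 'd) lvm"
  assumes k: "stein_kernel os k" and P: "latent_model os P" and Q: "latent_model os Q"
  shows "(\<lambda>(a, b). Hdiff os k m P Q a b) \<in>
    borel_measurable (sample_space os m \<Otimes>\<^sub>M sample_space os m)"
proof -
  have "(\<lambda>p. Hbar os k m P (fst (fst p), fst (snd (fst p))) (fst (snd p), fst (snd (snd p)))
      - Hbar os k m Q (fst (fst p), snd (snd (fst p))) (fst (snd p), snd (snd (snd p)))) \<in>
    borel_measurable (sample_space os m \<Otimes>\<^sub>M sample_space os m)"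
    unfolding sample_space_def
    by (intro borel_measurable_diff Hbar_measurable[OF k P] Hbar_measurable[OF k Q]) measurable
  then show ?thesis
    by (simp only: Hdiff_def case_prod_beta' prod.collapse)
qed

text \<open>Exchanging the arguments swaps the two cross terms; the first and last terms are
  symmetric by themselves.\<close>

lemma Hbar_sym:
  assumes k: "stein_kernel os k" and x: "x \<in> space (obs_base os)" "x' \<in> space (obs_base os)"
  shows "Hbar os k m P (x, zs) (x', zs') = Hbar os k m P (x', zs') (x, zs)"
proof -
  let ?m = "mean_score os P m x zs" and ?m' = "mean_score os P m x' zs'"
  have "(?m \<bullet> ?m') * k x x' = (?m' \<bullet> ?m) * k x' x"
    by (rule arg_cong2[of _ _ _ _ "(*)", OF inner_commute kernel_sym[OF k x]])
  moreover have "?m \<bullet> ker1 os k x' x = ker1 os k x' x \<bullet> ?m" "ker1 os k x x' \<bullet> ?m' = ?m' \<bullet> ker1 os k x x'"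
    by (rule inner_commute)+
  ultimately show ?thesis
    unfolding Hbar_def prod.case using ker12_sym[OF k x] by linarith
qed

lemma Hdiff_sym:
  assumes k: "stein_kernel os k"
    and a: "a \<in> space (sample_space os m)" and b: "b \<in> space (sample_space os m)"
  shows "Hdiff os k m P Q a b = Hdiff os k m P Q b a"
proof -
  obtain x zs ws x' zs' ws' where ab: "a = (x, zs, ws)" "b = (x', zs', ws')"
    by (metis prod_cases3)
  have x: "x \<in> space (obs_base os)" "x' \<in> space (obs_base os)"
    using a b by (auto simp: ab sample_space_def space_pair_measure)
  show ?thesis
    by (simp only: ab Hdiff_def prod.case Hbar_sym[OF k x])
qed

section \<open>The central limit theorem for chain samples\<close>

text \<open>Connects the abstract conditional expectation in \<open>\<sigma>_t\<close> with the
  section integral. By the defining property it suffices to test against events of the sigma-algebra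
  generated by \<open>Y 2\<close>.\<close>

lemma (in kernel_sample) cond_exp_second:
  defines "F \<equiv> vimage_algebra (space M) (Y 2) N"
  shows "AE \<omega> in M. real_cond_exp M F (\<lambda>\<omega>. h (Y 1 \<omega>) (Y 2 \<omega>)) \<omega> = section_mean (Y 2 \<omega>)"
proof -
  have Y2: "Y 2 \<in> space M \<rightarrow> space N"
    using Y_space by auto
  have sets_F: "sets F = {Y 2 -` B \<inter> space M | B. B \<in> sets N}"
    unfolding F_def by (rule sets_vimage_algebra2[OF Y2])
  have "subalgebra M F"
    unfolding subalgebra_def using sets_F measurable_sets[OF Y_measurable[of 2]] by (auto simp: F_def)
  then interpret finite_measure_subalgebra M F
    by unfold_locales
  have int_h: "integrable M (\<lambda>\<omega>. h (Y 1 \<omega>) (Y 2 \<omega>))"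
    using integrable_Y_pair[OF h_measurable, of 1 2] integrable_pair by simp
  have int_m: "integrable M (\<lambda>\<omega>. section_mean (Y 2 \<omega>))"
    using integrable_Y[of section_mean 2] integrable_section_mean by simp
  show ?thesis
  proof (rule real_cond_exp_charact[OF _ int_h int_m])
    fix A assume "A \<in> sets F"
    then obtain B where B: "B \<in> sets N" "A = Y 2 -` B \<inter> space M"
      using sets_F by auto
    note B(1)[measurable]
    have A[measurable]: "A \<in> sets M"
      using B measurable_sets[OF Y_measurable] by auto
    \<comment> \<open>\<open>Y 1\<close> is integrated out, with the indicator of
      \<open>Y 2 \<in> B\<close> as the second factor. Symmetry of \<open>h\<close> then turns
      \<open>h (Y 2) (Y 1)\<close> into the integrand of the claim.\<close>
    have "expectation (\<lambda>\<omega>. row_part (Y 2 \<omega>) (Y 1 \<omega>) * (\<lambda>a b. indicator B a) (Y 2 \<omega>) (Y 2 \<omega>)) = 0"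
      by (rule expectation_pair_eq_0[where k = 2 and l = 2]) (simp_all add: integral_row_part)
    also have "expectation (\<lambda>\<omega>. row_part (Y 2 \<omega>) (Y 1 \<omega>) * (\<lambda>a b. indicator B a) (Y 2 \<omega>) (Y 2 \<omega>)) =
        expectation (\<lambda>\<omega>. indicator A \<omega> * h (Y 1 \<omega>) (Y 2 \<omega>) - indicator A \<omega> * section_mean (Y 2 \<omega>))"
      by (rule Bochner_Integration.integral_cong[OF refl])
         (auto simp: row_part_def B(2) indicator_def h_sym[OF Y_space Y_space])
    also have "\<dots> = expectation (\<lambda>\<omega>. indicator A \<omega> * h (Y 1 \<omega>) (Y 2 \<omega>)) -
        expectation (\<lambda>\<omega>. indicator A \<omega> * section_mean (Y 2 \<omega>))"
      using integrable_mult_indicator[OF A int_h] integrable_mult_indicator[OF A int_m]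
      by (intro Bochner_Integration.integral_diff) simp_all
    finally show "(\<integral>\<omega>\<in>A. h (Y 1 \<omega>) (Y 2 \<omega>) \<partial>M) = (\<integral>\<omega>\<in>A. section_mean (Y 2 \<omega>) \<partial>M)"
      by (simp add: set_lebesgue_integral_def)
  next
    have "Y 2 \<in> F \<rightarrow>\<^sub>M N"
      unfolding F_def by (rule measurable_vimage_algebra1[OF Y2])
    then show "(\<lambda>\<omega>. section_mean (Y 2 \<omega>)) \<in> borel_measurable F"
      by (rule measurable_compose) simp
  qed
qed

text \<open>Hence \<open>\<sigma>_t^2\<close> is \<open>4 * proj_var\<close>, the form in which the
  variance enters \<open>jackknife_clt\<close>.\<close>

lemma (in kernel_sample) variance_cond_exp_second:
  "variance (real_cond_exp M (vimage_algebra (space M) (Y 2) N) (\<lambda>\<omega>. h (Y 1 \<omega>) (Y 2 \<omega>))) = proj_var"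
    (is "variance ?E = _")
proof -
  have E: "expectation ?E = mean"
  proof -
    have "expectation ?E = expectation (\<lambda>\<omega>. section_mean (Y 2 \<omega>))"
      using cond_exp_second by (intro integral_cong_AE) auto
    also have "\<dots> = mean"
      unfolding mean_def by (rule expectation_Y) simp
    finally show ?thesis .
  qed
  have "variance ?E = expectation (\<lambda>\<omega>. (proj (Y 2 \<omega>))\<^sup>2)"
    unfolding E
  proof (rule integral_cong_AE)
    show "AE \<omega> in M. (?E \<omega> - mean)\<^sup>2 = (proj (Y 2 \<omega>))\<^sup>2"
      using cond_exp_second by eventually_elim (simp add: proj_def)
  qed simp_all
  then show ?thesis
    by (simp add: proj_square_sample)
qed

lemma ustat_cong: "(\<And>i. i \<in> I \<Longrightarrow> y i = y' i) \<Longrightarrow> ustat h I y = ustat h I y'"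
  unfolding ustat_def by (intro arg_cong2[where f = "(/)"] sum.cong) auto

lemma jackknife_var_cong:
  assumes "\<And>i. i \<in> {1..n} \<Longrightarrow> y i = y' i"
  shows "jackknife_var h n y = jackknife_var h n y'"
proof -
  have "ustat h ({1..n} - {i}) y = ustat h ({1..n} - {i}) y'" "ustat h {1..n} y = ustat h {1..n} y'" for i
    using assms by (intro ustat_cong; simp)+
  then show ?thesis by (simp add: jackknife_var_def)
qed

lemma studentized_measurable:
  assumes "\<And>i j. (\<lambda>\<omega>. h (Y i \<omega>) (Y j \<omega>)) \<in> borel_measurable M"
  shows "(\<lambda>\<omega>. a * (ustat h {1..n} (\<lambda>i. Y i \<omega>) - \<mu>) / sqrt (jackknife_var h n (\<lambda>i. Y i \<omega>))) \<in> borel_measurable M"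
proof -
  note assms [measurable]
  show ?thesis
    unfolding jackknife_var_def ustat_altdef[OF finite_Diff[OF finite_atLeastAtMost]]
      ustat_altdef[OF finite_atLeastAtMost] by measurable
qed

text \<open>A bound \<open>D\<close> strictly between the limsup and infinity is used, as the
  sequence may exceed its limsup forever.\<close>

lemma eventually_bounded_of_limsup:
  fixes X :: "nat \<Rightarrow> ennreal"
  assumes "limsup X < \<infinity>"
  obtains C :: real where "C \<ge> 0" "eventually (\<lambda>s. X s \<le> ennreal C) sequentially"
proof -
  obtain D where D: "limsup X < D" "D < \<infinity>"
    using dense[OF assms] by blast
  then obtain C where C: "C \<ge> 0" "D = ennreal C"
    by (cases D) auto
  have "eventually (\<lambda>s. X s < D) sequentially"
    using D(1) by (rule Limsup_lessD)
  then have "eventually (\<lambda>s. X s \<le> ennreal C) sequentially"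
    unfolding C(2) by (rule eventually_mono) (rule less_imp_le)
  then show ?thesis
    by (rule that[OF C(1)])
qed

theorem corollary1:
  fixes os :: obs_space
    and P :: "('z::polish_space, 'd::finite) lvm"
    and Q :: "('w::polish_space, 'd) lvm"
    and R :: "(real ^ 'd) measure"
    and k :: "real ^ 'd \<Rightarrow> real ^ 'd \<Rightarrow> real"
    and H :: "(real ^ 'd \<Rightarrow> real) set"
    and ip :: "(real ^ 'd \<Rightarrow> real) \<Rightarrow> (real ^ 'd \<Rightarrow> real) \<Rightarrow> real"
    and m :: nat
    and cP :: "('z, 'd) sampler"
    and cQ :: "('w, 'd) sampler"
    and M :: "'o measure"
    and y :: "nat \<Rightarrow> nat \<Rightarrow> 'o \<Rightarrow> (real ^ 'd) \<times> (nat \<Rightarrow> 'z) \<times> (nat \<Rightarrow> 'w)"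
    and h :: "(real ^ 'd) \<times> (nat \<Rightarrow> 'z) \<times> (nat \<Rightarrow> 'w) \<Rightarrow>
              (real ^ 'd) \<times> (nat \<Rightarrow> 'z) \<times> (nat \<Rightarrow> 'w) \<Rightarrow> real"
    and \<mu> \<sigma>2 :: real
    and \<theta> :: "nat \<Rightarrow> real"
    and U v :: "nat \<Rightarrow> nat \<Rightarrow> 'o \<Rightarrow> real"
    and t :: "nat \<Rightarrow> nat"
  assumes obs: "valid_obs os"
    and models: "latent_model os P" "latent_model os Q"
    and R: "prob_space R" "sets R = sets (obs_base os)"
    and kernel: "stein_kernel os k" "is_rkhs (space (obs_base os)) k H ip"
    and ksd: "ksd_assms os H ip P R" "ksd_assms os H ip Q R"
    and m: "m \<ge> 1"
    and chains: "targets_posterior os P cP" "targets_posterior os Q cQ"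
    and M: "prob_space M"
    and draws: "\<And>s i. s \<ge> 1 \<Longrightarrow> i \<ge> 1 \<Longrightarrow> is_chain_draw os R cP cQ m s M (y s i)"
    and iid: "\<And>s. s \<ge> 1 \<Longrightarrow> iid_vars M (sample_space os m) (y s) {1..}"
    and h_def: "h = Hdiff os k m P Q"
    and U_def: "\<And>n s \<omega>. U n s \<omega> = ustat h {1..n} (\<lambda>i. y s i \<omega>)"
    and v_def: "\<And>n s \<omega>. v n s \<omega> = jackknife_var h n (\<lambda>i. y s i \<omega>)"
    and \<mu>_def: "\<mu> = (real_of_ereal (ksd os H ip P R))\<^sup>2 - (real_of_ereal (ksd os H ip Q R))\<^sup>2"
    and \<theta>_def: "\<And>s. \<theta> s = (\<integral> \<omega>. h (y s 1 \<omega>) (y s 2 \<omega>) \<partial>M)"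
    and a: "limsup (\<lambda>s. \<integral>\<^sup>+ \<omega>. ennreal (h (y s 1 \<omega>) (y s 2 \<omega>) ^ 4) \<partial>M) < \<infinity>"
    and b: "limsup (\<lambda>s. moment_norm 3 M (\<lambda>\<omega>. h (y s 1 \<omega>) (y s 2 \<omega>) - \<theta> s)) < \<infinity>"
    and c: "(\<lambda>s. 4 * prob_space.variance M
               (real_cond_exp M (vimage_algebra (space M) (y s 2) (sample_space os m))
                 (\<lambda>\<omega>. h (y s 1 \<omega>) (y s 2 \<omega>)))) \<longlonglongrightarrow> \<sigma>2"
      "\<sigma>2 > 0"
    and d: "\<theta> \<longlonglongrightarrow> \<mu>"
    and t: "\<And>n. t n \<ge> 1" "filterlim t at_top sequentially"
      "(\<lambda>n. sqrt (real n) * (\<theta> (t n) - \<mu>)) \<longlonglongrightarrow> 0"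
  shows "weak_conv_m
      (\<lambda>n. distr M borel (\<lambda>\<omega>. sqrt (real n) * (U n (t n) \<omega> - \<mu>) / sqrt (v n (t n) \<omega>)))
      std_normal_distribution"
proof -
  interpret prob_space M by (rule M)
  let ?N = "sample_space os m :: ((real ^ 'd) \<times> (nat \<Rightarrow> 'z) \<times> (nat \<Rightarrow> 'w)) measure"
  \<comment> \<open>Index 0 carries no assumption on \<open>y\<close>, while
    \<open>kernel_sample\<close> wants every index to have the common law. Redirecting 0 to 1 is
    invisible to \<open>U\<close> and \<open>v\<close>, which read only the indices
    \<open>1..n\<close>.\<close>
  define Y where "Y s i = y s (max 1 i)" for s i
  have Y: "Y s i = y s i" if "i \<ge> 1" for s i
    using that by (simp add: Y_def max_def)
  have Y_meas: "Y s i \<in> M \<rightarrow>\<^sub>M ?N" if "s \<ge> 1" for s i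
    unfolding Y_def using draws[OF that, of "max 1 i"] by (simp add: is_chain_draw_def)
  have h_meas: "(\<lambda>(a, b). h a b) \<in> borel_measurable (?N \<Otimes>\<^sub>M ?N)"
    unfolding h_def by (rule Hdiff_measurable[OF kernel(1) models])
  have hY_meas: "(\<lambda>\<omega>. h (Y s i \<omega>) (Y s j \<omega>)) \<in> borel_measurable M" if "s \<ge> 1" for s i j
    using measurable_compose[OF measurable_Pair[OF Y_meas[OF that] Y_meas[OF that]] h_meas]
    by (simp only: prod.case)
  have sample: "kernel_sample M ?N (Y s) h"
    if s: "s \<ge> 1" and h4: "integrable M (\<lambda>\<omega>. h (y s 1 \<omega>) (y s 2 \<omega>) ^ 4)" for s
  proof unfold_locales
    have "indep_vars (\<lambda>_. ?N) (y s) {1..}"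
      using iid[OF s] by (simp add: iid_vars_def)
    then show "indep_vars (\<lambda>_. ?N) (Y s) {1..}"
      by (subst indep_vars_cong[OF refl Y refl]) auto
    show "Y s i \<in> M \<rightarrow>\<^sub>M ?N" for i
      by (rule Y_meas[OF s])
    show "distr M ?N (Y s i) = distr M ?N (Y s 1)" for i
      using iid[OF s] by (simp add: iid_vars_def Y_def)
    show "(\<lambda>(a, b). h a b) \<in> borel_measurable (?N \<Otimes>\<^sub>M ?N)"
      by (rule h_meas)
    show "h a b = h b a" if "a \<in> space ?N" "b \<in> space ?N" for a b
      unfolding h_def by (rule Hdiff_sym[OF kernel(1) that])
    show "integrable M (\<lambda>\<omega>. h (Y s 1 \<omega>) (Y s 2 \<omega>) ^ 4)"
      using h4 by (simp add: Y)
  qed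

  obtain C where C: "C \<ge> 0"
    "eventually (\<lambda>s. (\<integral>\<^sup>+ \<omega>. ennreal (h (y s 1 \<omega>) (y s 2 \<omega>) ^ 4) \<partial>M) \<le> ennreal C) sequentially"
    using eventually_bounded_of_limsup[OF a] by blast
  \<comment> \<open>The eventual bound on the nonnegative integral yields integrability of the
    fourth power, which the locale demands, together with a bound on \<open>moment4\<close> that no
    longer depends on \<open>s\<close>.\<close>
  have good: "eventually (\<lambda>s. s \<ge> 1 \<and> kernel_sample M ?N (Y s) h \<and> kernel_sample.moment4 M (Y s) h \<le> C) sequentially"
    using C(2) eventually_ge_at_top[of 1]
  proof eventually_elim
    case (elim s)
    let ?X = "\<lambda>\<omega>. h (y s 1 \<omega>) (y s 2 \<omega>) ^ 4"
    have "(\<lambda>\<omega>. h (y s 1 \<omega>) (y s 2 \<omega>)) \<in> borel_measurable M"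
      using hY_meas[OF elim(2), of 1 2] by (simp add: Y)
    then have meas: "?X \<in> borel_measurable M"
      by (rule borel_measurable_power)
    have int: "integrable M ?X"
    proof (rule integrableI_nonneg)
      show "(\<integral>\<^sup>+ \<omega>. ennreal (?X \<omega>) \<partial>M) < \<infinity>"
        using elim(1) by (rule order_le_less_trans) simp
    qed (use meas in simp_all)
    interpret S: kernel_sample M ?N "Y s" h
      by (rule sample[OF elim(2) int])
    have "ennreal (expectation ?X) \<le> ennreal C"
      using elim(1) nn_integral_eq_integral[OF int] by simp
    then have "S.moment4 \<le> C"
      using C(1) by (simp add: S.moment4_def Y)
    then show ?case using elim S.kernel_sample_axioms by blast
  qed

  have T_eq: "sqrt (real n) * (U n (t n) \<omega> - \<mu>) / sqrt (v n (t n) \<omega>) =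
      sqrt (real n) * (ustat h {1..n} (\<lambda>i. Y (t n) i \<omega>) - \<mu>) / sqrt (jackknife_var h n (\<lambda>i. Y (t n) i \<omega>))"
    for n \<omega>
  proof -
    have "ustat h {1..n} (\<lambda>i. Y (t n) i \<omega>) = U n (t n) \<omega>"
      unfolding U_def by (intro ustat_cong) (simp add: Y)
    moreover have "jackknife_var h n (\<lambda>i. Y (t n) i \<omega>) = v n (t n) \<omega>"
      unfolding v_def by (intro jackknife_var_cong) (simp add: Y)
    ultimately show ?thesis by simp
  qed

  show ?thesis
    unfolding T_eq
  proof (rule jackknife_clt[where N = ?N and K = C and ?\<sigma>2.0 = \<sigma>2])
    \<comment> \<open>Properties that hold for late burn-in times \<open>s\<close> hold along
      \<open>t n\<close> for large \<open>n\<close>, because \<open>t\<close> tends to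
      infinity.\<close>
    note good_t = eventually_compose_filterlim[OF good t(2)]
    show "prob_space M" by (rule M)
    show "(\<lambda>\<omega>. sqrt (real n) * (ustat h {1..n} (\<lambda>i. Y (t n) i \<omega>) - \<mu>) /
        sqrt (jackknife_var h n (\<lambda>i. Y (t n) i \<omega>))) \<in> borel_measurable M" for n
      by (rule studentized_measurable) (rule hY_meas[OF t(1)])
    show "eventually (\<lambda>n. kernel_sample M ?N (Y (t n)) h) sequentially"
      using good_t by eventually_elim simp
    show "eventually (\<lambda>n. kernel_sample.moment4 M (Y (t n)) h \<le> C) sequentially"
      using good_t by eventually_elim simp
    show "\<sigma>2 > 0" by (rule c(2))
    \<comment> \<open>The variance is identified with \<open>proj_var\<close> for late
      \<open>s\<close>; only afterwards is the limit in \<open>s\<close> composed with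
      \<open>t\<close>.\<close>
    have "eventually (\<lambda>s. 4 * variance (real_cond_exp M (vimage_algebra (space M) (y s 2) ?N)
        (\<lambda>\<omega>. h (y s 1 \<omega>) (y s 2 \<omega>))) = 4 * kernel_sample.proj_var M ?N (Y s) h) sequentially"
      using good
    proof eventually_elim
      case (elim s)
      then interpret S: kernel_sample M ?N "Y s" h by simp
      show ?case
        using S.variance_cond_exp_second by (simp add: Y)
    qed
    from Lim_transform_eventually[OF c(1) this]
    show "(\<lambda>n. 4 * kernel_sample.proj_var M ?N (Y (t n)) h) \<longlonglongrightarrow> \<sigma>2"
      by (rule filterlim_compose[OF _ t(2)])
    have "eventually (\<lambda>n. sqrt (real n) * (\<theta> (t n) - \<mu>) =
        sqrt (real n) * (kernel_sample.mean M ?N (Y (t n)) h - \<mu>)) sequentially"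
      using good_t
    proof eventually_elim
      case (elim n)
      then interpret S: kernel_sample M ?N "Y (t n)" h by simp
      show ?case
        using S.mean_eq[of 1 2] by (simp add: Y \<theta>_def)
    qed
    from Lim_transform_eventually[OF t(3) this]
    show "(\<lambda>n. sqrt (real n) * (kernel_sample.mean M ?N (Y (t n)) h - \<mu>)) \<longlonglongrightarrow> 0" .
  qed
qed

end
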